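(* Let $G$ be a finite group. The map $T\mapsto\omega_T$ carries the (real vector space of) admissible operators on $L^2(G)$ onto the space of real valued functions on $\widehat{G}$ which vanish at the trivial representation and agree on complex conjugate pairs (i.e. take the same value at $\sigma$ and at $\overline{\sigma}$). Its kernel is the set of admissible $T_\varphi$ with $\varphi^\natural=0$, and it restricts to a linear bijection from $\operatorname{span}_{\mathbb{R}}\{\mathcal{L}_K:K\in\mathcal{K}\}$ onto that space of functions. Moreover, $\operatorname{span}_{\mathbb{R}}\{\mathcal{L}_K:K\in\mathcal{K}\}$ is exactly the set of admissible operators commuting with all right translations.
   Context: $L^2(G)$ is the space of functions $f:G\to\mathbb{C}$ with inner product $\langle f,h\rangle=\frac{1}{|G|}\sum_{g\in G}\overline{f(g)}h(g)$. A linear operator $T:L^2(G)\to L^2(G)$ is admissible if it is Hermitian, commutes with all left translations $(L_af)(g)=f(a^{-1}g)$, annihilates the constant functions, and satisfies $\langle\overline{f},T\overline{f}\rangle=\langle f,Tf\rangle$ for every $f\in L^2(G)$. Right translations are $(R_bf)(g)=f(gb)$, $b\in G$. For $\varphi\in L^2(G)$, $(T_\varphi f)(g)=\sum_{h\in G}\varphi(g^{-1}h)f(h)$; every admissible operator equals $T_\varphi$ for a unique $\varphi$. The conjugation average is $\varphi^\natural(x)=\frac{1}{|G|}\sum_{a\in G}\varphi(axa^{-1})$. $\widehat{G}$ is the set of equivalence classes of irreducible complex representations of $G$, each represented by a unitary matrix representation $\sigma:G\to U(d_\sigma)$ with entries $\sigma_{ij}$; $\overline{\sigma}$ denotes the complex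 conjugate representation; $\mathcal{A}_\sigma=\operatorname{span}\{\sigma_{ij}\}\subseteq L^2(G)$, which every admissible $T$ preserves. For admissible $T$, $\omega_T(\sigma)$ is the mean of the eigenvalues (with multiplicity) of $T$ restricted to $\mathcal{A}_\sigma$. $\mathcal{K}$ is the collection of sets $C\cup C^{-1}$ as $C$ ranges over the conjugacy classes of $G$ other than $\{e\}$. For $K\in\mathcal{K}$, $(A_Kf)(g)=\frac{1}{|K|}\sum_{s\in K}f(gs)$ and $\mathcal{L}_K=I-A_K$. *)

theory Defs
  imports
    "Jordan_Normal_Form.Schur_Decomposition"
    "Jordan_Normal_Form.VS_Connect"
    "HOL-Library.Function_Algebras"
begin

section \<open>Linear structures on function spaces\<close>

definition fscale :: "complex \<Rightarrow> ('b \<Rightarrow> complex) \<Rightarrow> 'b \<Rightarrow> complex" where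
  "fscale c f = (\<lambda>x. c * f x)"

definition rscale :: "real \<Rightarrow> ('b \<Rightarrow> complex) \<Rightarrow> 'b \<Rightarrow> complex" where
  "rscale r f = (\<lambda>x. of_real r * f x)"

definition opscale :: "real \<Rightarrow> ('c \<Rightarrow> 'b \<Rightarrow> complex) \<Rightarrow> 'c \<Rightarrow> 'b \<Rightarrow> complex" where
  "opscale r T = (\<lambda>f x. of_real r * T f x)"

global_interpretation cfun: vector_space "fscale :: complex \<Rightarrow> ('b \<Rightarrow> complex) \<Rightarrow> 'b \<Rightarrow> complex"
  by unfold_locales (auto simp: fscale_def fun_eq_iff algebra_simps)

global_interpretation rfun: vector_space "rscale :: real \<Rightarrow> ('b \<Rightarrow> complex) \<Rightarrow> 'b \<Rightarrow> complex"
  by unfold_locales (auto simp: rscale_def fun_eq_iff algebra_simps)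

global_interpretation rop: vector_space
  "opscale :: real \<Rightarrow> ('c \<Rightarrow> 'b \<Rightarrow> complex) \<Rightarrow> 'c \<Rightarrow> 'b \<Rightarrow> complex"
  by unfold_locales (auto simp: opscale_def fun_eq_iff algebra_simps)


section \<open>The space \<open>L\<^sup>2(G)\<close> and operators on it\<close>

text \<open>
  Functions on \<open>G\<close> are represented by functions on the ambient type that vanish outside
  \<open>carrier G\<close>, and operators on \<open>L\<^sup>2(G)\<close> by maps that are \<open>0\<close> outside \<open>L2 G\<close>.  Hence equality
  in HOL is equality of functions on \<open>G\<close> (resp. of operators on \<open>L\<^sup>2(G)\<close>), and the pointwise
  operations are the vector space operations.
\<close>

definition on_group :: "('a, 'm) monoid_scheme \<Rightarrow> ('a \<Rightarrow> complex) \<Rightarrow> 'a \<Rightarrow> complex" where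
  "on_group G f = (\<lambda>g. if g \<in> carrier G then f g else 0)"

definition L2 :: "('a, 'm) monoid_scheme \<Rightarrow> ('a \<Rightarrow> complex) set" where
  "L2 G = {f. \<forall>g. g \<notin> carrier G \<longrightarrow> f g = 0}"

definition on_L2 :: "('a, 'm) monoid_scheme \<Rightarrow> (('a \<Rightarrow> complex) \<Rightarrow> 'a \<Rightarrow> complex)
    \<Rightarrow> ('a \<Rightarrow> complex) \<Rightarrow> 'a \<Rightarrow> complex" where
  "on_L2 G T = (\<lambda>f. if f \<in> L2 G then on_group G (T f) else 0)"

definition L2_inner :: "('a, 'm) monoid_scheme \<Rightarrow> ('a \<Rightarrow> complex) \<Rightarrow> ('a \<Rightarrow> complex) \<Rightarrow> complex" where
  "L2_inner G f h = (\<Sum>g\<in>carrier G. cnj (f g) * h g) / of_nat (card (carrier G))"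

definition left_trans :: "('a, 'm) monoid_scheme \<Rightarrow> 'a \<Rightarrow> ('a \<Rightarrow> complex) \<Rightarrow> 'a \<Rightarrow> complex" where
  "left_trans G a = on_L2 G (\<lambda>f g. f (inv\<^bsub>G\<^esub> a \<otimes>\<^bsub>G\<^esub> g))"

definition right_trans :: "('a, 'm) monoid_scheme \<Rightarrow> 'a \<Rightarrow> ('a \<Rightarrow> complex) \<Rightarrow> 'a \<Rightarrow> complex" where
  "right_trans G b = on_L2 G (\<lambda>f g. f (g \<otimes>\<^bsub>G\<^esub> b))"

definition L2_operators :: "('a, 'm) monoid_scheme \<Rightarrow> (('a \<Rightarrow> complex) \<Rightarrow> 'a \<Rightarrow> complex) set" where
  "L2_operators G = {T.
     (\<forall>f\<in>L2 G. T f \<in> L2 G) \<and> (\<forall>f. f \<notin> L2 G \<longrightarrow> T f = 0) \<and>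
     (\<forall>f\<in>L2 G. \<forall>h\<in>L2 G. T (f + h) = T f + T h) \<and>
     (\<forall>c. \<forall>f\<in>L2 G. T (fscale c f) = fscale c (T f))}"

definition admissible :: "('a, 'm) monoid_scheme \<Rightarrow> (('a \<Rightarrow> complex) \<Rightarrow> 'a \<Rightarrow> complex) set" where
  "admissible G = {T \<in> L2_operators G.
     (\<forall>f\<in>L2 G. \<forall>h\<in>L2 G. L2_inner G f (T h) = L2_inner G (T f) h) \<and>
     (\<forall>a\<in>carrier G. \<forall>f\<in>L2 G. T (left_trans G a f) = left_trans G a (T f)) \<and>
     (\<forall>c. T (on_group G (\<lambda>_. c)) = 0) \<and>
     (\<forall>f\<in>L2 G. L2_inner G (\<lambda>g. cnj (f g)) (T (\<lambda>g. cnj (f g))) = L2_inner G f (T f))}"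

definition conv_op :: "('a, 'm) monoid_scheme \<Rightarrow> ('a \<Rightarrow> complex)
    \<Rightarrow> ('a \<Rightarrow> complex) \<Rightarrow> 'a \<Rightarrow> complex" where
  "conv_op G \<phi> = on_L2 G (\<lambda>f g. \<Sum>h\<in>carrier G. \<phi> (inv\<^bsub>G\<^esub> g \<otimes>\<^bsub>G\<^esub> h) * f h)"

definition conj_avg :: "('a, 'm) monoid_scheme \<Rightarrow> ('a \<Rightarrow> complex) \<Rightarrow> 'a \<Rightarrow> complex" where
  "conj_avg G \<phi> = on_group G
     (\<lambda>x. (\<Sum>a\<in>carrier G. \<phi> (a \<otimes>\<^bsub>G\<^esub> x \<otimes>\<^bsub>G\<^esub> inv\<^bsub>G\<^esub> a)) / of_nat (card (carrier G)))"

definition conj_class :: "('a, 'm) monoid_scheme \<Rightarrow> 'a \<Rightarrow> 'a set" where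
  "conj_class G x = {a \<otimes>\<^bsub>G\<^esub> x \<otimes>\<^bsub>G\<^esub> inv\<^bsub>G\<^esub> a | a. a \<in> carrier G}"

definition sym_classes :: "('a, 'm) monoid_scheme \<Rightarrow> 'a set set" where
  "sym_classes G =
     {C \<union> m_inv G ` C | C. C \<in> conj_class G ` carrier G \<and> C \<noteq> {\<one>\<^bsub>G\<^esub>}}"

definition avg_op :: "('a, 'm) monoid_scheme \<Rightarrow> 'a set \<Rightarrow> ('a \<Rightarrow> complex) \<Rightarrow> 'a \<Rightarrow> complex" where
  "avg_op G K = on_L2 G (\<lambda>f g. (\<Sum>s\<in>K. f (g \<otimes>\<^bsub>G\<^esub> s)) / of_nat (card K))"

definition class_laplacian :: "('a, 'm) monoid_scheme \<Rightarrow> 'a set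
    \<Rightarrow> ('a \<Rightarrow> complex) \<Rightarrow> 'a \<Rightarrow> complex" where
  "class_laplacian G K = on_L2 G (\<lambda>f. f) - avg_op G K"

definition laplacian_span :: "('a, 'm) monoid_scheme \<Rightarrow> (('a \<Rightarrow> complex) \<Rightarrow> 'a \<Rightarrow> complex) set" where
  "laplacian_span G = rop.span (class_laplacian G ` sym_classes G)"


section \<open>Representations and the dual\<close>

text \<open>
  A representation is a map into matrices; its degree is the dimension of the matrix at \<open>\<one>\<close>.
  Its values outside \<open>carrier G\<close> are irrelevant: two maps agreeing on \<open>carrier G\<close> are equivalent.
\<close>

definition matrix_rep :: "('a, 'm) monoid_scheme \<Rightarrow> nat \<Rightarrow> ('a \<Rightarrow> complex mat) \<Rightarrow> bool" where
  "matrix_rep G d \<sigma> \<longleftrightarrow>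
     (\<forall>g\<in>carrier G. \<sigma> g \<in> carrier_mat d d) \<and> \<sigma> \<one>\<^bsub>G\<^esub> = 1\<^sub>m d \<and>
     (\<forall>g\<in>carrier G. \<forall>h\<in>carrier G. \<sigma> (g \<otimes>\<^bsub>G\<^esub> h) = \<sigma> g * \<sigma> h)"

definition rep_degree :: "('a, 'm) monoid_scheme \<Rightarrow> ('a \<Rightarrow> complex mat) \<Rightarrow> nat" where
  "rep_degree G \<sigma> = dim_row (\<sigma> \<one>\<^bsub>G\<^esub>)"

definition irreducible_reps :: "('a, 'm) monoid_scheme \<Rightarrow> ('a \<Rightarrow> complex mat) set" where
  "irreducible_reps G = {\<sigma>. \<exists>d>0. matrix_rep G d \<sigma> \<and>
     (\<forall>W. VectorSpace.subspace class_ring W (module_vec TYPE(complex) d) \<and>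
          (\<forall>g\<in>carrier G. \<forall>w\<in>W. \<sigma> g *\<^sub>v w \<in> W) \<longrightarrow>
          W = {0\<^sub>v d} \<or> W = carrier_vec d)}"

definition unitary_rep :: "('a, 'm) monoid_scheme \<Rightarrow> ('a \<Rightarrow> complex mat) \<Rightarrow> bool" where
  "unitary_rep G \<sigma> \<longleftrightarrow> (\<forall>g\<in>carrier G. \<sigma> g * mat_adjoint (\<sigma> g) = 1\<^sub>m (rep_degree G \<sigma>))"

definition rep_equiv :: "('a, 'm) monoid_scheme \<Rightarrow> (('a \<Rightarrow> complex mat) \<times> ('a \<Rightarrow> complex mat)) set" where
  "rep_equiv G = {(\<sigma>, \<tau>). \<sigma> \<in> irreducible_reps G \<and> \<tau> \<in> irreducible_reps G \<and>
     rep_degree G \<sigma> = rep_degree G \<tau> \<and>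
     (\<exists>P \<in> carrier_mat (rep_degree G \<sigma>) (rep_degree G \<sigma>). invertible_mat P \<and>
        (\<forall>g\<in>carrier G. P * \<sigma> g = \<tau> g * P))}"

definition dual :: "('a, 'm) monoid_scheme \<Rightarrow> ('a \<Rightarrow> complex mat) set set" where
  "dual G = irreducible_reps G // rep_equiv G"

definition rep_class :: "('a, 'm) monoid_scheme \<Rightarrow> ('a \<Rightarrow> complex mat) \<Rightarrow> ('a \<Rightarrow> complex mat) set" where
  "rep_class G \<sigma> = rep_equiv G `` {\<sigma>}"

definition trivial_rep :: "'a \<Rightarrow> complex mat" where
  "trivial_rep = (\<lambda>_. 1\<^sub>m 1)"

definition conj_rep :: "('a \<Rightarrow> complex mat) \<Rightarrow> 'a \<Rightarrow> complex mat" where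
  "conj_rep \<sigma> = (\<lambda>g. map_mat cnj (\<sigma> g))"

definition coeff_space :: "('a, 'm) monoid_scheme \<Rightarrow> ('a \<Rightarrow> complex mat) \<Rightarrow> ('a \<Rightarrow> complex) set" where
  "coeff_space G \<sigma> = cfun.span
     {on_group G (\<lambda>g. \<sigma> g $$ (i, j)) | i j. i < rep_degree G \<sigma> \<and> j < rep_degree G \<sigma>}"


section \<open>The mean eigenvalue map\<close>

text \<open>
  Multiplicities are dimensions of eigenspaces.  For a Hermitian operator, hence a
  diagonalizable one, these agree with the algebraic multiplicities.
\<close>

definition mean_eigenvalue :: "(('a \<Rightarrow> complex) \<Rightarrow> 'a \<Rightarrow> complex) \<Rightarrow> ('a \<Rightarrow> complex) set \<Rightarrow> complex" where
  "mean_eigenvalue T V =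
     (\<Sum>l \<in> {l. \<exists>f\<in>V. f \<noteq> 0 \<and> T f = fscale l f}.
        of_nat (cfun.dim {f\<in>V. T f = fscale l f}) * l) / of_nat (cfun.dim V)"

text \<open>A choice of a unitary representative in every class.\<close>

definition unitary_choice :: "('a, 'm) monoid_scheme
    \<Rightarrow> (('a \<Rightarrow> complex mat) set \<Rightarrow> 'a \<Rightarrow> complex mat) \<Rightarrow> bool" where
  "unitary_choice G rep \<longleftrightarrow> (\<forall>c\<in>dual G. rep c \<in> c \<and> unitary_rep G (rep c))"

text \<open>Functions on the dual are extended by \<open>0\<close> to arbitrary sets of matrix-valued maps.\<close>

definition omega :: "('a, 'm) monoid_scheme \<Rightarrow> (('a \<Rightarrow> complex mat) set \<Rightarrow> 'a \<Rightarrow> complex mat)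
    \<Rightarrow> (('a \<Rightarrow> complex) \<Rightarrow> 'a \<Rightarrow> complex) \<Rightarrow> ('a \<Rightarrow> complex mat) set \<Rightarrow> complex" where
  "omega G rep T =
     (\<lambda>c. if c \<in> dual G then mean_eigenvalue T (coeff_space G (rep c)) else 0)"

definition symmetric_dual_functions ::
    "('a, 'm) monoid_scheme \<Rightarrow> (('a \<Rightarrow> complex mat) set \<Rightarrow> complex) set" where
  "symmetric_dual_functions G = {F.
     (\<forall>c. c \<notin> dual G \<longrightarrow> F c = 0) \<and> (\<forall>c\<in>dual G. F c \<in> \<real>) \<and>
     F (rep_class G trivial_rep) = 0 \<and>
     (\<forall>\<sigma>\<in>irreducible_reps G. F (rep_class G (conj_rep \<sigma>)) = F (rep_class G \<sigma>))}"

end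

theory Submission
  imports Defs "Jordan_Normal_Form.Spectral_Radius"
begin

text \<open>
  An admissible operator is convolution by a unique real, symmetric kernel \<open>\<phi>\<close> of total mass \<open>0\<close>.
  The trace of \<open>conv_op G \<phi>\<close> on the space of matrix coefficients of \<open>\<sigma>\<close>, computed in the orthonormal
  basis provided by Schur orthogonality, shows that \<open>\<omega>(\<sigma>)\<close> is the sum of \<open>\<phi>(x) \<chi>\<^sub>\<sigma>(x)\<close> over \<open>x\<close>,
  divided by the degree of \<open>\<sigma>\<close>.  Hence \<open>\<omega>\<close> depends only on the conjugation average of \<open>\<phi>\<close>, and the
  operators commuting with right translations, that is those whose kernel is a class function, form
  the span of the class Laplacians.  On class functions \<open>\<omega>\<close> is injective: an
  eigenspace of \<open>conv_op G \<phi>\<close> for a nonzero eigenvalue is invariant under right translations and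
  contains an irreducible subrepresentation, on which the character sum is a nonzero multiple of the eigenvalue.
  It is onto by Fourier inversion with irreducible characters.
\<close>

section \<open>Schur's lemma\<close>

text \<open>\<open>mean_eigenvalue\<close> weights eigenvalues by dimensions of eigenspaces, whereas
  Schur orthogonality yields matrix entries. The link is the spectral theorem on the coefficient
  space: in an orthonormal eigenbasis the mean is trace over dimension, and the trace may then be
  computed in any other orthonormal basis. Bases are sets of functions, while spectra and
  irreducibility are notions about matrices; orthonormal coordinates translate between the two. The
  conditions on kernels match those on functions on the dual: total mass 0 is the value 0 at the
  trivial representation, and a real symmetric kernel has the same, real, pairing with a character
  and with its conjugate. Completeness on class functions rests on hermiticity: an eigenbasis of the
  whole space exists, so a nonzero kernel has a nonzero eigenvalue to start from.\<close>

lemma sum_apply: "(\<Sum>a\<in>A. f a) x = (\<Sum>a\<in>A. f a x)"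
  for f :: "'b \<Rightarrow> 'c \<Rightarrow> 'd :: comm_monoid_add"
  by (induction A rule: infinite_finite_induct) auto

text \<open>Turns the locale-based notion of subspace used in \<open>irreducible_reps\<close> into
  plain closure conditions, the form in which \<open>irreducibleD\<close> and
  \<open>irreducibleI\<close> speak of irreducibility.\<close>

lemma subspace_module_vec_iff:
  "VectorSpace.subspace class_ring W (module_vec TYPE(complex) d) \<longleftrightarrow>
    W \<subseteq> carrier_vec d \<and> 0\<^sub>v d \<in> W \<and> (\<forall>v\<in>W. \<forall>w\<in>W. v + w \<in> W) \<and> (\<forall>c. \<forall>v\<in>W. c \<cdot>\<^sub>v v \<in> W)"
proof -
  have "Module.module class_ring (module_vec TYPE(complex) d)"
    by (rule vec_module)
  moreover have "vectorspace class_ring (module_vec TYPE(complex) d)"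
    by (rule vec_vs)
  ultimately show ?thesis
    unfolding VectorSpace.subspace_def submodule_def
    by (simp add: module_vec_simps) blast
qed

lemma mat_mult_unit_vec:
  fixes A :: "'b :: comm_semiring_1 mat"
  assumes "A \<in> carrier_mat m n" "j < n"
  shows "A *\<^sub>v unit_vec n j = col A j"
  using assms by (intro eq_vecI) auto

definition mat_trace :: "complex mat \<Rightarrow> complex" where
  "mat_trace A = (\<Sum>i<dim_row A. A $$ (i, i))"

lemma mat_mult_index:
  assumes "A \<in> carrier_mat m k" "B \<in> carrier_mat k n" "i < m" "j < n"
  shows "(A * B) $$ (i, j) = (\<Sum>l<k. A $$ (i, l) * B $$ (l, j))"
  using assms by (auto simp: scalar_prod_def atLeast0LessThan intro!: sum.cong)

text \<open>The factors may be rectangular; this is what forces equal degrees when an intertwiner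
  has a two-sided inverse.\<close>

lemma mat_trace_comm:
  assumes "A \<in> carrier_mat m n" "B \<in> carrier_mat n m"
  shows "mat_trace (A * B) = mat_trace (B * A)"
proof -
  have "mat_trace (A * B) = (\<Sum>i<m. \<Sum>l<n. A $$ (i, l) * B $$ (l, i))"
    using assms by (auto simp: mat_trace_def mat_mult_index[OF assms] simp del: index_mult_mat(1))
  also have "\<dots> = (\<Sum>l<n. \<Sum>i<m. B $$ (l, i) * A $$ (i, l))"
    by (subst sum.swap) (simp add: mult.commute)
  also have "\<dots> = mat_trace (B * A)"
    using assms by (auto simp: mat_trace_def mat_mult_index[OF assms(2,1)] simp del: index_mult_mat(1))
  finally show ?thesis .
qed

locale finite_group = group G for G (structure) +
  assumes finite_carrier [simp]: "finite (carrier G)"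
begin

lemma card_carrier_pos: "card (carrier G) > 0"
  unfolding card_gt_0_iff using one_closed by auto

lemma sum_left_mult:
  assumes "a \<in> carrier G"
  shows "(\<Sum>x\<in>carrier G. f (a \<otimes> x)) = (\<Sum>x\<in>carrier G. f x)"
proof (rule sum.reindex_bij_witness[where i = "\<lambda>x. inv a \<otimes> x"])
  fix x assume "x \<in> carrier G"
  then show "inv a \<otimes> (a \<otimes> x) = x" "a \<otimes> (inv a \<otimes> x) = x"
    using assms by (simp_all only: m_assoc[symmetric] inv_closed l_inv r_inv l_one)
qed (use assms in simp_all)

lemma sum_right_mult:
  assumes "a \<in> carrier G"
  shows "(\<Sum>x\<in>carrier G. f (x \<otimes> a)) = (\<Sum>x\<in>carrier G. f x)"
proof (rule sum.reindex_bij_witness[where i = "\<lambda>x. x \<otimes> inv a"])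
  fix x assume "x \<in> carrier G"
  then show "(x \<otimes> a) \<otimes> inv a = x" "(x \<otimes> inv a) \<otimes> a = x"
    using assms by (simp_all only: m_assoc inv_closed l_inv r_inv r_one)
qed (use assms in simp_all)

lemma sum_inv: "(\<Sum>x\<in>carrier G. f (inv x)) = (\<Sum>x\<in>carrier G. f x)"
  by (rule sum.reindex_bij_witness[where i = "\<lambda>x. inv x" and j = "\<lambda>x. inv x"]) auto

lemma irreducibleD:
  assumes "\<sigma> \<in> irreducible_reps G"
  shows "rep_degree G \<sigma> > 0"
    and "\<And>g. g \<in> carrier G \<Longrightarrow> \<sigma> g \<in> carrier_mat (rep_degree G \<sigma>) (rep_degree G \<sigma>)"
    and "\<sigma> \<one> = 1\<^sub>m (rep_degree G \<sigma>)"
    and "\<And>g h. g \<in> carrier G \<Longrightarrow> h \<in> carrier G \<Longrightarrow> \<sigma> (g \<otimes> h) = \<sigma> g * \<sigma> h"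
    and "\<And>W. W \<subseteq> carrier_vec (rep_degree G \<sigma>) \<Longrightarrow> 0\<^sub>v (rep_degree G \<sigma>) \<in> W \<Longrightarrow>
      (\<And>v w. v \<in> W \<Longrightarrow> w \<in> W \<Longrightarrow> v + w \<in> W) \<Longrightarrow>
      (\<And>c v. v \<in> W \<Longrightarrow> c \<cdot>\<^sub>v v \<in> W) \<Longrightarrow>
      (\<And>g w. g \<in> carrier G \<Longrightarrow> w \<in> W \<Longrightarrow> \<sigma> g *\<^sub>v w \<in> W) \<Longrightarrow>
      W = {0\<^sub>v (rep_degree G \<sigma>)} \<or> W = carrier_vec (rep_degree G \<sigma>)"
proof -
  from assms obtain d where d: "d > 0" "matrix_rep G d \<sigma>"
    and irr: "\<forall>W. VectorSpace.subspace class_ring W (module_vec TYPE(complex) d) \<and>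
      (\<forall>g\<in>carrier G. \<forall>w\<in>W. \<sigma> g *\<^sub>v w \<in> W) \<longrightarrow> W = {0\<^sub>v d} \<or> W = carrier_vec d"
    unfolding irreducible_reps_def by (elim CollectE exE conjE)
  have deg: "rep_degree G \<sigma> = d"
    using d(2) by (auto simp: matrix_rep_def rep_degree_def)
  show "rep_degree G \<sigma> > 0" using d deg by simp
  show "\<sigma> g \<in> carrier_mat (rep_degree G \<sigma>) (rep_degree G \<sigma>)" if "g \<in> carrier G" for g
    using d that deg by (auto simp: matrix_rep_def)
  show "\<sigma> \<one> = 1\<^sub>m (rep_degree G \<sigma>)" using d deg by (auto simp: matrix_rep_def)
  show "\<sigma> (g \<otimes> h) = \<sigma> g * \<sigma> h" if "g \<in> carrier G" "h \<in> carrier G" for g h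
    using d that by (auto simp: matrix_rep_def)
  show "W = {0\<^sub>v (rep_degree G \<sigma>)} \<or> W = carrier_vec (rep_degree G \<sigma>)"
    if "W \<subseteq> carrier_vec (rep_degree G \<sigma>)" "0\<^sub>v (rep_degree G \<sigma>) \<in> W"
      "\<And>v w. v \<in> W \<Longrightarrow> w \<in> W \<Longrightarrow> v + w \<in> W" "\<And>c v. v \<in> W \<Longrightarrow> c \<cdot>\<^sub>v v \<in> W"
      "\<And>g w. g \<in> carrier G \<Longrightarrow> w \<in> W \<Longrightarrow> \<sigma> g *\<^sub>v w \<in> W" for W
    using irr[rule_format, of W] that unfolding deg subspace_module_vec_iff by simp
qed

lemma irreducibleI:
  assumes "matrix_rep G d \<sigma>" "d > 0"
    and "\<And>W. W \<subseteq> carrier_vec d \<Longrightarrow> 0\<^sub>v d \<in> W \<Longrightarrow>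
      (\<And>v w. v \<in> W \<Longrightarrow> w \<in> W \<Longrightarrow> v + w \<in> W) \<Longrightarrow>
      (\<And>c v. v \<in> W \<Longrightarrow> c \<cdot>\<^sub>v v \<in> W) \<Longrightarrow>
      (\<And>g w. g \<in> carrier G \<Longrightarrow> w \<in> W \<Longrightarrow> \<sigma> g *\<^sub>v w \<in> W) \<Longrightarrow>
      W = {0\<^sub>v d} \<or> W = carrier_vec d"
  shows "\<sigma> \<in> irreducible_reps G"
  unfolding irreducible_reps_def mem_Collect_eq
proof (intro exI[of _ d] conjI allI impI assms(1,2))
  fix W
  assume "VectorSpace.subspace class_ring W (module_vec TYPE(complex) d) \<and>
    (\<forall>g\<in>carrier G. \<forall>w\<in>W. \<sigma> g *\<^sub>v w \<in> W)"
  then show "W = {0\<^sub>v d} \<or> W = carrier_vec d"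
    unfolding subspace_module_vec_iff by (intro assms(3)) auto
qed

text \<open>Kernel and image of \<open>P\<close> are invariant, so each is zero or everything. If
  the kernel is everything, \<open>P\<close> is zero; if it is zero, the image is everything, and
  preimages of the unit vectors are the columns of an inverse. The two degrees are not assumed
  equal.\<close>

lemma schur_lemma:
  assumes \<sigma>: "\<sigma> \<in> irreducible_reps G" and \<tau>: "\<tau> \<in> irreducible_reps G"
    and P: "P \<in> carrier_mat (rep_degree G \<tau>) (rep_degree G \<sigma>)"
    and int: "\<And>g. g \<in> carrier G \<Longrightarrow> P * \<sigma> g = \<tau> g * P"
  obtains "P = 0\<^sub>m (rep_degree G \<tau>) (rep_degree G \<sigma>)"
    | Q where "Q \<in> carrier_mat (rep_degree G \<sigma>) (rep_degree G \<tau>)"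
      "P * Q = 1\<^sub>m (rep_degree G \<tau>)" "Q * P = 1\<^sub>m (rep_degree G \<sigma>)"
proof -
  let ?d = "rep_degree G \<sigma>" and ?e = "rep_degree G \<tau>"
  note S = irreducibleD[OF \<sigma>] and T = irreducibleD[OF \<tau>]
  have eqv: "P *\<^sub>v (\<sigma> g *\<^sub>v v) = \<tau> g *\<^sub>v (P *\<^sub>v v)" if "g \<in> carrier G" "v \<in> carrier_vec ?d" for g v
    using assoc_mult_mat_vec[OF P S(2)[OF that(1)] that(2)]
      assoc_mult_mat_vec[OF T(2)[OF that(1)] P that(2)] int[OF that(1)] by simp
  have ker: "{v \<in> carrier_vec ?d. P *\<^sub>v v = 0\<^sub>v ?e} = {0\<^sub>v ?d} \<or>
        {v \<in> carrier_vec ?d. P *\<^sub>v v = 0\<^sub>v ?e} = carrier_vec ?d"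
  proof (rule S(5), goal_cases)
    case 2 then show ?case using P by auto
  next
    case 3 then show ?case using P by (auto simp: mult_add_distrib_mat_vec)
  next
    case 4 then show ?case using P by (auto simp: mult_mat_vec)
  next
    case (5 g w)
    then show ?case using P S(2)[of g] T(2)[of g] by (auto simp: eqv)
  qed auto
  have zero: "P = 0\<^sub>m ?e ?d" if "{v \<in> carrier_vec ?d. P *\<^sub>v v = 0\<^sub>v ?e} = carrier_vec ?d"
  proof (rule eq_matI)
    fix i j assume ij: "i < dim_row (0\<^sub>m ?e ?d)" "j < dim_col (0\<^sub>m ?e ?d)"
    have "unit_vec ?d j \<in> {v \<in> carrier_vec ?d. P *\<^sub>v v = 0\<^sub>v ?e}" unfolding that by simp
    then have "P *\<^sub>v unit_vec ?d j = 0\<^sub>v ?e" by simp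
    then have "col P j = 0\<^sub>v ?e" using mat_mult_unit_vec[OF P, of j] ij by simp
    then have "col P j $ i = 0" using ij by simp
    then show "P $$ (i, j) = 0\<^sub>m ?e ?d $$ (i, j)" using ij P by simp
  qed (use P in auto)
  have inv: "\<exists>Q \<in> carrier_mat ?d ?e. P * Q = 1\<^sub>m ?e \<and> Q * P = 1\<^sub>m ?d"
    if inj: "{v \<in> carrier_vec ?d. P *\<^sub>v v = 0\<^sub>v ?e} = {0\<^sub>v ?d}"
  proof -
    have "(\<lambda>v. P *\<^sub>v v) ` carrier_vec ?d = {0\<^sub>v ?e} \<or> (\<lambda>v. P *\<^sub>v v) ` carrier_vec ?d = carrier_vec ?e"
    proof (rule T(5), goal_cases)
      case 1 then show ?case using P by auto
    next
      case 2 then show ?case using P by (auto intro!: image_eqI[of _ _ "0\<^sub>v ?d"])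
    next
      case (3 v w)
      then obtain v' w' where "v' \<in> carrier_vec ?d" "w' \<in> carrier_vec ?d" "v = P *\<^sub>v v'" "w = P *\<^sub>v w'"
        by auto
      then show ?case using P
        by (auto intro!: image_eqI[of _ _ "v' + w'"] simp: mult_add_distrib_mat_vec)
    next
      case (4 c v)
      then obtain v' where "v' \<in> carrier_vec ?d" "v = P *\<^sub>v v'" by auto
      then show ?case using P by (auto intro!: image_eqI[of _ _ "c \<cdot>\<^sub>v v'"] simp: mult_mat_vec)
    next
      case (5 g w)
      then obtain v where "v \<in> carrier_vec ?d" "w = P *\<^sub>v v" by auto
      then show ?case using 5 S(2)[of g] by (auto intro!: image_eqI[of _ _ "\<sigma> g *\<^sub>v v"] simp: eqv)
    qed
    moreover have "(\<lambda>v. P *\<^sub>v v) ` carrier_vec ?d \<noteq> {0\<^sub>v ?e}"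
    proof
      assume "(\<lambda>v. P *\<^sub>v v) ` carrier_vec ?d = {0\<^sub>v ?e}"
      moreover have "P *\<^sub>v unit_vec ?d 0 \<in> (\<lambda>v. P *\<^sub>v v) ` carrier_vec ?d" by (rule imageI) simp
      ultimately have "unit_vec ?d 0 \<in> {v \<in> carrier_vec ?d. P *\<^sub>v v = 0\<^sub>v ?e}" by simp
      then have "unit_vec ?d 0 = (0\<^sub>v ?d :: complex vec)" unfolding inj by simp
      then have "unit_vec ?d 0 $ 0 = (0\<^sub>v ?d :: complex vec) $ 0" by simp
      then show False using S(1) by simp
    qed
    ultimately have surj: "(\<lambda>v. P *\<^sub>v v) ` carrier_vec ?d = carrier_vec ?e" by simp
    have "\<exists>v. v \<in> carrier_vec ?d \<and> P *\<^sub>v v = unit_vec ?e i" for i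
    proof -
      have "unit_vec ?e i \<in> (\<lambda>v. P *\<^sub>v v) ` carrier_vec ?d" unfolding surj by simp
      then obtain v where "v \<in> carrier_vec ?d" "unit_vec ?e i = P *\<^sub>v v" by (rule imageE)
      then show ?thesis by (intro exI[of _ v]) simp
    qed
    then have "\<exists>q. \<forall>i. q i \<in> carrier_vec ?d \<and> P *\<^sub>v q i = unit_vec ?e i" by (rule choice[OF allI])
    then obtain q where q': "\<forall>i. q i \<in> carrier_vec ?d \<and> P *\<^sub>v q i = unit_vec ?e i" ..
    have q: "q i \<in> carrier_vec ?d" "P *\<^sub>v q i = unit_vec ?e i" for i using q' by simp_all
    define Q where "Q = mat ?d ?e (\<lambda>(i, j). q j $ i)"
    have Q: "Q \<in> carrier_mat ?d ?e" by (simp add: Q_def)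
    have colQ: "col Q j = q j" if "j < ?e" for j
      using q(1)[of j] that by (intro eq_vecI) (auto simp: Q_def)
    have PQ: "P * Q = 1\<^sub>m ?e"
    proof (rule mat_col_eqI)
      fix j assume "j < dim_col (1\<^sub>m ?e :: complex mat)"
      then have j: "j < ?e" by simp
      have "col (P * Q) j = P *\<^sub>v col Q j" using col_mult2[OF P Q j] .
      then show "col (P * Q) j = col (1\<^sub>m ?e) j" using j by (simp add: colQ q)
    qed (use P Q in auto)
    have QP: "Q * P = 1\<^sub>m ?d"
    proof (rule mat_col_eqI)
      fix j assume "j < dim_col (1\<^sub>m ?d :: complex mat)"
      then have j: "j < ?d" by simp
      \<comment> \<open>\<open>Q\<close> is so far a right inverse only. \<open>P\<close>
        annihilates every column of \<open>Q * P - 1\<close>, and injectivity of \<open>P\<close>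
        makes these columns zero.\<close>
      define w where "w = col (Q * P) j - unit_vec ?d j"
      have cp: "col P j \<in> carrier_vec ?e" using P j by auto
      have c: "col (Q * P) j = Q *\<^sub>v col P j" using col_mult2[OF Q P j] .
      have "P *\<^sub>v (Q *\<^sub>v col P j) = col P j"
        unfolding assoc_mult_mat_vec[OF P Q cp, symmetric] PQ using cp by simp
      then have "P *\<^sub>v w = col P j - col P j"
        unfolding w_def c using P Q j
        by (subst mult_minus_distrib_mat_vec[OF P]) (auto simp: mat_mult_unit_vec[OF P])
      then have "P *\<^sub>v w = 0\<^sub>v ?e" using cp by auto
      moreover have w: "w \<in> carrier_vec ?d" using P Q j by (auto simp: w_def)
      ultimately have "w \<in> {v \<in> carrier_vec ?d. P *\<^sub>v v = 0\<^sub>v ?e}" by simp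
      then have "w = 0\<^sub>v ?d" unfolding inj by simp
      then have eq: "\<And>i. i < ?d \<Longrightarrow> w $ i = 0" by simp
      show "col (Q * P) j = col (1\<^sub>m ?d) j"
      proof (rule eq_vecI)
        fix i assume "i < dim_vec (col (1\<^sub>m ?d :: complex mat) j)"
        then have i: "i < ?d" by simp
        show "col (Q * P) j $ i = col (1\<^sub>m ?d) j $ i"
          using eq[OF i] i j P Q unfolding w_def by simp
      qed (use Q in auto)
    qed (use P Q in auto)
    show ?thesis by (intro bexI[OF _ Q] conjI PQ QP)
  qed
  from ker show thesis
  proof
    assume "{v \<in> carrier_vec ?d. P *\<^sub>v v = 0\<^sub>v ?e} = {0\<^sub>v ?d}"
    from inv[OF this] obtain Q where "Q \<in> carrier_mat ?d ?e" "P * Q = 1\<^sub>m ?e" "Q * P = 1\<^sub>m ?d"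
      by (elim bexE conjE)
    then show thesis by (rule that(2))
  next
    assume "{v \<in> carrier_vec ?d. P *\<^sub>v v = 0\<^sub>v ?e} = carrier_vec ?d"
    from zero[OF this] show thesis by (rule that(1))
  qed
qed

section \<open>Schur orthogonality\<close>

text \<open>Over the complex numbers \<open>P\<close> has an eigenvalue \<open>k\<close>. The
  difference \<open>P - k\<close> is again an intertwiner and annihilates an eigenvector, which
  rules out the invertible alternative of \<open>schur_lemma\<close>.\<close>

lemma schur_scalar:
  assumes \<sigma>: "\<sigma> \<in> irreducible_reps G"
    and P: "P \<in> carrier_mat (rep_degree G \<sigma>) (rep_degree G \<sigma>)"
    and int: "\<And>g. g \<in> carrier G \<Longrightarrow> P * \<sigma> g = \<sigma> g * P"
  obtains c where "P = c \<cdot>\<^sub>m 1\<^sub>m (rep_degree G \<sigma>)"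
proof -
  let ?d = "rep_degree G \<sigma>"
  note S = irreducibleD[OF \<sigma>]
  have "\<exists>k. eigenvalue P k"
    using spectrum_non_empty[OF P S(1)] unfolding spectrum_def by blast
  then obtain k v where "eigenvector P v k" unfolding eigenvalue_def by blast
  then have v: "v \<in> carrier_vec ?d" "v \<noteq> 0\<^sub>v ?d" "P *\<^sub>v v = k \<cdot>\<^sub>v v"
    unfolding eigenvector_def carrier_matD(1)[OF P] by blast+
  define P' where "P' = P - k \<cdot>\<^sub>m 1\<^sub>m ?d"
  have P': "P' \<in> carrier_mat ?d ?d" using P by (auto simp: P'_def)
  have P'v: "P' *\<^sub>v v = 0\<^sub>v ?d"
  proof -
    have "P' *\<^sub>v v = P *\<^sub>v v - (k \<cdot>\<^sub>m 1\<^sub>m ?d) *\<^sub>v v"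
      unfolding P'_def by (rule minus_mult_distrib_mat_vec[OF P _ v(1)]) simp
    also have "(k \<cdot>\<^sub>m 1\<^sub>m ?d) *\<^sub>v v = k \<cdot>\<^sub>v v"
      using v(1) by (intro eq_vecI) auto
    finally show ?thesis using v(1) by (simp add: v(3))
  qed
  have "P' * \<sigma> g = \<sigma> g * P'" if g: "g \<in> carrier G" for g
  proof -
    have "P' * \<sigma> g = P * \<sigma> g - k \<cdot>\<^sub>m \<sigma> g"
      unfolding P'_def using P S(2)[OF g] by (subst minus_mult_distrib_mat) auto
    moreover have "\<sigma> g * P' = \<sigma> g * P - k \<cdot>\<^sub>m \<sigma> g"
      unfolding P'_def using P S(2)[OF g] by (subst mult_minus_distrib_mat) auto
    ultimately show ?thesis using int[OF g] by simp
  qed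
  then have comm: "\<And>g. g \<in> carrier G \<Longrightarrow> P' * \<sigma> g = \<sigma> g * P'" .
  show thesis
  proof (rule schur_lemma[OF \<sigma> \<sigma> P' comm])
    assume 1: "P' = 0\<^sub>m ?d ?d"
    have "P = k \<cdot>\<^sub>m 1\<^sub>m ?d"
    proof (rule eq_matI)
      fix i j assume ij: "i < dim_row (k \<cdot>\<^sub>m 1\<^sub>m ?d)" "j < dim_col (k \<cdot>\<^sub>m 1\<^sub>m ?d)"
      then have "P' $$ (i, j) = 0" unfolding 1 by simp
      then show "P $$ (i, j) = (k \<cdot>\<^sub>m 1\<^sub>m ?d) $$ (i, j)" using ij P by (simp add: P'_def)
    qed (use P in auto)
    then show thesis by (rule that)
  next
    fix Q assume 2: "Q \<in> carrier_mat ?d ?d" "Q * P' = 1\<^sub>m ?d"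
    have "v = (Q * P') *\<^sub>v v" unfolding 2 using v(1) by simp
    also have "\<dots> = Q *\<^sub>v (P' *\<^sub>v v)" by (rule assoc_mult_mat_vec[OF 2(1) P' v(1)])
    also have "\<dots> = 0\<^sub>v ?d"
      using 2(1) unfolding P'v by (intro eq_vecI) auto
    finally have "v = 0\<^sub>v ?d" .
    with v(2) show thesis by (rule notE)
  qed
qed


lemma rep_index_mult:
  assumes \<sigma>: "\<sigma> \<in> irreducible_reps G" and gh: "g \<in> carrier G" "h \<in> carrier G"
    and ij: "i < rep_degree G \<sigma>" "j < rep_degree G \<sigma>"
  shows "\<sigma> (g \<otimes> h) $$ (i, j) = (\<Sum>l<rep_degree G \<sigma>. \<sigma> g $$ (i, l) * \<sigma> h $$ (l, j))"
  unfolding irreducibleD(4)[OF \<sigma> gh]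
  by (rule mat_mult_index[OF irreducibleD(2)[OF \<sigma> gh(1)] irreducibleD(2)[OF \<sigma> gh(2)] ij])

text \<open>\<open>P\<close> is the sum of \<open>\<tau>(x) E \<sigma>(x\<inverse>)\<close> over the group, with \<open>E\<close> the \<open>(j, l)\<close> matrix unit.\<close>

lemma intertwiner:
  assumes \<sigma>: "\<sigma> \<in> irreducible_reps G" and \<tau>: "\<tau> \<in> irreducible_reps G"
    and j: "j < rep_degree G \<tau>" and l: "l < rep_degree G \<sigma>" and g: "g \<in> carrier G"
  defines "P \<equiv> mat (rep_degree G \<tau>) (rep_degree G \<sigma>)
    (\<lambda>(a, b). \<Sum>x\<in>carrier G. \<tau> x $$ (a, j) * \<sigma> (inv x) $$ (l, b))"
  shows "P * \<sigma> g = \<tau> g * P"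
proof (rule eq_matI)
  let ?d = "rep_degree G \<sigma>" and ?e = "rep_degree G \<tau>"
  have P: "P \<in> carrier_mat ?e ?d" by (simp add: P_def)
  note sg = irreducibleD(2)[OF \<sigma> g] and tg = irreducibleD(2)[OF \<tau> g]
  fix a b assume "a < dim_row (\<tau> g * P)" "b < dim_col (\<tau> g * P)"
  then have a: "a < ?e" and b: "b < ?d" using tg P by auto
  have "(P * \<sigma> g) $$ (a, b) = (\<Sum>c<?d. (\<Sum>x\<in>carrier G. \<tau> x $$ (a, j) * \<sigma> (inv x) $$ (l, c)) * \<sigma> g $$ (c, b))"
    unfolding mat_mult_index[OF P sg a b] using a by (intro sum.cong) (auto simp: P_def)
  also have "\<dots> = (\<Sum>x\<in>carrier G. \<tau> x $$ (a, j) * (\<Sum>c<?d. \<sigma> (inv x) $$ (l, c) * \<sigma> g $$ (c, b)))"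
    unfolding sum_distrib_right sum_distrib_left by (subst sum.swap) (simp add: mult.assoc)
  also have "\<dots> = (\<Sum>x\<in>carrier G. \<tau> x $$ (a, j) * \<sigma> (inv x \<otimes> g) $$ (l, b))"
    using l b g by (intro sum.cong) (auto simp: rep_index_mult[OF \<sigma>])
  \<comment> \<open>Replacing \<open>x\<close> by \<open>g \<otimes> x\<close> moves
    \<open>g\<close> from the factor of \<sigma> to the factor of \<tau>.\<close>
  also have "\<dots> = (\<Sum>x\<in>carrier G. \<tau> (g \<otimes> x) $$ (a, j) * \<sigma> (inv (g \<otimes> x) \<otimes> g) $$ (l, b))"
    by (rule sum_left_mult[OF g, symmetric])
  also have "\<dots> = (\<Sum>x\<in>carrier G. (\<Sum>c<?e. \<tau> g $$ (a, c) * \<tau> x $$ (c, j)) * \<sigma> (inv x) $$ (l, b))"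
  proof (intro sum.cong refl)
    fix x assume x: "x \<in> carrier G"
    have "inv (g \<otimes> x) \<otimes> g = inv x"
      using x g by (simp add: inv_mult_group m_assoc)
    then show "\<tau> (g \<otimes> x) $$ (a, j) * \<sigma> (inv (g \<otimes> x) \<otimes> g) $$ (l, b) =
      (\<Sum>c<?e. \<tau> g $$ (a, c) * \<tau> x $$ (c, j)) * \<sigma> (inv x) $$ (l, b)"
      by (simp add: rep_index_mult[OF \<tau> g x a j])
  qed
  also have "\<dots> = (\<Sum>c<?e. \<tau> g $$ (a, c) * (\<Sum>x\<in>carrier G. \<tau> x $$ (c, j) * \<sigma> (inv x) $$ (l, b)))"
    unfolding sum_distrib_right sum_distrib_left by (subst sum.swap) (simp add: mult.assoc)
  also have "\<dots> = (\<tau> g * P) $$ (a, b)"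
    unfolding mat_mult_index[OF tg P a b] using b by (intro sum.cong) (auto simp: P_def)
  finally show "(P * \<sigma> g) $$ (a, b) = (\<tau> g * P) $$ (a, b)" .
qed (use irreducibleD(2)[OF \<sigma> g] irreducibleD(2)[OF \<tau> g] in \<open>auto simp: P_def\<close>)

section \<open>Equivalence of irreducible representations and the orthogonality relations\<close>

lemma rep_equivI:
  assumes "\<sigma> \<in> irreducible_reps G" "\<tau> \<in> irreducible_reps G" "rep_degree G \<sigma> = rep_degree G \<tau>"
    and P: "P \<in> carrier_mat (rep_degree G \<sigma>) (rep_degree G \<sigma>)"
    and Q: "Q \<in> carrier_mat (rep_degree G \<sigma>) (rep_degree G \<sigma>)"
    and "P * Q = 1\<^sub>m (rep_degree G \<sigma>)" "Q * P = 1\<^sub>m (rep_degree G \<sigma>)"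
    and "\<And>g. g \<in> carrier G \<Longrightarrow> P * \<sigma> g = \<tau> g * P"
  shows "(\<sigma>, \<tau>) \<in> rep_equiv G"
proof -
  have "invertible_mat P"
    unfolding invertible_mat_def inverts_mat_def using assms by (auto intro!: exI[of _ Q])
  then show ?thesis using assms by (auto simp: rep_equiv_def)
qed

lemma rep_equivE:
  assumes "(\<sigma>, \<tau>) \<in> rep_equiv G"
  obtains P Q where "\<sigma> \<in> irreducible_reps G" "\<tau> \<in> irreducible_reps G"
    "rep_degree G \<sigma> = rep_degree G \<tau>"
    "P \<in> carrier_mat (rep_degree G \<sigma>) (rep_degree G \<sigma>)"
    "Q \<in> carrier_mat (rep_degree G \<sigma>) (rep_degree G \<sigma>)"
    "P * Q = 1\<^sub>m (rep_degree G \<sigma>)" "Q * P = 1\<^sub>m (rep_degree G \<sigma>)"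
    "\<And>g. g \<in> carrier G \<Longrightarrow> P * \<sigma> g = \<tau> g * P"
proof -
  let ?d = "rep_degree G \<sigma>"
  from assms obtain P where P: "P \<in> carrier_mat ?d ?d" "invertible_mat P"
    "\<forall>g\<in>carrier G. P * \<sigma> g = \<tau> g * P"
    and st: "\<sigma> \<in> irreducible_reps G" "\<tau> \<in> irreducible_reps G" "?d = rep_degree G \<tau>"
    unfolding rep_equiv_def by auto
  from P(2) obtain Q where Q: "P * Q = 1\<^sub>m (dim_row P)" "Q * P = 1\<^sub>m (dim_row Q)"
    unfolding invertible_mat_def inverts_mat_def by auto
  \<comment> \<open>\<open>invertible_mat\<close> leaves the shape of \<open>Q\<close> open; it is
    read off from the dimensions of the two identity matrices.\<close>
  have "dim_row P = ?d" "dim_col P = ?d" using P(1) by auto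
  moreover have "dim_col Q = ?d" using arg_cong[OF Q(1), of dim_col] P(1) by simp
  moreover have "dim_row Q = ?d" using arg_cong[OF Q(2), of dim_col] P(1) by simp
  ultimately have "Q \<in> carrier_mat ?d ?d" "P * Q = 1\<^sub>m ?d" "Q * P = 1\<^sub>m ?d" using Q by auto
  then show thesis using P(3) by (intro that[OF st P(1)]) auto
qed

lemma equiv_rep_equiv: "equiv (irreducible_reps G) (rep_equiv G)"
proof (rule equivI)
  show "rep_equiv G \<subseteq> irreducible_reps G \<times> irreducible_reps G"
    by (auto simp: rep_equiv_def)
  show "refl_on (irreducible_reps G) (rep_equiv G)"
  proof (rule refl_onI)
    fix \<sigma> assume \<sigma>: "\<sigma> \<in> irreducible_reps G"
    show "(\<sigma>, \<sigma>) \<in> rep_equiv G"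
    proof (rule rep_equivI[OF \<sigma> \<sigma>, of "1\<^sub>m (rep_degree G \<sigma>)" "1\<^sub>m (rep_degree G \<sigma>)"])
      fix g assume g: "g \<in> carrier G"
      show "1\<^sub>m (rep_degree G \<sigma>) * \<sigma> g = \<sigma> g * 1\<^sub>m (rep_degree G \<sigma>)"
        using irreducibleD(2)[OF \<sigma> g] by simp
    qed auto
  qed
  show "sym (rep_equiv G)"
  proof (rule symI)
    fix \<sigma> \<tau> assume "(\<sigma>, \<tau>) \<in> rep_equiv G"
    then obtain P Q where \<sigma>: "\<sigma> \<in> irreducible_reps G" and \<tau>: "\<tau> \<in> irreducible_reps G"
      and d: "rep_degree G \<sigma> = rep_degree G \<tau>"
      and P: "P \<in> carrier_mat (rep_degree G \<tau>) (rep_degree G \<tau>)"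
      and Q: "Q \<in> carrier_mat (rep_degree G \<tau>) (rep_degree G \<tau>)"
      and PQ: "P * Q = 1\<^sub>m (rep_degree G \<tau>)" and QP: "Q * P = 1\<^sub>m (rep_degree G \<tau>)"
      and int: "\<And>g. g \<in> carrier G \<Longrightarrow> P * \<sigma> g = \<tau> g * P" by (elim rep_equivE) auto
    show "(\<tau>, \<sigma>) \<in> rep_equiv G"
    proof (rule rep_equivI[OF \<tau> \<sigma> d[symmetric] Q P QP PQ])
      fix g assume g: "g \<in> carrier G"
      note sg = irreducibleD(2)[OF \<sigma> g, unfolded d] and tg = irreducibleD(2)[OF \<tau> g]
      have "Q * \<tau> g = Q * (\<tau> g * (P * Q))" using tg by (simp add: PQ)
      also have "\<dots> = Q * (\<tau> g * P * Q)" by (simp only: assoc_mult_mat[OF tg P Q])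
      also have "\<dots> = Q * (P * \<sigma> g * Q)" by (simp only: int[OF g])
      also have "\<dots> = Q * (P * (\<sigma> g * Q))" by (simp only: assoc_mult_mat[OF P sg Q])
      also have "\<dots> = Q * P * (\<sigma> g * Q)"
        by (rule assoc_mult_mat[OF Q P mult_carrier_mat[OF sg Q], symmetric])
      also have "\<dots> = \<sigma> g * Q" using sg Q by (simp add: QP)
      finally show "Q * \<tau> g = \<sigma> g * Q" .
    qed
  qed
  show "trans (rep_equiv G)"
  proof (rule transI)
    fix \<rho> \<sigma> \<tau> assume "(\<rho>, \<sigma>) \<in> rep_equiv G" "(\<sigma>, \<tau>) \<in> rep_equiv G"
    then obtain P Q P' Q' where \<rho>: "\<rho> \<in> irreducible_reps G" and \<sigma>: "\<sigma> \<in> irreducible_reps G"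
      and \<tau>: "\<tau> \<in> irreducible_reps G" and d: "rep_degree G \<rho> = rep_degree G \<tau>"
      "rep_degree G \<sigma> = rep_degree G \<tau>"
      and P: "P \<in> carrier_mat (rep_degree G \<tau>) (rep_degree G \<tau>)"
      and Q: "Q \<in> carrier_mat (rep_degree G \<tau>) (rep_degree G \<tau>)"
      and PQ: "P * Q = 1\<^sub>m (rep_degree G \<tau>)" and QP: "Q * P = 1\<^sub>m (rep_degree G \<tau>)"
      and int: "\<And>g. g \<in> carrier G \<Longrightarrow> P * \<rho> g = \<sigma> g * P"
      and P': "P' \<in> carrier_mat (rep_degree G \<tau>) (rep_degree G \<tau>)"
      and Q': "Q' \<in> carrier_mat (rep_degree G \<tau>) (rep_degree G \<tau>)"
      and PQ': "P' * Q' = 1\<^sub>m (rep_degree G \<tau>)" and QP': "Q' * P' = 1\<^sub>m (rep_degree G \<tau>)"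
      and int': "\<And>g. g \<in> carrier G \<Longrightarrow> P' * \<sigma> g = \<tau> g * P'"
      by (elim rep_equivE) auto
    note PP = mult_carrier_mat[OF P' P] and QQ = mult_carrier_mat[OF Q Q']
    show "(\<rho>, \<tau>) \<in> rep_equiv G"
    proof (rule rep_equivI[OF \<rho> \<tau> d(1), unfolded d(1), OF PP QQ])
      have "P' * P * (Q * Q') = P' * (P * (Q * Q'))" by (rule assoc_mult_mat[OF P' P QQ])
      also have "P * (Q * Q') = Q'" using Q' by (simp add: assoc_mult_mat[OF P Q Q', symmetric] PQ)
      finally show "P' * P * (Q * Q') = 1\<^sub>m (rep_degree G \<tau>)" by (simp add: PQ')
      have "Q * Q' * (P' * P) = Q * (Q' * (P' * P))" by (rule assoc_mult_mat[OF Q Q' PP])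
      also have "Q' * (P' * P) = P" using P by (simp add: assoc_mult_mat[OF Q' P' P, symmetric] QP')
      finally show "Q * Q' * (P' * P) = 1\<^sub>m (rep_degree G \<tau>)" by (simp add: QP)
      fix g assume g: "g \<in> carrier G"
      note rg = irreducibleD(2)[OF \<rho> g, unfolded d] and sg = irreducibleD(2)[OF \<sigma> g, unfolded d]
        and tg = irreducibleD(2)[OF \<tau> g]
      have "P' * P * \<rho> g = P' * (P * \<rho> g)" by (rule assoc_mult_mat[OF P' P rg])
      also have "\<dots> = P' * \<sigma> g * P" by (simp only: int[OF g] assoc_mult_mat[OF P' sg P])
      also have "\<dots> = \<tau> g * (P' * P)" by (simp only: int'[OF g] assoc_mult_mat[OF tg P' P])
      finally show "P' * P * \<rho> g = \<tau> g * (P' * P)" .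
    qed
  qed
qed

text \<open>Were the averaged matrix \<open>P\<close> nonzero, Schur's lemma would invert it;
  comparing the traces of \<open>P * Q\<close> and \<open>Q * P\<close> then gives equal degrees,
  and \<open>P\<close> would be an equivalence.\<close>

lemma rep_coeff_orthogonal_inequivalent:
  assumes \<sigma>: "\<sigma> \<in> irreducible_reps G" and \<tau>: "\<tau> \<in> irreducible_reps G"
    and neq: "(\<sigma>, \<tau>) \<notin> rep_equiv G"
    and ind: "a < rep_degree G \<tau>" "j < rep_degree G \<tau>" "l < rep_degree G \<sigma>" "b < rep_degree G \<sigma>"
  shows "(\<Sum>x\<in>carrier G. \<tau> x $$ (a, j) * \<sigma> (inv x) $$ (l, b)) = 0"
proof -
  let ?d = "rep_degree G \<sigma>" and ?e = "rep_degree G \<tau>"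
  define P where "P = mat ?e ?d (\<lambda>(a, b). \<Sum>x\<in>carrier G. \<tau> x $$ (a, j) * \<sigma> (inv x) $$ (l, b))"
  have P: "P \<in> carrier_mat ?e ?d" by (simp add: P_def)
  have int: "\<And>g. g \<in> carrier G \<Longrightarrow> P * \<sigma> g = \<tau> g * P"
    unfolding P_def by (rule intertwiner[OF \<sigma> \<tau> ind(2,3)])
  have "P = 0\<^sub>m ?e ?d"
  proof (rule schur_lemma[OF \<sigma> \<tau> P int])
    fix Q assume Q: "Q \<in> carrier_mat ?d ?e" "P * Q = 1\<^sub>m ?e" "Q * P = 1\<^sub>m ?d"
    have "of_nat ?e = mat_trace (P * Q)" by (simp add: Q mat_trace_def)
    also have "\<dots> = mat_trace (Q * P)" by (rule mat_trace_comm[OF P Q(1)])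
    also have "\<dots> = of_nat ?d" by (simp add: Q mat_trace_def)
    finally have de: "?d = ?e" by simp
    have "(\<sigma>, \<tau>) \<in> rep_equiv G"
      using P Q int unfolding de[symmetric] by (intro rep_equivI[OF \<sigma> \<tau> de])
    with neq show ?thesis by (rule notE)
  qed
  then have "P $$ (a, b) = 0" using ind by simp
  then show ?thesis using ind by (simp add: P_def)
qed

text \<open>Schur's lemma makes the averaged matrix a scalar \<open>c\<close>. Its trace determines
  \<open>c\<close>: summing over the diagonal index multiplies \<open>\<sigma> (inv x)\<close> with
  \<open>\<sigma> x\<close>, so each group element contributes one entry of the identity
  matrix.\<close>

lemma rep_coeff_orthogonal:
  assumes \<sigma>: "\<sigma> \<in> irreducible_reps G"
    and ind: "a < rep_degree G \<sigma>" "j < rep_degree G \<sigma>" "l < rep_degree G \<sigma>" "b < rep_degree G \<sigma>"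
  shows "(\<Sum>x\<in>carrier G. \<sigma> x $$ (a, j) * \<sigma> (inv x) $$ (l, b)) =
    (if a = b \<and> j = l then of_nat (card (carrier G)) / of_nat (rep_degree G \<sigma>) else 0)"
proof -
  let ?d = "rep_degree G \<sigma>"
  define P where "P = mat ?d ?d (\<lambda>(a, b). \<Sum>x\<in>carrier G. \<sigma> x $$ (a, j) * \<sigma> (inv x) $$ (l, b))"
  have P: "P \<in> carrier_mat ?d ?d" by (simp add: P_def)
  have int: "\<And>g. g \<in> carrier G \<Longrightarrow> P * \<sigma> g = \<sigma> g * P"
    unfolding P_def by (rule intertwiner[OF \<sigma> \<sigma> ind(2,3)])
  obtain c where c: "P = c \<cdot>\<^sub>m 1\<^sub>m ?d" by (rule schur_scalar[OF \<sigma> P int])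
  have "of_nat ?d * c = mat_trace P" by (simp add: c mat_trace_def)
  also have "\<dots> = (\<Sum>a<?d. \<Sum>x\<in>carrier G. \<sigma> (inv x) $$ (l, a) * \<sigma> x $$ (a, j))"
    by (simp add: P_def mat_trace_def mult.commute)
  also have "\<dots> = (\<Sum>x\<in>carrier G. \<Sum>a<?d. \<sigma> (inv x) $$ (l, a) * \<sigma> x $$ (a, j))"
    by (rule sum.swap)
  also have "\<dots> = (\<Sum>x\<in>carrier G. \<sigma> (inv x \<otimes> x) $$ (l, j))"
    by (intro sum.cong refl rep_index_mult[OF \<sigma>, symmetric]) (use ind in auto)
  also have "\<dots> = (\<Sum>x\<in>carrier G. if j = l then 1 else 0)"
    using ind by (intro sum.cong) (auto simp: irreducibleD(3)[OF \<sigma>])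
  also have "\<dots> = (if j = l then of_nat (card (carrier G)) else 0)" by simp
  finally have "c = (if j = l then of_nat (card (carrier G)) / of_nat ?d else 0)"
    using irreducibleD(1)[OF \<sigma>] by (auto simp: field_simps)
  moreover have "(\<Sum>x\<in>carrier G. \<sigma> x $$ (a, j) * \<sigma> (inv x) $$ (l, b)) = P $$ (a, b)"
    using ind by (simp add: P_def)
  moreover have "P $$ (a, b) = (if a = b then c else 0)" using ind by (simp add: c)
  ultimately show ?thesis by simp
qed

section \<open>Orthonormal bases and eigenvalues\<close>

abbreviation ip where "ip \<equiv> L2_inner G"

lemma ip_add_right: "ip f (h + k) = ip f h + ip f k"
  by (simp add: L2_inner_def algebra_simps sum.distrib add_divide_distrib)

lemma ip_scale_right: "ip f (fscale c h) = c * ip f h"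
  by (simp add: L2_inner_def fscale_def sum_distrib_left algebra_simps)

lemma ip_cnj: "cnj (ip f h) = ip h f"
  by (simp add: L2_inner_def mult.commute)

lemma ip_scale_left: "ip (fscale c f) h = cnj c * ip f h"
  by (metis ip_cnj ip_scale_right complex_cnj_mult)

lemma ip_zero_right: "ip f 0 = 0"
  by (simp add: L2_inner_def)

lemma ip_zero_left: "ip 0 f = 0"
  by (simp add: L2_inner_def)

lemma ip_diff_right: "ip f (h - k) = ip f h - ip f k"
  by (simp add: L2_inner_def algebra_simps sum_subtractf diff_divide_distrib)

lemma ip_sum_right: "ip f (\<Sum>a\<in>A. h a) = (\<Sum>a\<in>A. ip f (h a))"
  unfolding L2_inner_def sum_apply sum_distrib_left sum_divide_distrib by (rule sum.swap)

lemma ip_self: "ip f f = of_real ((\<Sum>g\<in>carrier G. (cmod (f g))\<^sup>2) / card (carrier G))"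
proof -
  have "cnj z * z = of_real ((cmod z)\<^sup>2)" for z
    by (metis complex_norm_square mult.commute)
  then show ?thesis by (simp add: L2_inner_def)
qed

lemma ip_self_eq_0:
  assumes "f \<in> L2 G"
  shows "ip f f = 0 \<longleftrightarrow> f = 0"
proof
  assume "ip f f = 0"
  then have "(\<Sum>g\<in>carrier G. (cmod (f g))\<^sup>2) = 0"
    using card_carrier_pos unfolding ip_self of_real_eq_0_iff by auto
  then have "\<forall>g\<in>carrier G. (cmod (f g))\<^sup>2 = 0"
    by (subst (asm) sum_nonneg_eq_0_iff) auto
  then show "f = 0" using assms by (auto simp: L2_def fun_eq_iff)
qed (simp add: ip_zero_left)

lemma subspace_L2: "cfun.subspace (L2 G)"
  by (rule cfun.subspaceI) (auto simp: L2_def fscale_def)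

lemma on_group_L2 [simp]: "on_group G f \<in> L2 G"
  by (simp add: L2_def on_group_def)

definition delta :: "'a \<Rightarrow> 'a \<Rightarrow> complex" where
  "delta h = (\<lambda>g. if g = h then 1 else 0)"

lemma delta_L2 [simp]: "h \<in> carrier G \<Longrightarrow> delta h \<in> L2 G"
  by (auto simp: delta_def L2_def)

lemma L2_delta_expansion:
  assumes "f \<in> L2 G"
  shows "f = (\<Sum>h\<in>carrier G. fscale (f h) (delta h))"
proof
  fix g
  have "(\<Sum>h\<in>carrier G. fscale (f h) (delta h)) g = (\<Sum>h\<in>carrier G. if h = g then f g else 0)"
    unfolding sum_apply by (intro sum.cong) (auto simp: fscale_def delta_def)
  also have "\<dots> = f g" using assms by (auto simp: L2_def)
  finally show "f g = (\<Sum>h\<in>carrier G. fscale (f h) (delta h)) g" by simp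
qed

section \<open>Orthonormal sets and bases in spaces of functions\<close>

definition orthonormal :: "('a \<Rightarrow> complex) set \<Rightarrow> bool" where
  "orthonormal B \<longleftrightarrow> (\<forall>b\<in>B. \<forall>c\<in>B. ip b c = (if b = c then 1 else 0))"

definition onb :: "('a \<Rightarrow> complex) set \<Rightarrow> ('a \<Rightarrow> complex) set \<Rightarrow> bool" where
  "onb V B \<longleftrightarrow> B \<subseteq> V \<and> finite B \<and> orthonormal B \<and> (\<forall>f\<in>V. f = (\<Sum>b\<in>B. fscale (ip b f) b))"

lemma orthonormal_independent:
  assumes "orthonormal B"
  shows "cfun.independent B"
proof
  assume "cfun.dependent B"
  then obtain t u v where t: "finite t" "t \<subseteq> B" "(\<Sum>b\<in>t. fscale (u b) b) = 0" "v \<in> t" "u v \<noteq> 0"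
    unfolding cfun.dependent_explicit by blast
  have "ip v b = (if b = v then 1 else 0)" if "b \<in> t" for b
    using assms subsetD[OF t(2) that] subsetD[OF t(2,4)] by (auto simp: orthonormal_def)
  then have "ip v (\<Sum>b\<in>t. fscale (u b) b) = (\<Sum>b\<in>t. if b = v then u v else 0)"
    unfolding ip_sum_right ip_scale_right by (intro sum.cong) auto
  also have "\<dots> = u v" using t by simp
  finally show False using t by (simp add: ip_zero_right)
qed

text \<open>An orthonormal set is independent and lies in the span of the point masses. The bound
  supplies the maximum in \<open>onb_exists_with\<close> and later the finiteness of the
  dual.\<close>

lemma orthonormal_bound:
  assumes "orthonormal B" "B \<subseteq> L2 G"
  shows "finite B" "card B \<le> card (carrier G)"
proof -
  have "B \<subseteq> cfun.span (delta ` carrier G)"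
  proof
    fix f assume "f \<in> B"
    then have "f = (\<Sum>h\<in>carrier G. fscale (f h) (delta h))"
      using assms by (intro L2_delta_expansion) auto
    also have "\<dots> \<in> cfun.span (delta ` carrier G)"
      by (intro cfun.span_sum cfun.span_scale cfun.span_base) auto
    finally show "f \<in> cfun.span (delta ` carrier G)" .
  qed
  then have "finite B \<and> card B \<le> card (delta ` carrier G)"
    by (intro cfun.independent_span_bound orthonormal_independent assms) auto
  then show "finite B" "card B \<le> card (carrier G)"
    using card_image_le[OF finite_carrier, of delta] by auto
qed

lemma onb_dim:
  assumes "onb V B" "cfun.subspace V"
  shows "cfun.dim V = card B" "cfun.span B = V"
proof -
  have "V \<subseteq> cfun.span B"
  proof
    fix f assume "f \<in> V"
    then have "f = (\<Sum>b\<in>B. fscale (ip b f) b)" using assms unfolding onb_def by blast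
    also have "\<dots> \<in> cfun.span B" by (intro cfun.span_sum cfun.span_scale cfun.span_base)
    finally show "f \<in> cfun.span B" .
  qed
  moreover have "B \<subseteq> V" "orthonormal B" using assms by (auto simp: onb_def)
  ultimately show "cfun.dim V = card B" "cfun.span B = V"
    using assms(2) by (simp_all add: cfun.dim_unique orthonormal_independent cfun.span_subspace)
qed

text \<open>Maximality: among orthonormal sets of vectors satisfying \<open>P\<close> one has
  greatest size. If it missed a vector of \<open>V\<close>, \<open>step\<close> would exchange the
  residue for a nonzero vector satisfying \<open>P\<close> and orthogonal to the set, and
  normalising that vector would give a larger set. With \<open>P\<close> always true this produces
  bases, with \<open>P\<close> an eigenvector equation it produces the spectral theorem.\<close>

lemma onb_exists_with:
  assumes V: "cfun.subspace V" "V \<subseteq> L2 G"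
    and scale: "\<And>c f. P f \<Longrightarrow> P (fscale c f)"
    and step: "\<And>B f. B \<subseteq> V \<Longrightarrow> \<forall>b\<in>B. P b \<Longrightarrow> f \<in> V \<Longrightarrow> f \<noteq> 0 \<Longrightarrow> \<forall>b\<in>B. ip b f = 0 \<Longrightarrow>
      \<exists>h\<in>V. h \<noteq> 0 \<and> P h \<and> (\<forall>b\<in>B. ip b h = 0)"
  obtains B where "onb V B" "\<forall>b\<in>B. P b"
proof -
  let ?Q = "\<lambda>B. B \<subseteq> V \<and> orthonormal B \<and> (\<forall>b\<in>B. P b)"
  have "?Q {}" by (simp add: orthonormal_def)
  moreover have "\<forall>B. ?Q B \<longrightarrow> card B < Suc (card (carrier G))"
    using orthonormal_bound(2) V(2) by (auto simp: less_Suc_eq_le)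
  ultimately have "\<exists>B. ?Q B \<and> (\<forall>C. ?Q C \<longrightarrow> card C \<le> card B)"
    by (rule ex_has_greatest_nat)
  then obtain B where Q: "?Q B" and max: "\<And>C. ?Q C \<Longrightarrow> card C \<le> card B"
    by (elim exE conjE) simp
  have fin: "finite B" using orthonormal_bound(1)[of B] Q V(2) by blast
  have "f = (\<Sum>b\<in>B. fscale (ip b f) b)" if f: "f \<in> V" for f
  proof (rule ccontr)
    assume neq: "f \<noteq> (\<Sum>b\<in>B. fscale (ip b f) b)"
    \<comment> \<open>The residue after orthogonal projection onto the span of
      \<open>B\<close>.\<close>
    define r where "r = f - (\<Sum>b\<in>B. fscale (ip b f) b)"
    have "r \<in> V" unfolding r_def using Q f
      by (intro cfun.subspace_diff cfun.subspace_sum cfun.subspace_scale V) auto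
    moreover have "r \<noteq> 0" using neq by (simp add: r_def)
    moreover have "\<forall>b\<in>B. ip b r = 0"
    proof
      fix b assume b: "b \<in> B"
      have "ip b (\<Sum>c\<in>B. fscale (ip c f) c) = (\<Sum>c\<in>B. if c = b then ip b f else 0)"
        unfolding ip_sum_right ip_scale_right using Q b
        by (intro sum.cong) (auto simp: orthonormal_def)
      then show "ip b r = 0" using b fin by (simp add: r_def ip_diff_right)
    qed
    ultimately obtain h where h: "h \<in> V" "h \<noteq> 0" "P h" "\<forall>b\<in>B. ip b h = 0"
      using step[of B r] Q by blast
    define s where "s = (\<Sum>g\<in>carrier G. (cmod (h g))\<^sup>2) / card (carrier G)"
    have s: "ip h h = of_real s" unfolding s_def by (rule ip_self)
    have "s \<ge> 0" unfolding s_def by (intro divide_nonneg_nonneg sum_nonneg) auto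
    moreover have "s \<noteq> 0" using ip_self_eq_0[of h] h V(2) s by auto
    ultimately have spos: "s > 0" by simp
    define p where "p = fscale (of_real (1 / sqrt s)) h"
    have p1: "ip p p = 1"
    proof -
      have "ip p p = of_real (1 / sqrt s * (1 / sqrt s) * s)"
        unfolding p_def ip_scale_left ip_scale_right s complex_cnj_complex_of_real of_real_mult
        by (rule mult.assoc[symmetric])
      also have "1 / sqrt s * (1 / sqrt s) * s = 1" using spos by simp
      finally show ?thesis by simp
    qed
    have pB: "\<forall>b\<in>B. ip b p = 0" using h by (simp add: p_def ip_scale_right)
    then have pB': "\<forall>b\<in>B. ip p b = 0" by (metis ip_cnj complex_cnj_zero)
    have pn: "p \<notin> B" using pB p1 by auto
    have "?Q (insert p B)"
    proof (intro conjI)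
      show "insert p B \<subseteq> V" using Q h cfun.subspace_scale[OF V(1)] by (auto simp: p_def)
      show "orthonormal (insert p B)" using Q p1 pB pB' pn by (auto simp: orthonormal_def)
      show "\<forall>b\<in>insert p B. P b" using Q h scale by (auto simp: p_def)
    qed
    then have "card (insert p B) \<le> card B" by (rule max)
    then show False using fin pn by simp
  qed
  then show thesis using that[of B] Q fin by (auto simp: onb_def)
qed

lemma onb_exists:
  assumes "cfun.subspace V" "V \<subseteq> L2 G"
  obtains B where "onb V B"
  using onb_exists_with[of V "\<lambda>_. True"] assms by blast

section \<open>Operators, their traces and their mean eigenvalues\<close>

lemma operatorD:
  assumes "T \<in> L2_operators G"
  shows "\<And>f. f \<in> L2 G \<Longrightarrow> T f \<in> L2 G" "\<And>f. f \<notin> L2 G \<Longrightarrow> T f = 0"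
    "\<And>f h. f \<in> L2 G \<Longrightarrow> h \<in> L2 G \<Longrightarrow> T (f + h) = T f + T h"
    "\<And>c f. f \<in> L2 G \<Longrightarrow> T (fscale c f) = fscale c (T f)"
  using assms by (auto simp: L2_operators_def)

lemma operator_sum:
  assumes T: "T \<in> L2_operators G" and h: "\<And>a. a \<in> A \<Longrightarrow> h a \<in> L2 G"
  shows "T (\<Sum>a\<in>A. fscale (c a) (h a)) = (\<Sum>a\<in>A. fscale (c a) (T (h a)))"
proof -
  \<comment> \<open>\<open>T 0 = 0\<close> settles the empty sum and also the convention that a sum
    over an infinite set is 0.\<close>
  have "T (fscale 0 0) = fscale 0 (T 0)"
    by (rule operatorD(4)[OF T]) (simp add: L2_def)
  then have T0: "T 0 = 0" by simp
  show ?thesis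
  proof (cases "finite A")
    case True
    then show ?thesis using h
    proof (induction A)
      case (insert a A)
      have "(\<Sum>a\<in>A. fscale (c a) (h a)) \<in> L2 G" "fscale (c a) (h a) \<in> L2 G"
        using insert.prems by (auto intro!: cfun.subspace_sum cfun.subspace_scale subspace_L2)
      then have "T (\<Sum>a\<in>insert a A. fscale (c a) (h a)) = (\<Sum>a\<in>insert a A. fscale (c a) (T (h a)))"
        using insert.IH insert.hyps insert.prems by (simp add: operatorD(3,4)[OF T])
      then show ?case .
    qed (use T0 in \<open>simp add: zero_fun_def\<close>)
  qed (simp add: T0)
qed

text \<open>Basis independence of the trace: expanding \<open>b\<close> in \<open>C\<close> on one
  side and \<open>T c\<close> in \<open>B\<close> on the other leads to the same double sum.\<close>

lemma onb_trace_eq: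
  assumes T: "T \<in> L2_operators G" and V: "V \<subseteq> L2 G" "\<And>f. f \<in> V \<Longrightarrow> T f \<in> V"
    and B: "onb V B" and C: "onb V C"
  shows "(\<Sum>b\<in>B. ip b (T b)) = (\<Sum>c\<in>C. ip c (T c))"
proof -
  have BV: "B \<subseteq> V" and CV: "C \<subseteq> V" using B C by (auto simp: onb_def)
  have "ip b (T b) = (\<Sum>c\<in>C. ip c b * ip b (T c))" if "b \<in> B" for b
  proof -
    have "b = (\<Sum>c\<in>C. fscale (ip c b) c)" using C that BV by (auto simp: onb_def)
    then have "T b = T (\<Sum>c\<in>C. fscale (ip c b) c)" by simp
    also have "\<dots> = (\<Sum>c\<in>C. fscale (ip c b) (T c))"
      using CV V by (intro operator_sum[OF T]) auto
    finally show ?thesis by (simp add: ip_sum_right ip_scale_right)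
  qed
  then have "(\<Sum>b\<in>B. ip b (T b)) = (\<Sum>b\<in>B. \<Sum>c\<in>C. ip c b * ip b (T c))" by simp
  also have "\<dots> = (\<Sum>c\<in>C. \<Sum>b\<in>B. ip b (T c) * ip c b)"
    by (subst sum.swap) (simp add: mult.commute)
  also have "\<dots> = (\<Sum>c\<in>C. ip c (T c))"
  proof (intro sum.cong refl)
    fix c assume "c \<in> C"
    then have "T c = (\<Sum>b\<in>B. fscale (ip b (T c)) b)" using B V CV by (auto simp: onb_def)
    then have "ip c (T c) = ip c (\<Sum>b\<in>B. fscale (ip b (T c)) b)" by simp
    then show "(\<Sum>b\<in>B. ip b (T c) * ip c b) = ip c (T c)"
      by (simp add: ip_sum_right ip_scale_right)
  qed
  finally show ?thesis .
qed

text \<open>Comparing coefficients in \<open>T f = fscale l f\<close> shows that the eigenspace of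
  \<open>l\<close> in \<open>V\<close> is spanned by the basis vectors with
  \<open>\<mu> b = l\<close>, so its dimension counts them. Regrouping the basis by eigenvalue turns
  the weighted sum into the trace.\<close>

lemma mean_eigenvalue_onb:
  assumes T: "T \<in> L2_operators G" and V: "V \<subseteq> L2 G" "cfun.subspace V"
    and B: "onb V B" and eig: "\<And>b. b \<in> B \<Longrightarrow> T b = fscale (\<mu> b) b"
  shows "mean_eigenvalue T V = (\<Sum>b\<in>B. ip b (T b)) / of_nat (card B)"
proof -
  have BV: "B \<subseteq> V" and fin: "finite B" and on: "orthonormal B"
    and exp: "\<And>f. f \<in> V \<Longrightarrow> f = (\<Sum>b\<in>B. fscale (ip b f) b)"
    using B by (auto simp: onb_def)
  have b0: "b \<noteq> 0" if "b \<in> B" for b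
    using on that by (force simp: orthonormal_def ip_zero_left)
  have Texp: "ip b (T f) = \<mu> b * ip b f" if "f \<in> V" "b \<in> B" for b f
  proof -
    have "T f = T (\<Sum>b\<in>B. fscale (ip b f) b)" using exp[OF that(1)] by simp
    also have "\<dots> = (\<Sum>b\<in>B. fscale (ip b f) (T b))"
      using BV V by (intro operator_sum[OF T]) auto
    finally have "ip b (T f) = (\<Sum>c\<in>B. ip c f * (\<mu> c * ip b c))"
      by (simp add: ip_sum_right ip_scale_right eig mult.assoc)
    also have "\<dots> = (\<Sum>c\<in>B. if c = b then \<mu> b * ip b f else 0)"
      using on that by (intro sum.cong) (auto simp: orthonormal_def)
    finally show ?thesis using that fin by simp
  qed
  have coeff: "ip b f = 0" if "f \<in> V" "T f = fscale l f" "b \<in> B" "\<mu> b \<noteq> l" for b f l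
    using Texp[OF that(1,3)] that by (simp add: ip_scale_right)
  have evs: "{l. \<exists>f\<in>V. f \<noteq> 0 \<and> T f = fscale l f} = \<mu> ` B"
  proof (intro equalityI subsetI)
    fix l assume "l \<in> {l. \<exists>f\<in>V. f \<noteq> 0 \<and> T f = fscale l f}"
    then obtain f where f: "f \<in> V" "f \<noteq> 0" "T f = fscale l f" by blast
    show "l \<in> \<mu> ` B"
    proof (rule ccontr)
      assume "l \<notin> \<mu> ` B"
      then have "\<And>b. b \<in> B \<Longrightarrow> ip b f = 0" using coeff[OF f(1,3)] by blast
      then have "(\<Sum>b\<in>B. fscale (ip b f) b) = 0" by simp
      then show False using exp[OF f(1)] f(2) by simp
    qed
  next
    fix l assume "l \<in> \<mu> ` B"
    then show "l \<in> {l. \<exists>f\<in>V. f \<noteq> 0 \<and> T f = fscale l f}" using eig b0 BV by auto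
  qed
  have dim: "cfun.dim {f\<in>V. T f = fscale l f} = card {b\<in>B. \<mu> b = l}" for l
  proof (rule cfun.dim_unique[of "{b\<in>B. \<mu> b = l}"])
    show "{b \<in> B. \<mu> b = l} \<subseteq> {f \<in> V. T f = fscale l f}" using eig BV by auto
    show "{f \<in> V. T f = fscale l f} \<subseteq> cfun.span {b \<in> B. \<mu> b = l}"
    proof
      fix f assume f: "f \<in> {f \<in> V. T f = fscale l f}"
      then have "f = (\<Sum>b\<in>B. fscale (ip b f) b)" using exp by blast
      also have "\<dots> = (\<Sum>b\<in>{b\<in>B. \<mu> b = l}. fscale (ip b f) b)"
        using f coeff fin by (intro sum.mono_neutral_right) auto
      also have "\<dots> \<in> cfun.span {b \<in> B. \<mu> b = l}"
        by (intro cfun.span_sum cfun.span_scale cfun.span_base)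
      finally show "f \<in> cfun.span {b \<in> B. \<mu> b = l}" .
    qed
    show "cfun.independent {b \<in> B. \<mu> b = l}"
      by (rule cfun.independent_mono[OF orthonormal_independent[OF on]]) auto
  qed simp
  have "(\<Sum>l\<in>\<mu> ` B. of_nat (card {b\<in>B. \<mu> b = l}) * l) = (\<Sum>l\<in>\<mu> ` B. \<Sum>b\<in>{b\<in>B. \<mu> b = l}. \<mu> b)"
    by (intro sum.cong) auto
  also have "\<dots> = (\<Sum>b\<in>B. \<mu> b)"
    by (rule sum.image_gen[OF fin, symmetric])
  also have "\<dots> = (\<Sum>b\<in>B. ip b (T b))"
    using eig on by (intro sum.cong) (auto simp: ip_scale_right orthonormal_def)
  finally show ?thesis
    unfolding mean_eigenvalue_def evs dim onb_dim(1)[OF B V(2)] by simp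
qed

end

section \<open>Irreducible subrepresentations of the right regular representation\<close>

text \<open>An indexed orthonormal basis identifies \<open>V\<close> with vectors of length
  \<open>n\<close>. Through it the nonempty spectrum of a complex matrix becomes available for
  operators, and an invariant space of functions becomes a matrix representation.\<close>

locale onb_coords = finite_group +
  fixes V :: "('a \<Rightarrow> complex) set" and n :: nat and b :: "nat \<Rightarrow> 'a \<Rightarrow> complex"
  assumes subspace_V: "cfun.subspace V" and V_L2: "V \<subseteq> L2 G"
    and b_in: "\<And>i. i < n \<Longrightarrow> b i \<in> V"
    and b_orth: "\<And>i j. i < n \<Longrightarrow> j < n \<Longrightarrow> ip (b i) (b j) = (if i = j then 1 else 0)"
    and b_exp: "\<And>f. f \<in> V \<Longrightarrow> f = (\<Sum>i<n. fscale (ip (b i) f) (b i))"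
begin

definition comb :: "complex vec \<Rightarrow> 'a \<Rightarrow> complex" where
  "comb v = (\<Sum>i<n. fscale (v $ i) (b i))"

definition coord :: "('a \<Rightarrow> complex) \<Rightarrow> complex vec" where
  "coord f = vec n (\<lambda>i. ip (b i) f)"

definition op_matrix :: "(('a \<Rightarrow> complex) \<Rightarrow> 'a \<Rightarrow> complex) \<Rightarrow> complex mat" where
  "op_matrix T = mat n n (\<lambda>(i, j). ip (b i) (T (b j)))"

lemma op_matrix_carrier [simp]: "op_matrix T \<in> carrier_mat n n"
  by (simp add: op_matrix_def)

lemma comb_in: "comb v \<in> V"
  unfolding comb_def by (intro cfun.subspace_sum cfun.subspace_scale subspace_V b_in) auto

lemma comb_coord: "f \<in> V \<Longrightarrow> comb (coord f) = f"
  using b_exp[of f] by (simp add: comb_def coord_def)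

lemma ip_comb:
  assumes "i < n"
  shows "ip (b i) (comb v) = v $ i"
proof -
  have "ip (b i) (comb v) = (\<Sum>j<n. if j = i then v $ i else 0)"
    unfolding comb_def ip_sum_right ip_scale_right
    using assms by (intro sum.cong) (auto simp: b_orth)
  then show ?thesis using assms by simp
qed

lemma coord_comb: "v \<in> carrier_vec n \<Longrightarrow> coord (comb v) = v"
  by (intro eq_vecI) (auto simp: coord_def ip_comb)

lemma comb_add: "v \<in> carrier_vec n \<Longrightarrow> w \<in> carrier_vec n \<Longrightarrow> comb (v + w) = comb v + comb w"
  unfolding comb_def sum.distrib[symmetric]
  by (intro sum.cong) (auto simp: cfun.scale_left_distrib)

lemma comb_smult: "v \<in> carrier_vec n \<Longrightarrow> comb (c \<cdot>\<^sub>v v) = fscale c (comb v)"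
  unfolding comb_def cfun.scale_sum_right by (intro sum.cong) auto

lemma comb_zero: "comb (0\<^sub>v n) = 0"
  by (simp add: comb_def)

lemma op_comb:
  assumes T: "T \<in> L2_operators G" and TV: "\<And>f. f \<in> V \<Longrightarrow> T f \<in> V" and v: "v \<in> carrier_vec n"
  shows "T (comb v) = comb (op_matrix T *\<^sub>v v)"
proof -
  have "T (comb v) = (\<Sum>j<n. fscale (v $ j) (T (b j)))"
    unfolding comb_def using b_in V_L2 by (intro operator_sum[OF T]) auto
  then have "coord (T (comb v)) = op_matrix T *\<^sub>v v"
    using v by (intro eq_vecI)
      (auto simp: coord_def op_matrix_def ip_sum_right ip_scale_right scalar_prod_def
        atLeast0LessThan mult.commute intro!: sum.cong)
  then show ?thesis using comb_coord[OF TV[OF comb_in], of v] by simp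
qed

lemma op_matrix_mult:
  assumes S: "S \<in> L2_operators G" and TV: "\<And>f. f \<in> V \<Longrightarrow> T f \<in> V"
  shows "op_matrix (\<lambda>f. S (T f)) = op_matrix S * op_matrix T"
proof (rule eq_matI)
  fix i j assume "i < dim_row (op_matrix S * op_matrix T)" "j < dim_col (op_matrix S * op_matrix T)"
  then have ij: "i < n" "j < n" by (auto simp: op_matrix_def)
  have "S (T (b j)) = S (\<Sum>k<n. fscale (ip (b k) (T (b j))) (b k))"
    using b_exp[OF TV[OF b_in[OF ij(2)]]] by simp
  also have "\<dots> = (\<Sum>k<n. fscale (ip (b k) (T (b j))) (S (b k)))"
    using b_in V_L2 by (intro operator_sum[OF S]) auto
  finally have "ip (b i) (S (T (b j))) = (\<Sum>k<n. ip (b k) (T (b j)) * ip (b i) (S (b k)))"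
    by (simp add: ip_sum_right ip_scale_right)
  then show "op_matrix (\<lambda>f. S (T f)) $$ (i, j) = (op_matrix S * op_matrix T) $$ (i, j)"
    unfolding mat_mult_index[OF op_matrix_carrier op_matrix_carrier ij]
    using ij by (simp add: op_matrix_def mult.commute)
qed (auto simp: op_matrix_def)

text \<open>The nonzero \<open>f\<close> guarantees \<open>n > 0\<close>, so the matrix of
  \<open>T\<close> has a nonempty spectrum; \<open>comb\<close> carries an eigenvector of the matrix
  back to a function.\<close>

lemma eigenvector_in_V:
  assumes T: "T \<in> L2_operators G" and TV: "\<And>f. f \<in> V \<Longrightarrow> T f \<in> V" and f: "f \<in> V" "f \<noteq> 0"
  shows "\<exists>h\<in>V. h \<noteq> 0 \<and> (\<exists>l. T h = fscale l h)"
proof -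
  have "n > 0"
  proof (rule ccontr)
    assume "\<not> n > 0"
    then show False using b_exp[OF f(1)] f(2) by simp
  qed
  then have "spectrum (op_matrix T) \<noteq> {}" by (rule spectrum_non_empty[OF op_matrix_carrier])
  then obtain l v where "eigenvector (op_matrix T) v l"
    unfolding spectrum_def eigenvalue_def by blast
  then have v: "v \<in> carrier_vec n" "v \<noteq> 0\<^sub>v n" "op_matrix T *\<^sub>v v = l \<cdot>\<^sub>v v"
    unfolding eigenvector_def by (simp_all add: op_matrix_def)
  have "comb v \<noteq> 0"
  proof
    assume "comb v = 0"
    then have "v = coord 0" using coord_comb[OF v(1)] by simp
    also have "\<dots> = 0\<^sub>v n" by (intro eq_vecI) (auto simp: coord_def ip_zero_right)
    finally show False using v(2) by simp
  qed
  moreover have "T (comb v) = fscale l (comb v)"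
    using op_comb[OF T TV v(1)] comb_smult[OF v(1), of l] by (simp only: v(3))
  ultimately show ?thesis using comb_in by blast
qed

end

context finite_group begin

lemma onb_coords_exists:
  assumes "cfun.subspace V" "V \<subseteq> L2 G"
  obtains b where "onb_coords G V (cfun.dim V) b"
proof -
  obtain B where B: "onb V B" by (rule onb_exists[OF assms])
  then have fin: "finite B" and BV: "B \<subseteq> V" by (auto simp: onb_def)
  obtain b where b: "bij_betw b {0..<card B} B"
    using ex_bij_betw_nat_finite[OF fin] by blast
  have dim: "cfun.dim V = card B" by (rule onb_dim(1)[OF B assms(1)])
  have inj: "inj_on b {..<card B}" and im: "b ` {..<card B} = B"
    using b by (auto simp: bij_betw_def atLeast0LessThan)
  have "onb_coords G V (card B) b"
  proof
    show "b i \<in> V" if "i < card B" for i using im BV that by blast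
    show "ip (b i) (b j) = (if i = j then 1 else 0)" if "i < card B" "j < card B" for i j
    proof -
      have "b i \<in> B" "b j \<in> B" using im that by auto
      moreover have "b i = b j \<longleftrightarrow> i = j" using inj that by (auto simp: inj_on_def)
      ultimately show ?thesis using B by (simp add: onb_def orthonormal_def)
    qed
    show "f = (\<Sum>i<card B. fscale (ip (b i) f) (b i))" if "f \<in> V" for f
    proof -
      have "f = (\<Sum>c\<in>b ` {..<card B}. fscale (ip c f) c)"
        using B that unfolding im by (auto simp: onb_def)
      then show ?thesis by (simp add: sum.reindex[OF inj])
    qed
  qed (use assms in auto)
  then show thesis using that dim by simp
qed

text \<open>Hermiticity makes the orthogonal complement \<open>U\<close> of a set of eigenvectors
  invariant under \<open>T\<close>, so \<open>U\<close> contains an eigenvector as soon as it is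
  nonzero. This is the extension step that \<open>onb_exists_with\<close> asks for.\<close>

lemma spectral_theorem:
  assumes T: "T \<in> L2_operators G"
    and herm: "\<And>f h. f \<in> L2 G \<Longrightarrow> h \<in> L2 G \<Longrightarrow> ip f (T h) = ip (T f) h"
    and V: "cfun.subspace V" "V \<subseteq> L2 G" "\<And>f. f \<in> V \<Longrightarrow> T f \<in> V"
  obtains B \<mu> where "onb V B" "\<And>b. b \<in> B \<Longrightarrow> T b = fscale (\<mu> b) b"
proof -
  define P where "P f \<longleftrightarrow> f \<in> L2 G \<and> (\<exists>l. T f = fscale l f)" for f
  obtain B where B: "onb V B" "\<forall>b\<in>B. P b"
  proof (rule onb_exists_with[OF V(1,2), of P])
    fix c f assume "P f"
    then show "P (fscale c f)"
      using cfun.subspace_scale[OF subspace_L2] by (auto simp: P_def operatorD(4)[OF T] mult.commute)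
  next
    fix B f assume B: "B \<subseteq> V" "\<forall>b\<in>B. P b" and f: "f \<in> V" "f \<noteq> 0" "\<forall>b\<in>B. ip b f = 0"
    define U where "U = {h \<in> V. \<forall>b\<in>B. ip b h = 0}"
    have U: "cfun.subspace U" "U \<subseteq> L2 G"
      using V by (auto simp: U_def cfun.subspace_def ip_zero_right ip_add_right ip_scale_right)
    obtain u where "onb_coords G U (cfun.dim U) u" by (rule onb_coords_exists[OF U])
    then interpret onb_coords G U "cfun.dim U" u .
    have inv: "T h \<in> U" if "h \<in> U" for h
    proof -
      have "ip b (T h) = 0" if b: "b \<in> B" for b
      proof -
        obtain l where "T b = fscale l b" "b \<in> L2 G" using B b by (auto simp: P_def)
        then show ?thesis using herm[of b h] \<open>h \<in> U\<close> V(2) b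
          by (auto simp: U_def ip_scale_left)
      qed
      then show ?thesis using that V(3) by (auto simp: U_def)
    qed
    have "\<exists>h\<in>U. h \<noteq> 0 \<and> (\<exists>l. T h = fscale l h)"
      using f by (intro eigenvector_in_V[OF T inv, of f]) (auto simp: U_def)
    then show "\<exists>h\<in>V. h \<noteq> 0 \<and> P h \<and> (\<forall>b\<in>B. ip b h = 0)"
      using U by (auto simp: U_def P_def)
  qed
  then have "\<forall>b\<in>B. \<exists>l. T b = fscale l b" by (auto simp: P_def)
  then obtain \<mu> where "\<forall>b\<in>B. T b = fscale (\<mu> b) b" by metis
  then show thesis using that B by blast
qed

section \<open>Right translations and their invariant subspaces\<close>

lemma right_trans_operator:
  assumes "x \<in> carrier G"
  shows "right_trans G x \<in> L2_operators G"
  using cfun.subspace_add[OF subspace_L2] cfun.subspace_scale[OF subspace_L2] assms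
  by (auto simp: right_trans_def on_L2_def L2_operators_def on_group_def fun_eq_iff fscale_def)
    (auto simp: L2_def)

lemma right_trans_apply:
  "f \<in> L2 G \<Longrightarrow> right_trans G x f g = (if g \<in> carrier G then f (g \<otimes> x) else 0)"
  by (simp add: right_trans_def on_L2_def on_group_def)

lemma right_trans_mult:
  assumes "f \<in> L2 G" "x \<in> carrier G" "y \<in> carrier G"
  shows "right_trans G (x \<otimes> y) f = right_trans G x (right_trans G y f)"
  using assms operatorD(1)[OF right_trans_operator[OF assms(3)] assms(1)]
  by (auto simp: fun_eq_iff right_trans_apply m_assoc)

lemma right_trans_one: "f \<in> L2 G \<Longrightarrow> right_trans G \<one> f = f"
  by (auto simp: fun_eq_iff right_trans_apply L2_def)

definition right_invariant :: "('a \<Rightarrow> complex) set \<Rightarrow> bool" where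
  "right_invariant W \<longleftrightarrow> cfun.subspace W \<and> W \<subseteq> L2 G \<and>
    (\<forall>x\<in>carrier G. \<forall>f\<in>W. right_trans G x f \<in> W)"

text \<open>Take \<open>W\<close> of least dimension. A proper invariant \<open>W'\<close> inside it
  would have strictly smaller dimension, because a vector of \<open>W\<close> outside
  \<open>W'\<close> enlarges a basis of \<open>W'\<close> to an independent subset of
  \<open>W\<close>.\<close>

lemma minimal_right_invariant:
  assumes "right_invariant U" "U \<noteq> {0}"
  obtains W where "right_invariant W" "W \<subseteq> U" "W \<noteq> {0}"
    "\<And>W'. right_invariant W' \<Longrightarrow> W' \<subseteq> W \<Longrightarrow> W' \<noteq> {0} \<Longrightarrow> W' = W"
proof -
  let ?Q = "\<lambda>W. right_invariant W \<and> W \<subseteq> U \<and> W \<noteq> {0}"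
  have "\<exists>W. ?Q W \<and> (\<forall>W'. ?Q W' \<longrightarrow> cfun.dim W \<le> cfun.dim W')"
    by (rule ex_has_least_nat[of ?Q U]) (use assms in auto)
  then obtain W where W: "right_invariant W" "W \<subseteq> U" "W \<noteq> {0}"
    and min: "\<And>W'. ?Q W' \<Longrightarrow> cfun.dim W \<le> cfun.dim W'"
    by (elim exE conjE) simp
  show thesis
  proof (rule that[OF W])
    fix W' assume W': "right_invariant W'" "W' \<subseteq> W" "W' \<noteq> {0}"
    show "W' = W"
    proof (rule ccontr)
      assume "W' \<noteq> W"
      then obtain f where f: "f \<in> W" "f \<notin> W'" using W' by blast
      have sW: "cfun.subspace W" "W \<subseteq> L2 G" and sW': "cfun.subspace W'" "W' \<subseteq> L2 G"
        using W W' by (auto simp: right_invariant_def)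
      obtain B where B: "onb W B" by (rule onb_exists[OF sW])
      obtain B' where B': "onb W' B'" by (rule onb_exists[OF sW'])
      note dB = onb_dim[OF B sW(1)] and dB' = onb_dim[OF B' sW'(1)]
      have ind: "cfun.independent (insert f B')"
        using f B' dB' by (intro cfun.independent_insertI orthonormal_independent) (auto simp: onb_def)
      have "insert f B' \<subseteq> cfun.span B" using f W' B' unfolding dB(2) by (auto simp: onb_def)
      then have "card (insert f B') \<le> card B"
        using cfun.independent_span_bound[OF _ ind] B by (auto simp: onb_def)
      moreover have "card B \<le> card B'" using min[of W'] W W' dB(1) dB'(1) by auto
      moreover have "card (insert f B') = Suc (card B')"
        using B' f by (intro card_insert_disjoint) (auto simp: onb_def)
      ultimately show False by simp
    qed
  qed
qed

text \<open>On a minimal invariant subspace the matrices of the right translations form an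
  irreducible representation: an invariant set of coordinate vectors corresponds to an invariant
  space of functions. By \<open>eig\<close> the \<phi>-weighted sum of translations acts there as
  the scalar \<open>l\<close>, and taking traces gives the character sum.\<close>

lemma irreducible_from_eigenspace:
  assumes U: "right_invariant U" "U \<noteq> {0}"
    and eig: "\<And>f. f \<in> U \<Longrightarrow> (\<Sum>x\<in>carrier G. fscale (\<phi> x) (right_trans G x f)) = fscale l f"
  obtains \<sigma> where "\<sigma> \<in> irreducible_reps G"
    "(\<Sum>x\<in>carrier G. \<phi> x * mat_trace (\<sigma> x)) = of_nat (rep_degree G \<sigma>) * l"
proof -
  obtain W where W: "right_invariant W" "W \<subseteq> U" "W \<noteq> {0}"
    and min: "\<And>W'. right_invariant W' \<Longrightarrow> W' \<subseteq> W \<Longrightarrow> W' \<noteq> {0} \<Longrightarrow> W' = W"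
    by (rule minimal_right_invariant[OF U]) blast
  have sW: "cfun.subspace W" "W \<subseteq> L2 G" and inv: "\<And>x f. x \<in> carrier G \<Longrightarrow> f \<in> W \<Longrightarrow> right_trans G x f \<in> W"
    using W by (auto simp: right_invariant_def)
  define n where "n = cfun.dim W"
  obtain b where "onb_coords G W n b" unfolding n_def by (rule onb_coords_exists[OF sW])
  then interpret onb_coords G W n b .
  define \<sigma> where "\<sigma> x = op_matrix (right_trans G x)" for x
  have "n > 0"
  proof (rule ccontr)
    assume "\<not> n > 0"
    then have "f = 0" if "f \<in> W" for f using b_exp[OF that] by simp
    then show False using W(3) cfun.subspace_0[OF sW(1)] by blast
  qed
  have rep: "matrix_rep G n \<sigma>"
    unfolding matrix_rep_def
  proof (intro conjI ballI)
    show "\<sigma> \<one> = 1\<^sub>m n"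
      using b_in sW(2) by (intro eq_matI)
        (auto simp: \<sigma>_def op_matrix_def b_orth subset_iff right_trans_one)
    fix g h assume gh: "g \<in> carrier G" "h \<in> carrier G"
    have "\<sigma> (g \<otimes> h) = op_matrix (\<lambda>f. right_trans G g (right_trans G h f))"
      using b_in sW(2) gh by (intro eq_matI)
        (auto simp: \<sigma>_def op_matrix_def subset_iff right_trans_mult)
    then show "\<sigma> (g \<otimes> h) = \<sigma> g * \<sigma> h"
      using op_matrix_mult[OF right_trans_operator[OF gh(1)] inv[OF gh(2)]] by (simp add: \<sigma>_def)
  qed (simp add: \<sigma>_def)
  have deg: "rep_degree G \<sigma> = n" by (simp add: rep_degree_def \<sigma>_def op_matrix_def)
  have "\<sigma> \<in> irreducible_reps G"
  proof (rule irreducibleI[OF rep \<open>n > 0\<close>])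
    fix X assume X: "X \<subseteq> carrier_vec n" "0\<^sub>v n \<in> X" "\<And>v w. v \<in> X \<Longrightarrow> w \<in> X \<Longrightarrow> v + w \<in> X"
      "\<And>c v. v \<in> X \<Longrightarrow> c \<cdot>\<^sub>v v \<in> X" "\<And>g w. g \<in> carrier G \<Longrightarrow> w \<in> X \<Longrightarrow> \<sigma> g *\<^sub>v w \<in> X"
    have car: "v \<in> carrier_vec n" if "v \<in> X" for v using X(1) that by (rule subsetD)
    have inj: "v = w" if "comb v = comb w" "v \<in> carrier_vec n" "w \<in> carrier_vec n" for v w
    proof -
      have "coord (comb v) = coord (comb w)" using that(1) by (rule arg_cong)
      then show ?thesis unfolding coord_comb[OF that(2)] coord_comb[OF that(3)] .
    qed
    have sub: "cfun.subspace (comb ` X)"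
    proof (rule cfun.subspaceI)
      show "0 \<in> comb ` X" using X(2) comb_zero by (metis imageI)
    next
      fix f h assume "f \<in> comb ` X" "h \<in> comb ` X"
      then obtain v w where vw: "v \<in> X" "w \<in> X" "f = comb v" "h = comb w" by (elim imageE)
      have "f + h = comb (v + w)" unfolding vw by (rule comb_add[symmetric]; rule car; fact)
      then show "f + h \<in> comb ` X" using X(3)[OF vw(1,2)] by (simp only: imageI)
    next
      fix c f assume "f \<in> comb ` X"
      then obtain v where v: "v \<in> X" "f = comb v" by (elim imageE)
      have "fscale c f = comb (c \<cdot>\<^sub>v v)" unfolding v by (rule comb_smult[symmetric]; rule car; fact)
      then show "fscale c f \<in> comb ` X" using X(4)[OF v(1)] by (simp only: imageI)
    qed
    have CW: "comb ` X \<subseteq> W" using comb_in by blast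
    have "right_invariant (comb ` X)"
      unfolding right_invariant_def
    proof (intro conjI ballI sub)
      show "comb ` X \<subseteq> L2 G" using CW sW(2) by (rule subset_trans)
      fix x f assume x: "x \<in> carrier G" and "f \<in> comb ` X"
      then obtain v where v: "v \<in> X" "f = comb v" by (elim imageE)
      have "right_trans G x f = comb (\<sigma> x *\<^sub>v v)"
        unfolding v \<sigma>_def by (rule op_comb[OF right_trans_operator[OF x] inv[OF x] car[OF v(1)]])
      then show "right_trans G x f \<in> comb ` X" using X(5)[OF x v(1)] by (simp only: imageI)
    qed
    then have dich: "comb ` X = {0} \<or> comb ` X = W" using min[OF _ CW] by metis
    show "X = {0\<^sub>v n} \<or> X = carrier_vec n"
    proof (rule disjE[OF dich])
      assume "comb ` X = {0}"
      then have "v = 0\<^sub>v n" if "v \<in> X" for v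
        using imageI[OF that, of comb] inj[OF _ car[OF that], of "0\<^sub>v n"] by (simp add: comb_zero)
      then show ?thesis using X(2) by blast
    next
      assume eq: "comb ` X = W"
      have "v \<in> X" if v: "v \<in> carrier_vec n" for v
      proof -
        have "comb v \<in> comb ` X" unfolding eq by (rule comb_in)
        then obtain w where "comb v = comb w" "w \<in> X" by (rule imageE)
        then show ?thesis using inj[OF _ v car] by simp
      qed
      then show ?thesis using X(1) by blast
    qed
  qed
  moreover have "(\<Sum>x\<in>carrier G. \<phi> x * mat_trace (\<sigma> x)) = of_nat (rep_degree G \<sigma>) * l"
  proof -
    have "(\<Sum>x\<in>carrier G. \<phi> x * mat_trace (\<sigma> x)) =
        (\<Sum>x\<in>carrier G. \<Sum>i<n. \<phi> x * ip (b i) (right_trans G x (b i)))"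
      by (simp add: mat_trace_def \<sigma>_def op_matrix_def sum_distrib_left)
    also have "\<dots> = (\<Sum>i<n. \<Sum>x\<in>carrier G. \<phi> x * ip (b i) (right_trans G x (b i)))"
      by (rule sum.swap)
    also have "\<dots> = (\<Sum>i<n. ip (b i) (\<Sum>x\<in>carrier G. fscale (\<phi> x) (right_trans G x (b i))))"
      by (simp add: ip_sum_right ip_scale_right)
    also have "\<dots> = (\<Sum>i<n. ip (b i) (fscale l (b i)))"
      using b_in W(2) by (intro sum.cong refl arg_cong[of _ _ "ip _"] eig) auto
    also have "\<dots> = (\<Sum>i<n. l)" by (simp add: ip_scale_right b_orth)
    finally show ?thesis by (simp add: deg)
  qed
  ultimately show thesis by (rule that)
qed

section \<open>Admissible operators as convolutions\<close>

text \<open>The substitution \<open>h = g \<otimes> s\<close> frees the kernel from \<open>g\<close>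
  and exhibits the operator as a weighted sum of right translations; this is why it commutes with
  left translations.\<close>

lemma conv_op_apply:
  assumes "f \<in> L2 G" "g \<in> carrier G"
  shows "conv_op G \<phi> f g = (\<Sum>s\<in>carrier G. \<phi> s * f (g \<otimes> s))"
proof -
  have "conv_op G \<phi> f g = (\<Sum>h\<in>carrier G. \<phi> (inv g \<otimes> h) * f h)"
    using assms by (simp add: conv_op_def on_L2_def on_group_def)
  also have "\<dots> = (\<Sum>s\<in>carrier G. \<phi> (inv g \<otimes> (g \<otimes> s)) * f (g \<otimes> s))"
    by (rule sum_left_mult[OF assms(2), symmetric])
  also have "\<dots> = (\<Sum>s\<in>carrier G. \<phi> s * f (g \<otimes> s))"
    using assms by (intro sum.cong) (auto simp: m_assoc[symmetric])
  finally show ?thesis .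
qed

lemma conv_op_outside:
  "f \<notin> L2 G \<Longrightarrow> conv_op G \<phi> f = 0"
  "g \<notin> carrier G \<Longrightarrow> conv_op G \<phi> f g = 0"
  by (simp_all add: conv_op_def on_L2_def on_group_def)

text \<open>The three premises separate the values that are 0 by the conventions for operators and
  functions from the one genuine identity.\<close>

lemma conv_op_eqI:
  assumes "\<And>f. f \<notin> L2 G \<Longrightarrow> T f = 0"
    and "\<And>f g. f \<in> L2 G \<Longrightarrow> g \<notin> carrier G \<Longrightarrow> T f g = 0"
    and "\<And>f g. f \<in> L2 G \<Longrightarrow> g \<in> carrier G \<Longrightarrow> T f g = (\<Sum>s\<in>carrier G. \<phi> s * f (g \<otimes> s))"
  shows "T = conv_op G \<phi>"
proof (intro ext)
  fix f g
  show "T f g = conv_op G \<phi> f g"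
    using assms by (cases "f \<in> L2 G"; cases "g \<in> carrier G") (auto simp: conv_op_apply conv_op_outside)
qed

lemma conv_op_right_trans:
  assumes "f \<in> L2 G"
  shows "conv_op G \<phi> f = (\<Sum>x\<in>carrier G. fscale (\<phi> x) (right_trans G x f))"
proof
  fix g
  show "conv_op G \<phi> f g = (\<Sum>x\<in>carrier G. fscale (\<phi> x) (right_trans G x f)) g"
    using assms by (cases "g \<in> carrier G")
      (auto simp: sum_apply conv_op_apply conv_op_outside right_trans_apply fscale_def)
qed

lemma conv_op_operator: "conv_op G \<phi> \<in> L2_operators G"
  unfolding L2_operators_def mem_Collect_eq
proof (intro conjI ballI allI impI)
  fix f h c assume f: "f \<in> L2 G"
  show "conv_op G \<phi> f \<in> L2 G" by (simp add: L2_def conv_op_outside)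
  have "fscale c f \<in> L2 G" using f by (rule cfun.subspace_scale[OF subspace_L2])
  then show "conv_op G \<phi> (fscale c f) = fscale c (conv_op G \<phi> f)"
    using f by (simp add: conv_op_right_trans operatorD(4)[OF right_trans_operator]
      cfun.scale_sum_right mult.commute)
  assume h: "h \<in> L2 G"
  have "f + h \<in> L2 G" using f h by (rule cfun.subspace_add[OF subspace_L2])
  then show "conv_op G \<phi> (f + h) = conv_op G \<phi> f + conv_op G \<phi> h"
    using f h by (simp add: conv_op_right_trans operatorD(3)[OF right_trans_operator]
      cfun.scale_right_distrib sum.distrib)
qed (simp add: conv_op_outside)

lemma conv_op_add: "conv_op G (\<phi> + \<psi>) = conv_op G \<phi> + conv_op G \<psi>"
  by (rule conv_op_eqI[symmetric])
    (auto simp: conv_op_apply conv_op_outside distrib_right sum.distrib)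

lemma conv_op_diff: "conv_op G (\<phi> - \<psi>) = conv_op G \<phi> - conv_op G \<psi>"
  by (rule conv_op_eqI[symmetric])
    (auto simp: conv_op_apply conv_op_outside left_diff_distrib sum_subtractf)

lemma conv_op_rscale: "conv_op G (rscale r \<phi>) = opscale r (conv_op G \<phi>)"
  by (rule conv_op_eqI[symmetric])
    (auto simp: conv_op_apply conv_op_outside opscale_def rscale_def sum_distrib_left mult.assoc)

lemma conv_op_delta:
  assumes "h \<in> carrier G" "g \<in> carrier G"
  shows "conv_op G \<phi> (delta h) g = \<phi> (inv g \<otimes> h)"
proof -
  have "conv_op G \<phi> (delta h) g = (\<Sum>x\<in>carrier G. \<phi> (inv g \<otimes> x) * delta h x)"
    using assms by (simp add: conv_op_def on_L2_def on_group_def)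
  also have "\<dots> = (\<Sum>x\<in>carrier G. if x = h then \<phi> (inv g \<otimes> h) else 0)"
    by (intro sum.cong) (auto simp: delta_def)
  finally show ?thesis using assms by simp
qed

text \<open>The operator applied to \<open>delta x\<close> and evaluated at the identity returns the
  kernel at \<open>x\<close>.\<close>

lemma conv_op_inj:
  assumes "\<phi> \<in> L2 G" "\<psi> \<in> L2 G" "conv_op G \<phi> = conv_op G \<psi>"
  shows "\<phi> = \<psi>"
proof
  fix x
  have "\<phi> x = \<psi> x" if x: "x \<in> carrier G"
    using conv_op_delta[OF x one_closed, of \<phi>] conv_op_delta[OF x one_closed, of \<psi>] assms(3) x
    by simp
  then show "\<phi> x = \<psi> x" using assms by (cases "x \<in> carrier G") (auto simp: L2_def)
qed

lemma ip_add_left: "ip (h + k) f = ip h f + ip k f"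
  by (metis ip_cnj ip_add_right complex_cnj_add)

lemma ip_delta_left: "h \<in> carrier G \<Longrightarrow> ip (delta h) f = f h / of_nat (card (carrier G))"
  by (simp add: L2_inner_def delta_def if_distrib[of cnj] if_distrib[of "\<lambda>z. z * _"] cong: if_cong)

text \<open>Hermiticity of the convolution amounts to
  \<open>\<phi> (inv x) = cnj (\<phi> x)\<close>, invariance of the quadratic form under conjugation
  to \<open>\<phi> (inv x) = \<phi> x\<close>, and annihilation of constants to total mass 0. The
  first two together say that \<phi> is real and symmetric.\<close>

definition adm_kernels :: "('a \<Rightarrow> complex) set" where
  "adm_kernels = {\<phi> \<in> L2 G. (\<forall>x\<in>carrier G. \<phi> x \<in> \<real>) \<and> (\<forall>x\<in>carrier G. \<phi> (inv x) = \<phi> x) \<and>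
    (\<Sum>x\<in>carrier G. \<phi> x) = 0}"

text \<open>The matrix with entries \<open>\<phi> (inv g \<otimes> x)\<close> is Hermitian, since
  inverting \<open>inv g \<otimes> x\<close> exchanges \<open>g\<close> and
  \<open>x\<close>.\<close>

lemma conv_op_hermitian:
  assumes \<phi>: "\<phi> \<in> adm_kernels" and fh: "f \<in> L2 G" "h \<in> L2 G"
  shows "ip f (conv_op G \<phi> h) = ip (conv_op G \<phi> f) h"
proof -
  have sym: "cnj (\<phi> (inv g \<otimes> x)) = \<phi> (inv x \<otimes> g)" if "g \<in> carrier G" "x \<in> carrier G" for g x
  proof -
    have "\<phi> (inv x \<otimes> g) = \<phi> (inv (inv g \<otimes> x))" using that by (simp add: inv_mult_group)
    then show ?thesis using \<phi> that by (simp add: adm_kernels_def Reals_cnj_iff)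
  qed
  have "(\<Sum>g\<in>carrier G. cnj (f g) * conv_op G \<phi> h g) =
      (\<Sum>g\<in>carrier G. \<Sum>x\<in>carrier G. cnj (f g) * (\<phi> (inv g \<otimes> x) * h x))"
    using fh by (simp add: conv_op_def on_L2_def on_group_def sum_distrib_left)
  also have "\<dots> = (\<Sum>x\<in>carrier G. \<Sum>g\<in>carrier G. cnj (f g) * (\<phi> (inv g \<otimes> x) * h x))"
    by (rule sum.swap)
  also have "\<dots> = (\<Sum>x\<in>carrier G. cnj (conv_op G \<phi> f x) * h x)"
    using fh by (auto simp: conv_op_def on_L2_def on_group_def sum_distrib_right sym mult.assoc
      mult.left_commute intro!: sum.cong)
  finally show ?thesis by (simp add: L2_inner_def)
qed

lemma left_trans_apply:
  "f \<in> L2 G \<Longrightarrow> left_trans G a f g = (if g \<in> carrier G then f (inv a \<otimes> g) else 0)"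
  by (simp add: left_trans_def on_L2_def on_group_def)

lemma left_trans_L2: "left_trans G a f \<in> L2 G"
  by (auto simp: left_trans_def on_L2_def) (simp add: L2_def)

lemma conv_op_cnj:
  assumes \<phi>: "\<phi> \<in> adm_kernels" and f: "f \<in> L2 G"
  shows "conv_op G \<phi> (\<lambda>g. cnj (f g)) = (\<lambda>g. cnj (conv_op G \<phi> f g))"
proof
  fix g
  have "(\<lambda>g. cnj (f g)) \<in> L2 G" using f by (simp add: L2_def)
  then show "conv_op G \<phi> (\<lambda>g. cnj (f g)) g = cnj (conv_op G \<phi> f g)"
    using f \<phi> by (cases "g \<in> carrier G")
      (auto simp: conv_op_apply conv_op_outside adm_kernels_def Reals_cnj_iff intro!: sum.cong)
qed

lemma conv_op_admissible:
  assumes \<phi>: "\<phi> \<in> adm_kernels"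
  shows "conv_op G \<phi> \<in> admissible G"
  unfolding admissible_def mem_Collect_eq
proof (intro conjI ballI allI conv_op_operator)
  fix f h a c
  show "conv_op G \<phi> (on_group G (\<lambda>_. c)) = 0"
  proof
    fix g
    show "conv_op G \<phi> (on_group G (\<lambda>_. c)) g = 0 g"
    proof (cases "g \<in> carrier G")
      case True
      have "conv_op G \<phi> (on_group G (\<lambda>_. c)) g = (\<Sum>s\<in>carrier G. \<phi> s * c)"
        unfolding conv_op_apply[OF on_group_L2 True]
        using True by (intro sum.cong) (auto simp: on_group_def)
      then show ?thesis using \<phi> by (simp add: adm_kernels_def sum_distrib_right[symmetric])
    qed (simp add: conv_op_outside)
  qed
  assume f: "f \<in> L2 G"
  show "ip (\<lambda>g. cnj (f g)) (conv_op G \<phi> (\<lambda>g. cnj (f g))) = ip f (conv_op G \<phi> f)"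
  proof -
    have "ip (\<lambda>g. cnj (f g)) (conv_op G \<phi> (\<lambda>g. cnj (f g))) = ip (conv_op G \<phi> f) f"
      unfolding conv_op_cnj[OF \<phi> f] by (simp add: L2_inner_def mult.commute)
    then show ?thesis using conv_op_hermitian[OF \<phi> f f] by simp
  qed
  show "ip f (conv_op G \<phi> h) = ip (conv_op G \<phi> f) h" if "h \<in> L2 G"
    by (rule conv_op_hermitian[OF \<phi> f that])
  show "conv_op G \<phi> (left_trans G a f) = left_trans G a (conv_op G \<phi> f)" if a: "a \<in> carrier G"
  proof
    fix g
    have Tf: "conv_op G \<phi> f \<in> L2 G" by (rule operatorD(1)[OF conv_op_operator f])
    show "conv_op G \<phi> (left_trans G a f) g = left_trans G a (conv_op G \<phi> f) g"
      using a f by (cases "g \<in> carrier G")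
       (auto simp: conv_op_apply[OF left_trans_L2] conv_op_apply[OF f] conv_op_outside
         left_trans_apply[OF f] left_trans_apply[OF Tf] m_assoc intro!: sum.cong)
  qed
qed

text \<open>All point masses are left translates of \<open>delta \<one>\<close>, so \<open>T\<close>
  is determined by its value there. The conditions on the kernel come from testing the conditions on
  \<open>T\<close> against point masses and the constant 1.\<close>

lemma admissible_conv_op:
  assumes T: "T \<in> admissible G"
  obtains \<phi> where "\<phi> \<in> adm_kernels" "T = conv_op G \<phi>"
proof -
  note A = T[unfolded admissible_def mem_Collect_eq]
  have op: "T \<in> L2_operators G" using A by blast
  \<comment> \<open>Convolution with \<phi> sends \<open>delta \<one>\<close> to
    \<open>\<phi> (inv g)\<close> at \<open>g\<close>, hence the inverse.\<close>
  define \<phi> where "\<phi> = on_group G (\<lambda>x. T (delta \<one>) (inv x))"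
  have \<phi>: "\<phi> \<in> L2 G" by (simp add: \<phi>_def)
  have Td: "T (delta h) g = \<phi> (inv g \<otimes> h)" if gh: "g \<in> carrier G" "h \<in> carrier G" for g h
  proof -
    have "left_trans G h (delta \<one>) = delta h"
    proof
      fix x
      show "left_trans G h (delta \<one>) x = delta h x"
      proof (cases "x \<in> carrier G")
        case True
        have "inv h \<otimes> x = \<one> \<longleftrightarrow> x = h"
          using True gh inv_solve_left'[of \<one> h x] by auto
        then show ?thesis
          using True unfolding left_trans_apply[OF delta_L2[OF one_closed]] by (simp add: delta_def)
      next
        case False
        then show ?thesis
          using gh unfolding left_trans_apply[OF delta_L2[OF one_closed]] by (auto simp: delta_def)
      qed
    qed
    then have "T (delta h) = left_trans G h (T (delta \<one>))"
      using A gh by (metis delta_L2 one_closed)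
    then have "T (delta h) g = T (delta \<one>) (inv h \<otimes> g)"
      using gh operatorD(1)[OF op, of "delta \<one>"] by (simp add: left_trans_apply)
    then show ?thesis using gh by (simp add: \<phi>_def on_group_def inv_mult_group)
  qed
  have Teq: "T = conv_op G \<phi>"
  proof (intro ext)
    fix f g
    consider "f \<notin> L2 G" | "f \<in> L2 G" "g \<notin> carrier G" | "f \<in> L2 G" "g \<in> carrier G" by blast
    then show "T f g = conv_op G \<phi> f g"
    proof cases
      case 1 then show ?thesis using operatorD(2)[OF op] by (simp add: conv_op_outside)
    next
      case 2 then show ?thesis using operatorD(1)[OF op, of f] by (auto simp: conv_op_outside L2_def)
    next
      case 3
      have "T f = T (\<Sum>h\<in>carrier G. fscale (f h) (delta h))" using L2_delta_expansion[OF 3(1)] by simp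
      also have "\<dots> = (\<Sum>h\<in>carrier G. fscale (f h) (T (delta h)))"
        by (rule operator_sum[OF op]) simp
      finally have "T f g = (\<Sum>h\<in>carrier G. \<phi> (inv g \<otimes> h) * f h)"
        using 3 by (simp add: sum_apply fscale_def Td mult.commute)
      then show ?thesis using 3 by (simp add: conv_op_def on_L2_def on_group_def)
    qed
  qed
  have N: "of_nat (card (carrier G)) \<noteq> (0 :: complex)"
    unfolding of_nat_eq_0_iff using card_carrier_pos by linarith
  have herm: "\<phi> x = cnj (\<phi> (inv x))" if x: "x \<in> carrier G" for x
  proof -
    have "ip (delta \<one>) (T (delta x)) = ip (T (delta \<one>)) (delta x)"
      using A x by simp
    also have "\<dots> = cnj (ip (delta x) (T (delta \<one>)))" by (rule ip_cnj[symmetric])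
    finally show ?thesis using x N by (simp add: ip_delta_left Td)
  qed
  have sym: "\<phi> (inv x) = \<phi> x" if x: "x \<in> carrier G" for x
  proof -
    \<comment> \<open>Polarisation: \<open>f\<close> and its conjugate differ only in the sign of
      \<open>\<i>\<close>, so equal quadratic forms force the two mixed terms to be equal.\<close>
    define f where "f = delta \<one> + fscale \<i> (delta x)"
    have dx: "fscale c (delta x) \<in> L2 G" for c using x by (intro cfun.subspace_scale[OF subspace_L2]) simp
    have f: "f \<in> L2 G" unfolding f_def using dx by (intro cfun.subspace_add[OF subspace_L2]) auto
    have cf: "(\<lambda>g. cnj (f g)) = delta \<one> + fscale (-\<i>) (delta x)"
      by (auto simp: f_def delta_def fscale_def fun_eq_iff)
    have exp: "ip (delta \<one> + fscale c (delta x)) (T (delta \<one> + fscale c (delta x))) =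
      ip (delta \<one>) (T (delta \<one>)) + c * ip (delta \<one>) (T (delta x)) + cnj c * ip (delta x) (T (delta \<one>))
       + c * cnj c * ip (delta x) (T (delta x))" for c
      using dx x by (simp add: operatorD(3,4)[OF op] ip_add_left ip_add_right ip_scale_left
        ip_scale_right algebra_simps)
    have "ip (\<lambda>g. cnj (f g)) (T (\<lambda>g. cnj (f g))) = ip f (T f)" using A f by blast
    then have "ip (delta \<one>) (T (delta x)) = ip (delta x) (T (delta \<one>))"
      unfolding cf unfolding f_def exp by (simp add: algebra_simps complex_eq_iff)
    then show ?thesis using x N by (simp add: ip_delta_left Td)
  qed
  have "T (on_group G (\<lambda>_. 1)) \<one> = (\<Sum>s\<in>carrier G. \<phi> s)"
    unfolding Teq conv_op_apply[OF on_group_L2 one_closed]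
    by (intro sum.cong) (auto simp: on_group_def)
  moreover have "T (on_group G (\<lambda>_. 1)) = 0" using A by blast
  ultimately have "(\<Sum>s\<in>carrier G. \<phi> s) = 0" by simp
  moreover have "\<phi> x \<in> \<real>" if "x \<in> carrier G" for x
    using herm[OF that] sym[OF that] by (simp add: Reals_cnj_iff)
  ultimately have "\<phi> \<in> adm_kernels" using \<phi> sym by (simp add: adm_kernels_def)
  then show thesis using Teq by (rule that)
qed

lemma admissible_eq: "admissible G = conv_op G ` adm_kernels"
  using conv_op_admissible by (auto elim: admissible_conv_op)

text \<open>Constancy on conjugacy classes in a form free of inverses. Nothing is required outside
  \<open>carrier G\<close>, so characters qualify although a representation is arbitrary
  there.\<close>

definition class_functions :: "('a \<Rightarrow> complex) set" where
  "class_functions = {\<phi>. \<forall>x\<in>carrier G. \<forall>y\<in>carrier G. \<phi> (x \<otimes> y) = \<phi> (y \<otimes> x)}"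

text \<open>Both compositions are convolutions with a shifted kernel,
  \<open>\<phi> (s \<otimes> inv b)\<close> in one order and
  \<open>\<phi> (inv b \<otimes> s)\<close> in the other; point masses separate the kernels.\<close>

lemma conv_op_commute_right_iff:
  "(\<forall>b\<in>carrier G. \<forall>f\<in>L2 G. conv_op G \<phi> (right_trans G b f) = right_trans G b (conv_op G \<phi> f)) \<longleftrightarrow>
    \<phi> \<in> class_functions"
proof -
  have R: "right_trans G b f \<in> L2 G" if "f \<in> L2 G" "b \<in> carrier G" for f b
    by (rule operatorD(1)[OF right_trans_operator[OF that(2)] that(1)])
  have 1: "conv_op G \<phi> (right_trans G b f) g = (\<Sum>s\<in>carrier G. \<phi> (s \<otimes> inv b) * f (g \<otimes> s))"
    if "f \<in> L2 G" "b \<in> carrier G" "g \<in> carrier G" for f b g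
  proof -
    have "conv_op G \<phi> (right_trans G b f) g = (\<Sum>s\<in>carrier G. \<phi> s * f (g \<otimes> s \<otimes> b))"
      using that R[OF that(1,2)] by (auto simp: conv_op_apply right_trans_apply intro!: sum.cong)
    also have "\<dots> = (\<Sum>s\<in>carrier G. \<phi> (s \<otimes> inv b) * f (g \<otimes> (s \<otimes> inv b) \<otimes> b))"
      using that by (intro sum_right_mult[symmetric]) simp
    also have "\<dots> = (\<Sum>s\<in>carrier G. \<phi> (s \<otimes> inv b) * f (g \<otimes> s))"
      using that by (intro sum.cong) (auto simp: m_assoc)
    finally show ?thesis .
  qed
  have 2: "right_trans G b (conv_op G \<phi> f) g = (\<Sum>s\<in>carrier G. \<phi> (inv b \<otimes> s) * f (g \<otimes> s))"
    if "f \<in> L2 G" "b \<in> carrier G" "g \<in> carrier G" for f b g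
  proof -
    have "right_trans G b (conv_op G \<phi> f) g = (\<Sum>s\<in>carrier G. \<phi> s * f (g \<otimes> b \<otimes> s))"
      using that operatorD(1)[OF conv_op_operator that(1)]
      by (auto simp: conv_op_apply right_trans_apply intro!: sum.cong)
    also have "\<dots> = (\<Sum>s\<in>carrier G. \<phi> (inv b \<otimes> s) * f (g \<otimes> b \<otimes> (inv b \<otimes> s)))"
      using that by (intro sum_left_mult[symmetric]) simp
    also have "\<dots> = (\<Sum>s\<in>carrier G. \<phi> (inv b \<otimes> s) * f (g \<otimes> s))"
    proof (intro sum.cong refl)
      fix s assume "s \<in> carrier G"
      then have "g \<otimes> b \<otimes> (inv b \<otimes> s) = g \<otimes> s"
        using that by (metis inv_closed m_assoc m_closed r_inv l_one)
      then show "\<phi> (inv b \<otimes> s) * f (g \<otimes> b \<otimes> (inv b \<otimes> s)) = \<phi> (inv b \<otimes> s) * f (g \<otimes> s)" by simp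
    qed
    finally show ?thesis .
  qed
  show ?thesis
  proof
    assume "\<phi> \<in> class_functions"
    then have c: "\<phi> (s \<otimes> inv b) = \<phi> (inv b \<otimes> s)" if "b \<in> carrier G" "s \<in> carrier G" for b s
      using that by (simp add: class_functions_def)
    show "\<forall>b\<in>carrier G. \<forall>f\<in>L2 G. conv_op G \<phi> (right_trans G b f) = right_trans G b (conv_op G \<phi> f)"
    proof (intro ballI ext)
      fix b f g assume bf: "b \<in> carrier G" "f \<in> L2 G"
      show "conv_op G \<phi> (right_trans G b f) g = right_trans G b (conv_op G \<phi> f) g"
      proof (cases "g \<in> carrier G")
        case True
        have "conv_op G \<phi> (right_trans G b f) g = (\<Sum>s\<in>carrier G. \<phi> (s \<otimes> inv b) * f (g \<otimes> s))"
          by (rule 1[OF bf(2,1) True])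
        also have "\<dots> = (\<Sum>s\<in>carrier G. \<phi> (inv b \<otimes> s) * f (g \<otimes> s))"
          using bf by (intro sum.cong) (auto simp: c)
        also have "\<dots> = right_trans G b (conv_op G \<phi> f) g"
          by (rule 2[OF bf(2,1) True, symmetric])
        finally show ?thesis .
      qed (use bf in \<open>simp add: conv_op_outside right_trans_apply operatorD(1)[OF conv_op_operator]\<close>)
    qed
  next
    assume comm: "\<forall>b\<in>carrier G. \<forall>f\<in>L2 G. conv_op G \<phi> (right_trans G b f) = right_trans G b (conv_op G \<phi> f)"
    show "\<phi> \<in> class_functions"
      unfolding class_functions_def
    proof (intro CollectI ballI)
      fix x y assume xy: "x \<in> carrier G" "y \<in> carrier G"
      have e: "(\<Sum>s\<in>carrier G. F s * delta x (\<one> \<otimes> s)) = F x" for F :: "'a \<Rightarrow> complex"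
      proof -
        have "(\<Sum>s\<in>carrier G. F s * delta x (\<one> \<otimes> s)) = (\<Sum>s\<in>carrier G. if s = x then F x else 0)"
          by (intro sum.cong) (auto simp: delta_def)
        then show ?thesis using xy by simp
      qed
      \<comment> \<open>Translating by \<open>inv y\<close> makes the shift by its inverse a
        multiplication by \<open>y\<close>, on the right on one side and on the left on the
        other.\<close>
      have "conv_op G \<phi> (right_trans G (inv y) (delta x)) \<one> = right_trans G (inv y) (conv_op G \<phi> (delta x)) \<one>"
        using comm xy by simp
      then show "\<phi> (x \<otimes> y) = \<phi> (y \<otimes> x)"
        using xy by (simp only: 1 2 delta_L2 inv_closed one_closed e inv_inv)
    qed
  qed
qed

section \<open>Mean eigenvalues as character sums\<close>

text \<open>Unitarity identifies the inverse of \<open>\<sigma> x\<close> with its adjoint. This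
  turns Schur's relations, which involve \<open>inv x\<close>, into inner products.\<close>

lemma unitary_inv_index:
  assumes \<sigma>: "\<sigma> \<in> irreducible_reps G" and u: "unitary_rep G \<sigma>" and x: "x \<in> carrier G"
    and ij: "i < rep_degree G \<sigma>" "j < rep_degree G \<sigma>"
  shows "\<sigma> (inv x) $$ (i, j) = cnj (\<sigma> x $$ (j, i))"
proof -
  let ?d = "rep_degree G \<sigma>"
  note sx = irreducibleD(2)[OF \<sigma> x] and sy = irreducibleD(2)[OF \<sigma> inv_closed[OF x]]
  have adj: "mat_adjoint (\<sigma> x) \<in> carrier_mat ?d ?d"
    using sx by (intro carrier_matI) (simp_all add: mat_adjoint_def)
  have "\<sigma> (inv x) = \<sigma> (inv x) * (\<sigma> x * mat_adjoint (\<sigma> x))"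
    using u x sy by (simp add: unitary_rep_def)
  also have "\<dots> = \<sigma> (inv x) * \<sigma> x * mat_adjoint (\<sigma> x)"
    by (rule assoc_mult_mat[OF sy sx adj, symmetric])
  also have "\<sigma> (inv x) * \<sigma> x = 1\<^sub>m ?d"
    using irreducibleD(4)[OF \<sigma> inv_closed[OF x] x] x by (simp add: irreducibleD(3)[OF \<sigma>])
  also have "1\<^sub>m ?d * mat_adjoint (\<sigma> x) = mat_adjoint (\<sigma> x)" using adj by simp
  finally have "\<sigma> (inv x) = mat_adjoint (\<sigma> x)" .
  then show ?thesis using sx ij by (simp add: mat_adjoint_def mat_of_rows_def)
qed

lemma trace_inv:
  assumes "\<sigma> \<in> irreducible_reps G" "unitary_rep G \<sigma>" "x \<in> carrier G"
  shows "mat_trace (\<sigma> (inv x)) = cnj (mat_trace (\<sigma> x))"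
  using carrier_matD(1)[OF irreducibleD(2)[OF assms(1,3)]]
    carrier_matD(1)[OF irreducibleD(2)[OF assms(1) inv_closed[OF assms(3)]]]
  by (simp add: mat_trace_def unitary_inv_index[OF assms])

lemma trace_class_function:
  assumes \<sigma>: "\<sigma> \<in> irreducible_reps G"
  shows "(\<lambda>x. mat_trace (\<sigma> x)) \<in> class_functions"
  unfolding class_functions_def
proof (intro CollectI ballI)
  fix x y assume xy: "x \<in> carrier G" "y \<in> carrier G"
  show "mat_trace (\<sigma> (x \<otimes> y)) = mat_trace (\<sigma> (y \<otimes> x))"
    unfolding irreducibleD(4)[OF \<sigma> xy] irreducibleD(4)[OF \<sigma> xy(2,1)]
    by (rule mat_trace_comm[OF irreducibleD(2)[OF \<sigma> xy(1)] irreducibleD(2)[OF \<sigma> xy(2)]])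
qed

lemma rep_equiv_trace:
  assumes "(\<sigma>, \<tau>) \<in> rep_equiv G" "x \<in> carrier G"
  shows "mat_trace (\<sigma> x) = mat_trace (\<tau> x)"
proof -
  from assms(1) obtain P Q where \<sigma>: "\<sigma> \<in> irreducible_reps G" and \<tau>: "\<tau> \<in> irreducible_reps G"
    and d: "rep_degree G \<sigma> = rep_degree G \<tau>"
    and P: "P \<in> carrier_mat (rep_degree G \<tau>) (rep_degree G \<tau>)"
    and Q: "Q \<in> carrier_mat (rep_degree G \<tau>) (rep_degree G \<tau>)"
    and PQ: "P * Q = 1\<^sub>m (rep_degree G \<tau>)" and QP: "Q * P = 1\<^sub>m (rep_degree G \<tau>)"
    and int: "\<And>g. g \<in> carrier G \<Longrightarrow> P * \<sigma> g = \<tau> g * P" by (elim rep_equivE) auto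
  note sx = irreducibleD(2)[OF \<sigma> assms(2), unfolded d] and tx = irreducibleD(2)[OF \<tau> assms(2)]
  have "mat_trace (\<sigma> x) = mat_trace (Q * P * \<sigma> x)" using sx by (simp add: QP)
  also have "Q * P * \<sigma> x = Q * (\<tau> x * P)"
    by (simp only: assoc_mult_mat[OF Q P sx] int[OF assms(2)])
  also have "mat_trace \<dots> = mat_trace (\<tau> x * P * Q)"
    by (rule mat_trace_comm[OF Q mult_carrier_mat[OF tx P]])
  also have "\<tau> x * P * Q = \<tau> x" using tx by (simp add: assoc_mult_mat[OF tx P Q] PQ)
  finally show ?thesis .
qed

lemma rep_equiv_degree: "(\<sigma>, \<tau>) \<in> rep_equiv G \<Longrightarrow> rep_degree G \<sigma> = rep_degree G \<tau>"
  by (simp add: rep_equiv_def)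

lemma onb_span:
  assumes "orthonormal B" "finite B"
  shows "onb (cfun.span B) B"
  unfolding onb_def
proof (intro conjI ballI assms cfun.span_superset)
  fix f assume "f \<in> cfun.span B"
  then obtain u where f: "f = (\<Sum>c\<in>B. fscale (u c) c)"
    unfolding cfun.span_finite[OF assms(2)] by blast
  have "ip b f = u b" if b: "b \<in> B" for b
  proof -
    have "ip b f = (\<Sum>c\<in>B. if c = b then u b else 0)"
      unfolding f ip_sum_right ip_scale_right
      using assms b by (intro sum.cong) (auto simp: orthonormal_def)
    then show ?thesis using b assms by simp
  qed
  then show "f = (\<Sum>b\<in>B. fscale (ip b f) b)" using f by simp
qed

text \<open>The operator maps the coefficient \<sigma>_ij to a combination of the \<sigma>_ik with
  weights \<open>M k j\<close> that do not depend on \<open>i\<close>. Its trace on the coefficient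
  space, of dimension d^2, is therefore d times the trace of \<open>M\<close>, which leaves a single
  division by d.\<close>

lemma mean_eigenvalue_coeff_space:
  assumes \<phi>: "\<phi> \<in> adm_kernels" and \<sigma>: "\<sigma> \<in> irreducible_reps G" and u: "unitary_rep G \<sigma>"
  shows "mean_eigenvalue (conv_op G \<phi>) (coeff_space G \<sigma>) =
    (\<Sum>x\<in>carrier G. \<phi> x * mat_trace (\<sigma> x)) / of_nat (rep_degree G \<sigma>)"
proof -
  let ?d = "rep_degree G \<sigma>"
  let ?I = "{..<?d} \<times> {..<?d}"
  let ?V = "coeff_space G \<sigma>"
  let ?T = "conv_op G \<phi>"
  have dpos: "?d > 0" by (rule irreducibleD(1)[OF \<sigma>])
  define e where "e i j = on_group G (\<lambda>g. \<sigma> g $$ (i, j))" for i j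
  \<comment> \<open>By Schur orthogonality a matrix coefficient has squared norm
    \<open>1 / ?d\<close>; the factor \<open>c\<close> normalises it.\<close>
  define c :: complex where "c = of_real (sqrt (real ?d))"
  have c2: "cnj c * c = of_nat ?d" "c \<noteq> 0" "c * c = of_nat ?d"
    using dpos by (auto simp: c_def of_real_mult[symmetric] simp del: of_real_mult)
  have ip_e: "ip (e i j) (e k l) = (if i = k \<and> j = l then 1 / of_nat ?d else 0)"
    if "i < ?d" "j < ?d" "k < ?d" "l < ?d" for i j k l
  proof -
    have "(\<Sum>g\<in>carrier G. cnj (e i j g) * e k l g) = (\<Sum>x\<in>carrier G. \<sigma> x $$ (k, l) * \<sigma> (inv x) $$ (j, i))"
      using that by (intro sum.cong) (auto simp: e_def on_group_def unitary_inv_index[OF \<sigma> u])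
    also have "\<dots> = (if k = i \<and> l = j then of_nat (card (carrier G)) / of_nat ?d else 0)"
      by (rule rep_coeff_orthogonal[OF \<sigma> that(3,4,2,1)])
    finally show ?thesis
      using card_carrier_pos by (auto simp: L2_inner_def)
  qed
  define w where "w p = fscale c (e (fst p) (snd p))" for p
  define B where "B = w ` ?I"
  have ip_w: "ip (w p) (w q) = (if p = q then 1 else 0)" if "p \<in> ?I" "q \<in> ?I" for p q
  proof -
    have "ip (w p) (w q) = (cnj c * c) * ip (e (fst p) (snd p)) (e (fst q) (snd q))"
      by (simp only: w_def ip_scale_left ip_scale_right mult.assoc mult.left_commute)
    also have "ip (e (fst p) (snd p)) (e (fst q) (snd q)) = (if p = q then 1 / of_nat ?d else 0)"
      using that by (subst ip_e) (auto simp: prod_eq_iff)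
    finally show ?thesis using dpos c2 by simp
  qed
  have inj: "inj_on w ?I"
  proof (rule inj_onI, rule ccontr)
    fix p q assume "p \<in> ?I" "q \<in> ?I" "w p = w q" "p \<noteq> q"
    then show False using ip_w[of p q] ip_w[of q q] by auto
  qed
  have on: "orthonormal B"
    unfolding orthonormal_def B_def using ip_w inj by (auto simp: inj_on_def)
  have fin: "finite B" by (simp add: B_def)
  have span: "?V = cfun.span B"
  proof -
    have S: "{on_group G (\<lambda>g. \<sigma> g $$ (i, j)) |i j. i < ?d \<and> j < ?d} = (\<lambda>p. e (fst p) (snd p)) ` ?I"
      by (force simp: e_def)
    show ?thesis
      unfolding coeff_space_def S cfun.span_eq B_def
    proof (intro conjI subsetI)
      fix f assume "f \<in> (\<lambda>p. e (fst p) (snd p)) ` ?I"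
      then obtain p where p: "p \<in> ?I" "f = e (fst p) (snd p)" by blast
      then have "f = fscale (1 / c) (w p)" using c2 by (simp add: w_def)
      then show "f \<in> cfun.span (w ` ?I)"
        using p by (simp only: cfun.span_scale cfun.span_base imageI)
    next
      fix f assume "f \<in> w ` ?I"
      then obtain p where p: "p \<in> ?I" "f = w p" by blast
      show "f \<in> cfun.span ((\<lambda>p. e (fst p) (snd p)) ` ?I)"
        unfolding p(2) w_def by (rule cfun.span_scale[OF cfun.span_base[OF imageI[OF p(1)]]])
    qed
  qed
  have V: "cfun.subspace ?V" by (simp add: coeff_space_def)
  have BL: "B \<subseteq> L2 G"
    by (auto simp: B_def w_def e_def intro!: cfun.subspace_scale[OF subspace_L2])
  have VL: "?V \<subseteq> L2 G" unfolding span by (rule cfun.span_minimal[OF BL subspace_L2])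
  have B: "onb ?V B" unfolding span by (rule onb_span[OF on fin])
  \<comment> \<open>The entries of the Fourier transform of \<phi> at \<sigma>, the sum of the
    matrices \<sigma>(s) weighted by \<phi>(s).\<close>
  define M where "M k j = (\<Sum>s\<in>carrier G. \<phi> s * \<sigma> s $$ (k, j))" for k j
  have Te: "?T (e i j) = (\<Sum>k<?d. fscale (M k j) (e i k))" if ij: "i < ?d" "j < ?d" for i j
  proof
    fix g
    show "?T (e i j) g = (\<Sum>k<?d. fscale (M k j) (e i k)) g"
    proof (cases "g \<in> carrier G")
      case True
      have "?T (e i j) g = (\<Sum>s\<in>carrier G. \<phi> s * \<sigma> (g \<otimes> s) $$ (i, j))"
        unfolding e_def conv_op_apply[OF on_group_L2 True]
        using True by (intro sum.cong) (auto simp: on_group_def)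
      also have "\<dots> = (\<Sum>s\<in>carrier G. \<Sum>k<?d. \<phi> s * \<sigma> s $$ (k, j) * \<sigma> g $$ (i, k))"
        using True ij by (intro sum.cong) (auto simp: rep_index_mult[OF \<sigma>] sum_distrib_left mult_ac)
      also have "\<dots> = (\<Sum>k<?d. \<Sum>s\<in>carrier G. \<phi> s * \<sigma> s $$ (k, j) * \<sigma> g $$ (i, k))"
        by (rule sum.swap)
      also have "\<dots> = (\<Sum>k<?d. fscale (M k j) (e i k)) g"
        using True by (simp add: sum_apply fscale_def M_def e_def on_group_def sum_distrib_right)
      finally show ?thesis .
    next
      case False
      then show ?thesis by (simp add: conv_op_outside sum_apply fscale_def e_def on_group_def)
    qed
  qed
  have eV: "e i j \<in> ?V" if "i < ?d" "j < ?d" for i j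
    unfolding coeff_space_def e_def using that by (intro cfun.span_base) blast
  have eL: "e i j \<in> L2 G" for i j by (simp add: e_def)
  have wT: "?T (w p) = fscale c (?T (e (fst p) (snd p)))" for p
    unfolding w_def by (rule operatorD(4)[OF conv_op_operator eL])
  have TV: "?T f \<in> ?V" if "f \<in> ?V" for f
  proof -
    have "f = (\<Sum>b\<in>B. fscale (ip b f) b)" using B that by (auto simp: onb_def)
    then have "?T f = ?T (\<Sum>b\<in>B. fscale (ip b f) b)" by simp
    also have "\<dots> = (\<Sum>b\<in>B. fscale (ip b f) (?T b))"
      using BL by (intro operator_sum[OF conv_op_operator]) auto
    also have "\<dots> \<in> ?V"
    proof (intro cfun.subspace_sum cfun.subspace_scale V)
      fix b assume "b \<in> B"
      then obtain p where p: "p \<in> ?I" "b = w p" by (auto simp: B_def)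
      show "?T b \<in> ?V"
        unfolding p(2) wT using p(1)
        by (auto simp: Te intro!: cfun.subspace_sum cfun.subspace_scale V eV)
    qed
    finally show ?thesis .
  qed
  \<comment> \<open>The elements of \<open>B\<close> need not be eigenvectors, so the mean is
    evaluated in an eigenbasis \<open>C\<close> and the trace is then transferred to
    \<open>B\<close>.\<close>
  obtain C \<mu> where C: "onb ?V C" and eig: "\<And>b. b \<in> C \<Longrightarrow> ?T b = fscale (\<mu> b) b"
    by (rule spectral_theorem[OF conv_op_operator conv_op_hermitian[OF \<phi>] V VL TV]) auto
  have "mean_eigenvalue ?T ?V = (\<Sum>b\<in>C. ip b (?T b)) / of_nat (card C)"
    by (rule mean_eigenvalue_onb[OF conv_op_operator VL V C eig])
  also have "(\<Sum>b\<in>C. ip b (?T b)) = (\<Sum>b\<in>B. ip b (?T b))"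
    by (rule onb_trace_eq[OF conv_op_operator VL TV C B])
  also have "card C = card B" using onb_dim(1)[OF C V] onb_dim(1)[OF B V] by simp
  also have "card B = ?d * ?d" unfolding B_def card_image[OF inj] by simp
  also have "(\<Sum>b\<in>B. ip b (?T b)) = (\<Sum>p\<in>?I. ip (w p) (?T (w p)))"
    unfolding B_def sum.reindex[OF inj] by simp
  also have "\<dots> = (\<Sum>p\<in>?I. M (snd p) (snd p))"
  proof (intro sum.cong refl)
    fix p assume p: "p \<in> ?I"
    then have ij: "fst p < ?d" "snd p < ?d" by auto
    have "ip (w p) (?T (w p)) = (cnj c * c) * ip (e (fst p) (snd p)) (?T (e (fst p) (snd p)))"
      unfolding wT by (simp only: w_def ip_scale_left ip_scale_right mult.assoc mult.left_commute)
    also have "ip (e (fst p) (snd p)) (?T (e (fst p) (snd p))) =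
        (\<Sum>k<?d. if k = snd p then M (snd p) (snd p) / of_nat ?d else 0)"
      unfolding Te[OF ij] ip_sum_right ip_scale_right
      using ij by (intro sum.cong) (auto simp: ip_e)
    also have "\<dots> = M (snd p) (snd p) / of_nat ?d" using ij by simp
    finally show "ip (w p) (?T (w p)) = M (snd p) (snd p)" using c2 dpos by simp
  qed
  also have "\<dots> = of_nat ?d * (\<Sum>j<?d. M j j)"
    by (simp add: sum.cartesian_product')
  also have "(\<Sum>j<?d. M j j) = (\<Sum>x\<in>carrier G. \<phi> x * mat_trace (\<sigma> x))"
    unfolding M_def by (subst sum.swap)
      (auto simp: mat_trace_def sum_distrib_left carrier_matD(1)[OF irreducibleD(2)[OF \<sigma>]] intro!: sum.cong)
  finally show ?thesis using dpos by simp
qed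

section \<open>Class functions and symmetric conjugacy classes\<close>

lemma subspace_adm_kernels: "rfun.subspace adm_kernels"
proof (rule rfun.subspaceI)
  show "0 \<in> adm_kernels" by (simp add: adm_kernels_def L2_def)
next
  fix \<phi> \<psi> assume "\<phi> \<in> adm_kernels" "\<psi> \<in> adm_kernels"
  then show "\<phi> + \<psi> \<in> adm_kernels" by (simp add: adm_kernels_def L2_def sum.distrib)
next
  fix r \<phi> assume "\<phi> \<in> adm_kernels"
  then show "rscale r \<phi> \<in> adm_kernels"
    by (simp add: adm_kernels_def L2_def rscale_def sum_distrib_left[symmetric])
qed

lemma subspace_class_functions: "rfun.subspace class_functions"
  by (rule rfun.subspaceI) (auto simp: class_functions_def rscale_def)

lemma subspace_conv_op_image:
  assumes "rfun.subspace X"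
  shows "rop.subspace (conv_op G ` X)"
proof (rule rop.subspaceI)
  have "conv_op G (rscale 0 0) = opscale 0 (conv_op G 0)" by (rule conv_op_rscale)
  then have "conv_op G 0 = 0" by simp
  then show "0 \<in> conv_op G ` X" using rfun.subspace_0[OF assms] by (metis imageI)
next
  fix S T assume "S \<in> conv_op G ` X" "T \<in> conv_op G ` X"
  then show "S + T \<in> conv_op G ` X"
    using rfun.subspace_add[OF assms] by (auto simp: conv_op_add[symmetric])
next
  fix r T assume "T \<in> conv_op G ` X"
  then show "opscale r T \<in> conv_op G ` X"
    using rfun.subspace_scale[OF assms] by (auto simp: conv_op_rscale[symmetric])
qed

lemma adm_kernels_L2: "\<phi> \<in> adm_kernels \<Longrightarrow> \<phi> \<in> L2 G"
  by (simp add: adm_kernels_def)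

text \<open>Completeness of the irreducible characters, read off from a spectrum: in an eigenbasis
  of \<open>L2 G\<close> the claim reduces to the vanishing of each eigenvalue, and a nonzero one
  would be detected by a character coming from its eigenspace.\<close>

lemma class_function_complete:
  assumes \<phi>: "\<phi> \<in> adm_kernels" "\<phi> \<in> class_functions"
    and van: "\<And>\<sigma>. \<sigma> \<in> irreducible_reps G \<Longrightarrow> (\<Sum>x\<in>carrier G. \<phi> x * mat_trace (\<sigma> x)) = 0"
  shows "\<phi> = 0"
proof -
  let ?T = "conv_op G \<phi>"
  have comm: "?T (right_trans G b f) = right_trans G b (?T f)" if "b \<in> carrier G" "f \<in> L2 G" for b f
    using \<phi>(2) that conv_op_commute_right_iff by blast
  obtain B \<mu> where B: "onb (L2 G) B" and eig: "\<And>b. b \<in> B \<Longrightarrow> ?T b = fscale (\<mu> b) b"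
    by (rule spectral_theorem[OF conv_op_operator conv_op_hermitian[OF \<phi>(1)] subspace_L2 subset_refl
      operatorD(1)[OF conv_op_operator]]) auto
  have zero: "\<mu> b = 0" if b: "b \<in> B" for b
  proof (rule ccontr)
    assume nz: "\<mu> b \<noteq> 0"
    define U where "U = {f \<in> L2 G. ?T f = fscale (\<mu> b) f}"
    have bU: "b \<in> U" using b B eig by (auto simp: U_def onb_def)
    have b0: "b \<noteq> 0" using b B by (force simp: onb_def orthonormal_def ip_zero_left)
    have "cfun.subspace U"
    proof (rule cfun.subspaceI)
      show "0 \<in> U"
        using cfun.subspace_0[OF subspace_L2] operatorD(4)[OF conv_op_operator[of \<phi>], of 0 0] by (simp add: U_def)
    next
      fix f h assume "f \<in> U" "h \<in> U"
      then show "f + h \<in> U"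
        using cfun.subspace_add[OF subspace_L2]
        by (simp add: U_def operatorD(3)[OF conv_op_operator] cfun.scale_right_distrib)
    next
      fix c f assume "f \<in> U"
      then show "fscale c f \<in> U"
        using cfun.subspace_scale[OF subspace_L2]
        by (simp add: U_def operatorD(4)[OF conv_op_operator] mult.commute)
    qed
    moreover have "right_trans G x f \<in> U" if "x \<in> carrier G" "f \<in> U" for x f
      using that comm operatorD(1,4)[OF right_trans_operator] by (simp add: U_def)
    ultimately have U: "right_invariant U" by (auto simp: right_invariant_def U_def)
    have "U \<noteq> {0}" using bU b0 by blast
    have "(\<Sum>x\<in>carrier G. fscale (\<phi> x) (right_trans G x f)) = fscale (\<mu> b) f" if "f \<in> U" for f
      using that conv_op_right_trans[of f \<phi>] by (simp add: U_def)
    then obtain \<sigma> where "\<sigma> \<in> irreducible_reps G"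
      "(\<Sum>x\<in>carrier G. \<phi> x * mat_trace (\<sigma> x)) = of_nat (rep_degree G \<sigma>) * \<mu> b"
      by (rule irreducible_from_eigenspace[OF U \<open>U \<noteq> {0}\<close>])
    then show False using van[of \<sigma>] irreducibleD(1)[of \<sigma>] nz by simp
  qed
  have Tz: "?T f = 0" if f: "f \<in> L2 G" for f
  proof -
    have "?T f = ?T (\<Sum>b\<in>B. fscale (ip b f) b)" using B f by (simp add: onb_def)
    also have "\<dots> = (\<Sum>b\<in>B. fscale (ip b f) (?T b))"
      using B by (intro operator_sum[OF conv_op_operator]) (auto simp: onb_def)
    also have "\<dots> = (\<Sum>b\<in>B. 0)" by (intro sum.cong refl) (simp add: eig zero)
    finally show ?thesis by simp
  qed
  show ?thesis
  proof
    fix x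
    show "\<phi> x = 0 x"
    proof (cases "x \<in> carrier G")
      case True
      then show ?thesis using conv_op_delta[OF True one_closed, of \<phi>] Tz[OF delta_L2[OF True]] by simp
    next
      case False
      then show ?thesis using adm_kernels_L2[OF \<phi>(1)] by (simp add: L2_def)
    qed
  qed
qed

section \<open>Averaging over conjugation\<close>

lemma sum_conj:
  assumes "a \<in> carrier G"
  shows "(\<Sum>x\<in>carrier G. f (a \<otimes> x \<otimes> inv a)) = (\<Sum>x\<in>carrier G. f x)"
  using sum_left_mult[OF assms, of "\<lambda>y. f (y \<otimes> inv a)"] sum_right_mult[of "inv a" f] assms by simp

lemma class_function_conj:
  assumes "F \<in> class_functions" "a \<in> carrier G" "x \<in> carrier G"
  shows "F (a \<otimes> x \<otimes> inv a) = F x"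
proof -
  have "F (a \<otimes> x \<otimes> inv a) = F (inv a \<otimes> (a \<otimes> x))"
    using assms by (simp add: class_functions_def)
  also have "inv a \<otimes> (a \<otimes> x) = x" using assms by (simp add: m_assoc[symmetric])
  finally show ?thesis .
qed

text \<open>Since \<open>F\<close> is unchanged by conjugation, it may be conjugated along with
  \<phi>; the substitution in \<open>x\<close> then removes the conjugation from both. With a
  character as \<open>F\<close> this makes \<open>omega\<close> blind to averaging, with the
  constant 1 it preserves the total mass.\<close>

lemma conj_avg_pairing:
  assumes F: "F \<in> class_functions"
  shows "(\<Sum>x\<in>carrier G. conj_avg G \<phi> x * F x) = (\<Sum>x\<in>carrier G. \<phi> x * F x)"
proof -
  let ?N = "of_nat (card (carrier G)) :: complex"
  have N: "?N \<noteq> 0" unfolding of_nat_eq_0_iff using card_carrier_pos by linarith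
  have "(\<Sum>x\<in>carrier G. conj_avg G \<phi> x * F x) =
      (\<Sum>x\<in>carrier G. \<Sum>a\<in>carrier G. \<phi> (a \<otimes> x \<otimes> inv a) * F (a \<otimes> x \<otimes> inv a)) / ?N"
    unfolding sum_divide_distrib
    by (intro sum.cong refl)
      (simp add: conj_avg_def on_group_def sum_distrib_right sum_divide_distrib class_function_conj[OF F])
  also have "\<dots> = (\<Sum>a\<in>carrier G. \<Sum>x\<in>carrier G. \<phi> (a \<otimes> x \<otimes> inv a) * F (a \<otimes> x \<otimes> inv a)) / ?N"
    by (subst sum.swap) simp
  also have "\<dots> = (\<Sum>a\<in>carrier G. \<Sum>x\<in>carrier G. \<phi> x * F x) / ?N"
    by (intro arg_cong[of _ _ "\<lambda>z. z / ?N"] sum.cong refl sum_conj[of _ "\<lambda>x. \<phi> x * F x"])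
  also have "\<dots> = (\<Sum>x\<in>carrier G. \<phi> x * F x)" using N by simp
  finally show ?thesis .
qed

lemma conj_avg_class_function: "conj_avg G \<phi> \<in> class_functions"
  unfolding class_functions_def
proof (intro CollectI ballI)
  fix x y assume xy: "x \<in> carrier G" "y \<in> carrier G"
  \<comment> \<open>Replacing \<open>a\<close> by \<open>a \<otimes> y\<close> works because
    conjugating \<open>x \<otimes> y\<close> by \<open>y\<close> gives
    \<open>y \<otimes> x\<close>.\<close>
  have "(\<Sum>a\<in>carrier G. \<phi> (a \<otimes> (x \<otimes> y) \<otimes> inv a)) =
      (\<Sum>a\<in>carrier G. \<phi> ((a \<otimes> y) \<otimes> (x \<otimes> y) \<otimes> inv (a \<otimes> y)))"
    by (rule sum_right_mult[OF xy(2), symmetric])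
  also have "\<dots> = (\<Sum>a\<in>carrier G. \<phi> (a \<otimes> (y \<otimes> x) \<otimes> inv a))"
  proof (intro sum.cong refl arg_cong[of _ _ \<phi>])
    fix a assume a: "a \<in> carrier G"
    have "y \<otimes> (inv y \<otimes> inv a) = inv a" using a xy by (simp add: m_assoc[symmetric])
    then show "(a \<otimes> y) \<otimes> (x \<otimes> y) \<otimes> inv (a \<otimes> y) = a \<otimes> (y \<otimes> x) \<otimes> inv a"
      using a xy by (simp add: inv_mult_group m_assoc)
  qed
  finally show "conj_avg G \<phi> (x \<otimes> y) = conj_avg G \<phi> (y \<otimes> x)"
    using xy by (simp add: conj_avg_def on_group_def)
qed

lemma conj_avg_adm_kernel:
  assumes \<phi>: "\<phi> \<in> adm_kernels"
  shows "conj_avg G \<phi> \<in> adm_kernels"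
proof -
  have "conj_avg G \<phi> x \<in> \<real>" if "x \<in> carrier G" for x
    using that \<phi> by (simp add: conj_avg_def on_group_def adm_kernels_def)
  moreover have "conj_avg G \<phi> (inv x) = conj_avg G \<phi> x" if x: "x \<in> carrier G" for x
  proof -
    have "\<phi> (a \<otimes> inv x \<otimes> inv a) = \<phi> (a \<otimes> x \<otimes> inv a)" if a: "a \<in> carrier G" for a
    proof -
      have "a \<otimes> inv x \<otimes> inv a = inv (a \<otimes> x \<otimes> inv a)" using a x by (simp add: inv_mult_group m_assoc)
      then show ?thesis using \<phi> a x by (simp add: adm_kernels_def)
    qed
    then show ?thesis using x by (simp add: conj_avg_def on_group_def)
  qed
  moreover have "(\<Sum>x\<in>carrier G. conj_avg G \<phi> x) = 0"
    using conj_avg_pairing[of "\<lambda>_. 1" \<phi>] \<phi> by (simp add: class_functions_def adm_kernels_def)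
  ultimately show ?thesis by (simp add: adm_kernels_def) (simp add: conj_avg_def)
qed

section \<open>Conjugacy classes joined with their inverses\<close>

lemma conj_class_subset_carrier: "x \<in> carrier G \<Longrightarrow> conj_class G x \<subseteq> carrier G"
  by (auto simp: conj_class_def)

lemma conj_class_self: "x \<in> carrier G \<Longrightarrow> x \<in> conj_class G x"
  by (auto simp: conj_class_def intro!: exI[of _ \<one>])

lemma conj_class_one: "conj_class G \<one> = {\<one>}"
  by (auto simp: conj_class_def intro!: exI[of _ \<one>])

lemma conj_class_eq:
  assumes x: "x \<in> carrier G" and y: "y \<in> conj_class G x"
  shows "conj_class G y = conj_class G x"
proof -
  have sub: "conj_class G y \<subseteq> conj_class G x" if x: "x \<in> carrier G" and y: "y \<in> conj_class G x" for x y
  proof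
    fix z assume "z \<in> conj_class G y"
    then obtain a b where ab: "a \<in> carrier G" "b \<in> carrier G" "y = a \<otimes> x \<otimes> inv a" "z = b \<otimes> y \<otimes> inv b"
      using y by (auto simp: conj_class_def)
    then have "z = (b \<otimes> a) \<otimes> x \<otimes> inv (b \<otimes> a)" using x by (simp add: inv_mult_group m_assoc)
    then show "z \<in> conj_class G x" using ab by (auto simp: conj_class_def)
  qed
  obtain a where a: "a \<in> carrier G" "y = a \<otimes> x \<otimes> inv a" using y by (auto simp: conj_class_def)
  have "inv a \<otimes> y \<otimes> inv (inv a) = (inv a \<otimes> a) \<otimes> x \<otimes> (inv a \<otimes> a)"
    unfolding a(2) using a(1) x by (simp only: m_assoc inv_closed m_closed inv_inv)
  also have "\<dots> = x" using a(1) x by simp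
  finally have "x \<in> conj_class G y" using a(1) by (auto simp: conj_class_def intro!: exI[of _ "inv a"])
  moreover have "y \<in> carrier G" using conj_class_subset_carrier[OF x] y by (rule subsetD)
  ultimately show ?thesis using sub[OF x y] sub[of y x] by blast
qed

lemma inv_image_conj_class:
  assumes x: "x \<in> carrier G"
  shows "m_inv G ` conj_class G x = conj_class G (inv x)"
proof -
  have "inv (a \<otimes> x \<otimes> inv a) = a \<otimes> inv x \<otimes> inv a" if "a \<in> carrier G" for a
    using that x by (simp add: inv_mult_group m_assoc)
  then show ?thesis unfolding conj_class_def by (auto simp: image_iff) metis
qed

text \<open>The sets C \<union> C^-1 indexed by a group element, with the inverse class written as
  the class of \<open>inv x\<close>. The identity gives the excluded set
  \<open>{\<one>}\<close>.\<close>

definition sym_class :: "'a \<Rightarrow> 'a set" where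
  "sym_class x = conj_class G x \<union> conj_class G (inv x)"

lemma sym_class_self: "x \<in> carrier G \<Longrightarrow> x \<in> sym_class x"
  by (simp add: sym_class_def conj_class_self)

lemma sym_class_subset: "x \<in> carrier G \<Longrightarrow> sym_class x \<subseteq> carrier G"
  using conj_class_subset_carrier[of x] conj_class_subset_carrier[of "inv x"]
  by (simp add: sym_class_def)

lemma sym_class_eq:
  assumes x: "x \<in> carrier G" and y: "y \<in> sym_class x"
  shows "sym_class y = sym_class x"
proof -
  have "y \<in> conj_class G x \<or> y \<in> conj_class G (inv x)" using y by (simp add: sym_class_def)
  then show ?thesis
  proof
    assume y: "y \<in> conj_class G x"
    then have "inv y \<in> conj_class G (inv x)" using inv_image_conj_class[OF x] by blast
    then show ?thesis
      using conj_class_eq[OF x y] conj_class_eq[of "inv x" "inv y"] x by (simp add: sym_class_def)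
  next
    assume y: "y \<in> conj_class G (inv x)"
    then have "inv y \<in> conj_class G (inv (inv x))" using inv_image_conj_class[of "inv x"] x by blast
    then show ?thesis
      using conj_class_eq[of "inv x" y] conj_class_eq[of x "inv y"] x y
      by (simp add: sym_class_def Un_commute)
  qed
qed

lemma sym_classes_eq: "sym_classes G = sym_class ` (carrier G - {\<one>})"
proof -
  have "conj_class G x = {\<one>} \<longleftrightarrow> x = \<one>" if "x \<in> carrier G" for x
    using conj_class_self[OF that] conj_class_one by auto
  then have "{x \<in> carrier G. conj_class G x \<noteq> {\<one>}} = carrier G - {\<one>}" by blast
  moreover have "sym_classes G =
    (\<lambda>x. conj_class G x \<union> m_inv G ` conj_class G x) ` {x \<in> carrier G. conj_class G x \<noteq> {\<one>}}"
    unfolding sym_classes_def by blast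
  moreover have "\<dots> = sym_class ` {x \<in> carrier G. conj_class G x \<noteq> {\<one>}}"
    by (intro image_cong refl) (simp add: sym_class_def inv_image_conj_class)
  ultimately show ?thesis by simp
qed

lemma inv_in_sym_class:
  assumes "x \<in> carrier G" "y \<in> sym_class x"
  shows "inv y \<in> sym_class x"
proof -
  have "y \<in> carrier G" using sym_class_subset[OF assms(1)] assms(2) by (rule subsetD)
  then have "inv y \<in> sym_class y" by (simp add: sym_class_def conj_class_self)
  then show ?thesis using sym_class_eq[OF assms] by simp
qed

text \<open>Centrality gives constancy on a conjugacy class, and the symmetry of an admissible
  kernel extends it to the inverse class.\<close>

lemma class_function_sym_class:
  assumes "\<phi> \<in> adm_kernels" "\<phi> \<in> class_functions" "x \<in> carrier G" "y \<in> sym_class x"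
  shows "\<phi> y = \<phi> x"
  using assms class_function_conj[OF assms(2)]
  by (auto simp: sym_class_def conj_class_def adm_kernels_def)

text \<open>The convolution kernel of I - A_K: a unit point mass minus the uniform probability on
  \<open>K\<close>.\<close>

definition laplacian_kernel :: "'a set \<Rightarrow> 'a \<Rightarrow> complex" where
  "laplacian_kernel K = (\<lambda>x. (if x = \<one> then 1 else 0) - (if x \<in> K then 1 / of_nat (card K) else 0))"

lemma class_laplacian_conv_op:
  assumes K: "K \<subseteq> carrier G"
  shows "class_laplacian G K = conv_op G (laplacian_kernel K)"
proof (rule conv_op_eqI)
  show "class_laplacian G K f = 0" if "f \<notin> L2 G" for f
    using that by (simp add: class_laplacian_def avg_op_def on_L2_def)
  show "class_laplacian G K f g = 0" if "f \<in> L2 G" "g \<notin> carrier G" for f g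
    using that by (simp add: class_laplacian_def avg_op_def on_L2_def on_group_def)
  show "class_laplacian G K f g = (\<Sum>s\<in>carrier G. laplacian_kernel K s * f (g \<otimes> s))"
    if "f \<in> L2 G" "g \<in> carrier G" for f g
  proof -
    have "(\<Sum>s\<in>carrier G. laplacian_kernel K s * f (g \<otimes> s)) =
      (\<Sum>s\<in>carrier G. if s = \<one> then f (g \<otimes> \<one>) else 0) -
      (\<Sum>s\<in>carrier G. if s \<in> K then f (g \<otimes> s) / of_nat (card K) else 0)"
      unfolding sum_subtractf[symmetric]
      by (intro sum.cong) (auto simp: laplacian_kernel_def algebra_simps)
    also have "(\<Sum>s\<in>carrier G. if s \<in> K then f (g \<otimes> s) / of_nat (card K) else 0) =
      (\<Sum>s\<in>K. f (g \<otimes> s) / of_nat (card K))"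
      using K by (simp add: sum.If_cases Int_absorb1)
    finally show ?thesis
      using that by (simp add: class_laplacian_def avg_op_def on_L2_def on_group_def sum_divide_distrib)
  qed
qed

text \<open>Symmetry comes from the closure of the set under inversion, centrality from its closure
  under conjugation, and total mass 0 from subtracting one probability weight from another.\<close>

lemma laplacian_kernel_adm:
  assumes x: "x \<in> carrier G" "x \<noteq> \<one>"
  shows "laplacian_kernel (sym_class x) \<in> adm_kernels" "laplacian_kernel (sym_class x) \<in> class_functions"
proof -
  let ?K = "sym_class x"
  have K: "?K \<subseteq> carrier G" by (rule sym_class_subset[OF x(1)])
  have fin: "finite ?K" using K by (rule finite_subset) simp
  have card: "of_nat (card ?K) \<noteq> (0 :: complex)"
    using sym_class_self[OF x(1)] fin by auto
  have inv_iff: "inv y \<in> ?K \<longleftrightarrow> y \<in> ?K" if "y \<in> carrier G" for y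
    using inv_in_sym_class[OF x(1), of y] inv_in_sym_class[OF x(1), of "inv y"] that by auto
  have "(\<Sum>s\<in>carrier G. laplacian_kernel ?K s) = 1 - (\<Sum>s\<in>?K. 1 / of_nat (card ?K))"
    using K by (simp add: laplacian_kernel_def sum_subtractf sum.If_cases Int_absorb1)
  also have "\<dots> = 0" using card by simp
  finally show "laplacian_kernel ?K \<in> adm_kernels"
    using K by (auto simp: adm_kernels_def L2_def laplacian_kernel_def inv_iff)
  have "laplacian_kernel ?K (a \<otimes> b) = laplacian_kernel ?K (b \<otimes> a)"
    if ab: "a \<in> carrier G" "b \<in> carrier G" for a b
  proof -
    have mem: "b \<otimes> a \<in> ?K" if "a \<otimes> b \<in> ?K" "a \<in> carrier G" "b \<in> carrier G" for a b
    proof -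
      have "b \<otimes> a = b \<otimes> (a \<otimes> b) \<otimes> inv b" using that by (simp add: m_assoc)
      then have "b \<otimes> a \<in> conj_class G (a \<otimes> b)" using that by (auto simp: conj_class_def)
      then show ?thesis using sym_class_eq[OF x(1) that(1)] by (auto simp: sym_class_def)
    qed
    have "a \<otimes> b \<in> ?K \<longleftrightarrow> b \<otimes> a \<in> ?K" using mem ab by blast
    moreover have "a \<otimes> b = \<one> \<longleftrightarrow> b \<otimes> a = \<one>" using inv_comm ab by blast
    ultimately show ?thesis by (simp add: laplacian_kernel_def)
  qed
  then show "laplacian_kernel ?K \<in> class_functions" by (simp add: class_functions_def)
qed

text \<open>A central admissible kernel is constant on each symmetric class, and these classes
  partition the group without the identity. Its values there fix the coefficients of the Laplacian
  kernels; the value at the identity follows from total mass 0.\<close>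

lemma laplacian_span_eq: "laplacian_span G = conv_op G ` (adm_kernels \<inter> class_functions)"
proof (rule antisym)
  have sub: "rfun.subspace (adm_kernels \<inter> class_functions)"
    by (rule rfun.subspace_inter[OF subspace_adm_kernels subspace_class_functions])
  show "laplacian_span G \<subseteq> conv_op G ` (adm_kernels \<inter> class_functions)"
    unfolding laplacian_span_def
  proof (rule rop.span_minimal[OF _ subspace_conv_op_image[OF sub]])
    show "class_laplacian G ` sym_classes G \<subseteq> conv_op G ` (adm_kernels \<inter> class_functions)"
      unfolding sym_classes_eq
      using laplacian_kernel_adm by (auto simp: class_laplacian_conv_op[OF sym_class_subset])
  qed
  show "conv_op G ` (adm_kernels \<inter> class_functions) \<subseteq> laplacian_span G"
  proof (rule image_subsetI)
    fix \<phi> assume "\<phi> \<in> adm_kernels \<inter> class_functions"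
    then have \<phi>: "\<phi> \<in> adm_kernels" "\<phi> \<in> class_functions" by auto
    \<comment> \<open>A Laplacian kernel equals \<open>- 1 / card K\<close> on \<open>K\<close> and
      vanishes at every other element except the identity, so this coefficient reproduces the common
      value of \<phi> on \<open>K\<close>; any representative of \<open>K\<close> gives the same
      value.\<close>
    define r where "r K = - real (card K) * Re (\<phi> (SOME y. y \<in> K))" for K
    define \<psi> where "\<psi> = (\<Sum>K\<in>sym_classes G. rscale (r K) (laplacian_kernel K))"
    have fin: "finite (sym_classes G)" by (simp add: sym_classes_eq)
    have \<psi>: "\<psi> \<in> adm_kernels" unfolding \<psi>_def sym_classes_eq
      by (intro rfun.subspace_sum rfun.subspace_scale subspace_adm_kernels)
        (auto intro: laplacian_kernel_adm)
    have off: "\<psi> x = \<phi> x" if x: "x \<in> carrier G" "x \<noteq> \<one>" for x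
    proof -
      have "of_real (r K) * laplacian_kernel K x = (if K = sym_class x then \<phi> x else 0)"
        if K: "K \<in> sym_classes G" for K
      proof -
        obtain y where y: "y \<in> carrier G" "K = sym_class y" using K by (auto simp: sym_classes_eq)
        have mem: "x \<in> K \<longleftrightarrow> K = sym_class x"
          using sym_class_eq[OF y(1), of x] sym_class_self[OF x(1)] y(2) by auto
        show ?thesis
        proof (cases "K = sym_class x")
          case True
          have "finite K" unfolding y(2) by (rule finite_subset[OF sym_class_subset[OF y(1)]]) simp
          then have card: "card K \<noteq> 0" using True mem by auto
          have "(SOME y. y \<in> K) \<in> K" using True mem by (metis someI_ex)
          then have "\<phi> (SOME y. y \<in> K) = \<phi> x"
            using class_function_sym_class[OF \<phi> x(1)] True by simp
          moreover have "of_real (Re (\<phi> x)) = \<phi> x" using \<phi>(1) x by (simp add: adm_kernels_def)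
          ultimately show ?thesis using True card x mem by (simp add: r_def laplacian_kernel_def)
        qed (use mem x in \<open>simp add: laplacian_kernel_def\<close>)
      qed
      then have "\<psi> x = (\<Sum>K\<in>sym_classes G. if K = sym_class x then \<phi> x else 0)"
        by (simp add: \<psi>_def sum_apply rscale_def)
      moreover have "sym_class x \<in> sym_classes G" using x by (simp add: sym_classes_eq)
      ultimately show ?thesis using fin by simp
    qed
    \<comment> \<open>Both kernels have total mass 0 and agree off the identity, hence also at
      it.\<close>
    have "\<phi> \<one> = \<psi> \<one>"
    proof -
      have s: "(\<Sum>x\<in>carrier G. \<eta> x) = \<eta> \<one> + (\<Sum>x\<in>carrier G - {\<one>}. \<eta> x)" for \<eta> :: "'a \<Rightarrow> complex"
        by (rule sum.remove) auto
      have "(\<Sum>x\<in>carrier G - {\<one>}. \<psi> x) = (\<Sum>x\<in>carrier G - {\<one>}. \<phi> x)"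
        using off by (intro sum.cong) auto
      then show ?thesis using \<phi>(1) \<psi> s[of \<phi>] s[of \<psi>] by (simp add: adm_kernels_def add_eq_0_iff)
    qed
    then have "\<phi> = \<psi>"
      using off adm_kernels_L2[OF \<phi>(1)] adm_kernels_L2[OF \<psi>] by (auto simp: L2_def fun_eq_iff) metis
    moreover have "conv_op G \<psi> \<in> laplacian_span G"
    proof -
      have S: "rop.subspace (laplacian_span G)" by (simp add: laplacian_span_def)
      have "conv_op G (rscale 0 0) = opscale 0 (conv_op G 0)" by (rule conv_op_rscale)
      then have "conv_op G 0 = 0" by simp
      \<comment> \<open>Linearity of \<open>conv_op\<close> in the kernel: the kernels landing in
        the span form a real subspace, so only the summands of \<psi> remain to be placed.\<close>
      then have "rfun.subspace {\<eta>. conv_op G \<eta> \<in> laplacian_span G}"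
        using rop.subspace_0[OF S] rop.subspace_add[OF S] rop.subspace_scale[OF S]
        by (auto simp: rfun.subspace_def conv_op_add conv_op_rscale)
      then have "\<psi> \<in> {\<eta>. conv_op G \<eta> \<in> laplacian_span G}"
        unfolding \<psi>_def
      proof (intro rfun.subspace_sum rfun.subspace_scale)
        fix K assume K: "K \<in> sym_classes G"
        then have "K \<subseteq> carrier G" using sym_class_subset by (auto simp: sym_classes_eq)
        then show "laplacian_kernel K \<in> {\<eta>. conv_op G \<eta> \<in> laplacian_span G}"
          using K by (auto simp: class_laplacian_conv_op[symmetric] laplacian_span_def intro: rop.span_base)
      qed
      then show ?thesis by simp
    qed
    ultimately show "conv_op G \<phi> \<in> laplacian_span G" by simp
  qed
qed

section \<open>Characters and the dual\<close>

lemma trivial_rep_irreducible: "trivial_rep \<in> irreducible_reps G"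
proof (rule irreducibleI[of 1])
  show "matrix_rep G 1 trivial_rep" by (simp add: matrix_rep_def trivial_rep_def)
next
  fix W :: "complex vec set"
  assume W: "W \<subseteq> carrier_vec 1" "0\<^sub>v 1 \<in> W" "\<And>c v. v \<in> W \<Longrightarrow> c \<cdot>\<^sub>v v \<in> W"
  show "W = {0\<^sub>v 1} \<or> W = carrier_vec 1"
  proof (cases "\<exists>v\<in>W. v $ 0 \<noteq> 0")
    case True
    then obtain v where v: "v \<in> W" "v $ 0 \<noteq> 0" by blast
    have dv: "dim_vec v = 1" using subsetD[OF W(1) v(1)] by simp
    have "w \<in> W" if w: "w \<in> carrier_vec 1" for w
    proof -
      have "w = (w $ 0 / v $ 0) \<cdot>\<^sub>v v" using w v(2) dv by (intro eq_vecI) auto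
      moreover have "(w $ 0 / v $ 0) \<cdot>\<^sub>v v \<in> W" by (rule W(3)[OF v(1)])
      ultimately show ?thesis by (rule ssubst)
    qed
    then show ?thesis using W(1) by blast
  next
    case False
    have "v = 0\<^sub>v 1" if v: "v \<in> W" for v
    proof -
      have "dim_vec v = 1" using subsetD[OF W(1) v] by simp
      then show ?thesis using False v by (intro eq_vecI) auto
    qed
    then show ?thesis using W(2) by blast
  qed
qed simp

text \<open>Entrywise conjugation of vectors is a conjugate-linear bijection. It carries invariant
  subspaces of the conjugate representation to invariant subspaces of \<sigma>, where irreducibility
  applies.\<close>

lemma conj_rep_irreducible:
  assumes \<sigma>: "\<sigma> \<in> irreducible_reps G"
  shows "conj_rep \<sigma> \<in> irreducible_reps G" "rep_degree G (conj_rep \<sigma>) = rep_degree G \<sigma>"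
proof -
  let ?d = "rep_degree G \<sigma>"
  note S = irreducibleD[OF \<sigma>]
  show "rep_degree G (conj_rep \<sigma>) = ?d" by (simp add: rep_degree_def conj_rep_def)
  have rep: "matrix_rep G ?d (conj_rep \<sigma>)"
    unfolding matrix_rep_def
  proof (intro conjI ballI)
    show "conj_rep \<sigma> g \<in> carrier_mat ?d ?d" if "g \<in> carrier G" for g
      using S(2)[OF that] by (simp add: conj_rep_def)
    show "conj_rep \<sigma> \<one> = 1\<^sub>m ?d"
      by (intro eq_matI) (auto simp: conj_rep_def S(3))
    fix g h assume gh: "g \<in> carrier G" "h \<in> carrier G"
    note sg = S(2)[OF gh(1)] and sh = S(2)[OF gh(2)]
    show "conj_rep \<sigma> (g \<otimes> h) = conj_rep \<sigma> g * conj_rep \<sigma> h"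
      unfolding conj_rep_def S(4)[OF gh]
    proof (rule eq_matI)
      fix i j assume "i < dim_row (map_mat cnj (\<sigma> g) * map_mat cnj (\<sigma> h))"
        "j < dim_col (map_mat cnj (\<sigma> g) * map_mat cnj (\<sigma> h))"
      then have ij: "i < ?d" "j < ?d" using sg sh by auto
      have mg: "map_mat cnj (\<sigma> g) \<in> carrier_mat ?d ?d" and mh: "map_mat cnj (\<sigma> h) \<in> carrier_mat ?d ?d"
        using sg sh by auto
      have "map_mat cnj (\<sigma> g * \<sigma> h) $$ (i, j) = cnj ((\<sigma> g * \<sigma> h) $$ (i, j))"
        using ij sg sh by simp
      also have "\<dots> = (\<Sum>l<?d. map_mat cnj (\<sigma> g) $$ (i, l) * map_mat cnj (\<sigma> h) $$ (l, j))"
        unfolding mat_mult_index[OF sg sh ij] using ij sg sh by (auto intro!: sum.cong)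
      also have "\<dots> = (map_mat cnj (\<sigma> g) * map_mat cnj (\<sigma> h)) $$ (i, j)"
        by (rule mat_mult_index[OF mg mh ij, symmetric])
      finally show "map_mat cnj (\<sigma> g * \<sigma> h) $$ (i, j) = (map_mat cnj (\<sigma> g) * map_mat cnj (\<sigma> h)) $$ (i, j)" .
    qed (use sg sh in auto)
  qed
  show "conj_rep \<sigma> \<in> irreducible_reps G"
  proof (rule irreducibleI[OF rep S(1)])
    fix W assume W: "W \<subseteq> carrier_vec ?d" "0\<^sub>v ?d \<in> W" "\<And>v w. v \<in> W \<Longrightarrow> w \<in> W \<Longrightarrow> v + w \<in> W"
      "\<And>c v. v \<in> W \<Longrightarrow> c \<cdot>\<^sub>v v \<in> W" "\<And>g w. g \<in> carrier G \<Longrightarrow> w \<in> W \<Longrightarrow> conj_rep \<sigma> g *\<^sub>v w \<in> W"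
    define X where "X = {v \<in> carrier_vec ?d. map_vec cnj v \<in> W}"
    have cc: "map_vec cnj (map_vec cnj v) = v" for v :: "complex vec"
      by (intro eq_vecI) auto
    have "X = {0\<^sub>v ?d} \<or> X = carrier_vec ?d"
    proof (rule S(5))
      show "X \<subseteq> carrier_vec ?d" by (auto simp: X_def)
      have "map_vec cnj (0\<^sub>v ?d) = (0\<^sub>v ?d)" by (intro eq_vecI) auto
      then show "0\<^sub>v ?d \<in> X" using W(2) by (simp add: X_def)
      fix v w assume v: "v \<in> X" and w: "w \<in> X"
      have "map_vec cnj (v + w) = map_vec cnj v + map_vec cnj w"
        using v w by (intro eq_vecI) (auto simp: X_def)
      then show "v + w \<in> X" using v w W(3) by (simp add: X_def)
    next
      fix c v assume v: "v \<in> X"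
      have "map_vec cnj (c \<cdot>\<^sub>v v) = cnj c \<cdot>\<^sub>v map_vec cnj v" by (intro eq_vecI) auto
      then show "c \<cdot>\<^sub>v v \<in> X" using v W(4) by (simp add: X_def)
    next
      fix g v assume g: "g \<in> carrier G" and v: "v \<in> X"
      note sg = S(2)[OF g]
      have vc: "v \<in> carrier_vec ?d" and vW: "map_vec cnj v \<in> W" using v by (auto simp: X_def)
      have "map_vec cnj (\<sigma> g *\<^sub>v v) = conj_rep \<sigma> g *\<^sub>v map_vec cnj v"
        using sg vc by (intro eq_vecI) (auto simp: conj_rep_def scalar_prod_def)
      then have "map_vec cnj (\<sigma> g *\<^sub>v v) \<in> W" using W(5)[OF g vW] by simp
      moreover have "\<sigma> g *\<^sub>v v \<in> carrier_vec ?d" using sg vc by simp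
      ultimately show "\<sigma> g *\<^sub>v v \<in> X" by (simp add: X_def)
    qed
    then show "W = {0\<^sub>v ?d} \<or> W = carrier_vec ?d"
    proof
      assume X: "X = {0\<^sub>v ?d}"
      have "v = 0\<^sub>v ?d" if v: "v \<in> W" for v
      proof -
        have "map_vec cnj v \<in> X" using v subsetD[OF W(1) v] by (simp add: X_def cc)
        then have "map_vec cnj v = 0\<^sub>v ?d" unfolding X by simp
        then have "map_vec cnj (map_vec cnj v) = map_vec cnj (0\<^sub>v ?d)" by (rule arg_cong)
        also have "\<dots> = 0\<^sub>v ?d" by (intro eq_vecI) auto
        finally show ?thesis unfolding cc .
      qed
      then show ?thesis using W(2) by blast
    next
      assume X: "X = carrier_vec ?d"
      have "v \<in> W" if v: "v \<in> carrier_vec ?d" for v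
      proof -
        have "map_vec cnj v \<in> X" unfolding X using v by simp
        then show ?thesis by (simp add: X_def cc)
      qed
      then show ?thesis using W(1) by blast
    qed
  qed
qed

lemma conj_rep_trace:
  assumes "\<sigma> \<in> irreducible_reps G" "x \<in> carrier G"
  shows "mat_trace (conj_rep \<sigma> x) = cnj (mat_trace (\<sigma> x))"
  using irreducibleD(2)[OF assms] by (simp add: mat_trace_def conj_rep_def)

text \<open>The premise \<open>eq\<close> holds for chosen class representatives: among them
  equivalence is equality. For equal representations exactly the d terms with \<open>a = b\<close>
  survive, each contributing the group order divided by d.\<close>

lemma character_orthogonality:
  assumes \<sigma>: "\<sigma> \<in> irreducible_reps G" and \<tau>: "\<tau> \<in> irreducible_reps G"
    and eq: "(\<sigma>, \<tau>) \<in> rep_equiv G \<Longrightarrow> \<sigma> = \<tau>"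
  shows "(\<Sum>x\<in>carrier G. mat_trace (\<tau> x) * mat_trace (\<sigma> (inv x))) =
    (if \<sigma> = \<tau> then of_nat (card (carrier G)) else 0)"
proof -
  let ?d = "rep_degree G \<sigma>" and ?e = "rep_degree G \<tau>"
  have "(\<Sum>x\<in>carrier G. mat_trace (\<tau> x) * mat_trace (\<sigma> (inv x))) =
      (\<Sum>x\<in>carrier G. \<Sum>a<?e. \<Sum>b<?d. \<tau> x $$ (a, a) * \<sigma> (inv x) $$ (b, b))"
    using carrier_matD(1)[OF irreducibleD(2)[OF \<sigma> inv_closed]] carrier_matD(1)[OF irreducibleD(2)[OF \<tau>]]
    by (intro sum.cong refl) (simp add: mat_trace_def sum_product)
  also have "\<dots> = (\<Sum>a<?e. \<Sum>b<?d. \<Sum>x\<in>carrier G. \<tau> x $$ (a, a) * \<sigma> (inv x) $$ (b, b))"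
    by (subst sum.swap, intro sum.cong refl sum.swap)
  also have "\<dots> = (if \<sigma> = \<tau> then of_nat (card (carrier G)) else 0)"
  proof (cases "\<sigma> = \<tau>")
    case True
    have "(\<Sum>a<?d. \<Sum>b<?d. \<Sum>x\<in>carrier G. \<sigma> x $$ (a, a) * \<sigma> (inv x) $$ (b, b)) =
        (\<Sum>a<?d. \<Sum>b<?d. if b = a then of_nat (card (carrier G)) / of_nat ?d else 0)"
      by (intro sum.cong refl, subst rep_coeff_orthogonal[OF \<sigma>]) auto
    also have "\<dots> = of_nat (card (carrier G))" using irreducibleD(1)[OF \<sigma>] by simp
    finally show ?thesis using True by simp
  next
    case False
    then have "(\<sigma>, \<tau>) \<notin> rep_equiv G" using eq by blast
    then show ?thesis using False by (simp add: rep_coeff_orthogonal_inequivalent[OF \<sigma> \<tau>])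
  qed
  finally show ?thesis .
qed

end

section \<open>Chosen unitary representatives, their characters and the map
  \<open>omega\<close>\<close>

locale finite_group_dual = finite_group +
  fixes rep :: "('a \<Rightarrow> complex mat) set \<Rightarrow> 'a \<Rightarrow> complex mat"
  assumes choice: "unitary_choice G rep"
begin

abbreviation character where "character c x \<equiv> mat_trace (rep c x)"

abbreviation degree where "degree c \<equiv> rep_degree G (rep c)"

lemma dual_rep:
  assumes "c \<in> dual G"
  shows "rep c \<in> irreducible_reps G" "unitary_rep G (rep c)" "rep_class G (rep c) = c"
proof -
  have c: "rep c \<in> c" "unitary_rep G (rep c)" using choice assms by (auto simp: unitary_choice_def)
  obtain \<sigma> where \<sigma>: "\<sigma> \<in> irreducible_reps G" "c = rep_equiv G `` {\<sigma>}"
    using assms unfolding dual_def by (rule quotientE)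
  have st: "(\<sigma>, rep c) \<in> rep_equiv G" using c(1) \<sigma>(2) by simp
  then show "rep c \<in> irreducible_reps G" by (simp add: rep_equiv_def)
  show "unitary_rep G (rep c)" by fact
  show "rep_class G (rep c) = c"
    unfolding rep_class_def using equiv_class_eq[OF equiv_rep_equiv st] \<sigma>(2) by simp
qed

lemma rep_class_dual:
  assumes \<sigma>: "\<sigma> \<in> irreducible_reps G"
  shows "rep_class G \<sigma> \<in> dual G" "(\<sigma>, rep (rep_class G \<sigma>)) \<in> rep_equiv G"
proof -
  show d: "rep_class G \<sigma> \<in> dual G"
    unfolding rep_class_def dual_def by (rule quotientI[OF \<sigma>])
  then have "rep (rep_class G \<sigma>) \<in> rep_class G \<sigma>" using choice by (simp add: unitary_choice_def)
  then show "(\<sigma>, rep (rep_class G \<sigma>)) \<in> rep_equiv G" by (simp add: rep_class_def)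
qed

lemma dual_orthogonality:
  assumes "c \<in> dual G" "c' \<in> dual G"
  shows "(\<Sum>x\<in>carrier G. cnj (character c x) * character c' x) =
    (if c = c' then of_nat (card (carrier G)) else 0)"
proof -
  have eq: "c = c'" if "(rep c, rep c') \<in> rep_equiv G"
    using equiv_class_eq[OF equiv_rep_equiv that] dual_rep(3)[OF assms(1)] dual_rep(3)[OF assms(2)]
    by (simp add: rep_class_def)
  have "(rep c = rep c') \<longleftrightarrow> c = c'" using dual_rep(3)[OF assms(1)] dual_rep(3)[OF assms(2)] by metis
  moreover have "(\<Sum>x\<in>carrier G. cnj (character c x) * character c' x) =
      (\<Sum>x\<in>carrier G. character c' x * mat_trace (rep c (inv x)))"
    by (intro sum.cong refl) (simp add: trace_inv[OF dual_rep(1,2)[OF assms(1)]])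
  ultimately show ?thesis
    using character_orthogonality[OF dual_rep(1)[OF assms(1)] dual_rep(1)[OF assms(2)]] eq by simp
qed

text \<open>The characters of distinct classes are orthonormal in a finite-dimensional space.
  Fourier inversion sums over the dual, and over an infinite set that sum would be 0 by
  convention.\<close>

lemma finite_dual: "finite (dual G)"
proof -
  define f where "f c = on_group G (character c)" for c
  have ip: "ip (f c) (f c') = (if c = c' then 1 else 0)" if "c \<in> dual G" "c' \<in> dual G" for c c'
  proof -
    have "(\<Sum>x\<in>carrier G. cnj (f c x) * f c' x) = (\<Sum>x\<in>carrier G. cnj (character c x) * character c' x)"
      by (intro sum.cong) (auto simp: f_def on_group_def)
    then show ?thesis using dual_orthogonality[OF that] card_carrier_pos by (auto simp: L2_inner_def)
  qed
  have inj: "inj_on f (dual G)"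
  proof (rule inj_onI, rule ccontr)
    fix c c' assume "c \<in> dual G" "c' \<in> dual G" "f c = f c'" "c \<noteq> c'"
    then show False using ip[of c c'] ip[of c' c'] by simp
  qed
  have "orthonormal (f ` dual G)"
    using ip inj by (auto simp: orthonormal_def inj_on_def)
  then have "finite (f ` dual G)" by (rule orthonormal_bound(1)) (auto simp: f_def)
  then show ?thesis using inj by (rule finite_imageD)
qed

lemma omega_conv_op:
  assumes "\<phi> \<in> adm_kernels"
  shows "omega G rep (conv_op G \<phi>) =
    (\<lambda>c. if c \<in> dual G then (\<Sum>x\<in>carrier G. \<phi> x * character c x) / of_nat (degree c) else 0)"
  using mean_eigenvalue_coeff_space[OF assms dual_rep(1,2)] by (auto simp: omega_def fun_eq_iff)

lemma omega_add:
  assumes "\<phi> \<in> adm_kernels" "\<psi> \<in> adm_kernels"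
  shows "omega G rep (conv_op G \<phi> + conv_op G \<psi>) = omega G rep (conv_op G \<phi>) + omega G rep (conv_op G \<psi>)"
  using rfun.subspace_add[OF subspace_adm_kernels assms] assms
  by (simp add: conv_op_add[symmetric] omega_conv_op fun_eq_iff distrib_right sum.distrib add_divide_distrib)

lemma omega_diff:
  assumes "\<phi> \<in> adm_kernels" "\<psi> \<in> adm_kernels"
  shows "omega G rep (conv_op G \<phi> - conv_op G \<psi>) = omega G rep (conv_op G \<phi>) - omega G rep (conv_op G \<psi>)"
  using rfun.subspace_diff[OF subspace_adm_kernels assms] assms
  by (simp add: conv_op_diff[symmetric] omega_conv_op fun_eq_iff left_diff_distrib sum_subtractf diff_divide_distrib)

lemma omega_opscale:
  assumes "\<phi> \<in> adm_kernels"
  shows "omega G rep (opscale r (conv_op G \<phi>)) = rscale r (omega G rep (conv_op G \<phi>))"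
  using rfun.subspace_scale[OF subspace_adm_kernels assms, of r] assms
  by (simp add: conv_op_rscale[symmetric] omega_conv_op fun_eq_iff rscale_def sum_distrib_left mult.assoc)

text \<open>\<open>omega\<close> sees only the chosen representatives, while
  \<open>class_function_complete\<close> ranges over all irreducible matrix representations;
  equality of characters within a class bridges the gap.\<close>

lemma omega_class_function_inj:
  assumes \<phi>: "\<phi> \<in> adm_kernels" "\<phi> \<in> class_functions" and z: "omega G rep (conv_op G \<phi>) = 0"
  shows "\<phi> = 0"
proof (rule class_function_complete[OF \<phi>])
  fix \<sigma> assume \<sigma>: "\<sigma> \<in> irreducible_reps G"
  let ?c = "rep_class G \<sigma>"
  have "omega G rep (conv_op G \<phi>) ?c = 0" using z by simp
  then have "(\<Sum>x\<in>carrier G. \<phi> x * character ?c x) = 0"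
    using rep_class_dual(1)[OF \<sigma>] irreducibleD(1)[OF dual_rep(1)[OF rep_class_dual(1)[OF \<sigma>]]]
    by (simp add: omega_conv_op[OF \<phi>(1)])
  moreover have "(\<Sum>x\<in>carrier G. \<phi> x * mat_trace (\<sigma> x)) = (\<Sum>x\<in>carrier G. \<phi> x * character ?c x)"
    using rep_equiv_trace[OF rep_class_dual(2)[OF \<sigma>]] by (intro sum.cong) auto
  ultimately show "(\<Sum>x\<in>carrier G. \<phi> x * mat_trace (\<sigma> x)) = 0" by simp
qed

lemma omega_conj_avg:
  assumes "\<phi> \<in> adm_kernels"
  shows "omega G rep (conv_op G (conj_avg G \<phi>)) = omega G rep (conv_op G \<phi>)"
  using conj_avg_pairing[OF trace_class_function[OF dual_rep(1)]]
  by (auto simp: omega_conv_op assms conj_avg_adm_kernel fun_eq_iff)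

text \<open>The conjugate of a chosen representative need not be the one chosen for its own class.
  Characters and degrees are class invariants and do not notice the difference.\<close>

lemma conj_class_dual:
  assumes c: "c \<in> dual G"
  shows "rep_class G (conj_rep (rep c)) \<in> dual G"
    "x \<in> carrier G \<Longrightarrow> character (rep_class G (conj_rep (rep c))) x = cnj (character c x)"
    "degree (rep_class G (conj_rep (rep c))) = degree c"
proof -
  note i = conj_rep_irreducible[OF dual_rep(1)[OF c]]
  show "rep_class G (conj_rep (rep c)) \<in> dual G" by (rule rep_class_dual(1)[OF i(1)])
  show "character (rep_class G (conj_rep (rep c))) x = cnj (character c x)" if "x \<in> carrier G"
    using rep_equiv_trace[OF rep_class_dual(2)[OF i(1)] that]
    by (simp add: conj_rep_trace[OF dual_rep(1)[OF c] that])
  show "degree (rep_class G (conj_rep (rep c))) = degree c"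
    using rep_equiv_degree[OF rep_class_dual(2)[OF i(1)]] i(2) by simp
qed

lemma character_trivial:
  assumes "x \<in> carrier G"
  shows "character (rep_class G trivial_rep) x = 1"
  using rep_equiv_trace[OF rep_class_dual(2)[OF trivial_rep_irreducible] assms]
  by (simp add: trivial_rep_def mat_trace_def)

text \<open>Conjugating a pairing with a character amounts to substituting \<open>inv x\<close>, by
  unitarity and because \<phi> is real; symmetry of \<phi> makes the pairing real. As \<phi> is
  real, the pairing for the conjugate representation is the conjugate of this real number.\<close>

lemma omega_symmetric:
  assumes \<phi>: "\<phi> \<in> adm_kernels"
  shows "omega G rep (conv_op G \<phi>) \<in> symmetric_dual_functions G"
proof -
  let ?F = "omega G rep (conv_op G \<phi>)"
  have real: "cnj (\<phi> x) = \<phi> x" and sym: "\<phi> (inv x) = \<phi> x" if "x \<in> carrier G" for x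
    using \<phi> that by (auto simp: adm_kernels_def Reals_cnj_iff)
  have cnj_pairing: "cnj (\<Sum>x\<in>carrier G. \<phi> x * character c x) = (\<Sum>x\<in>carrier G. \<phi> x * character c x)"
    if c: "c \<in> dual G" for c
  proof -
    have "cnj (\<Sum>x\<in>carrier G. \<phi> x * character c x) = (\<Sum>x\<in>carrier G. \<phi> (inv x) * character c (inv x))"
      by (auto simp: real sym trace_inv[OF dual_rep(1,2)[OF c]] intro!: sum.cong)
    also have "\<dots> = (\<Sum>x\<in>carrier G. \<phi> x * character c x)"
      by (rule sum_inv[of "\<lambda>x. \<phi> x * character c x"])
    finally show ?thesis .
  qed
  have "?F c \<in> \<real>" if "c \<in> dual G" for c
    using cnj_pairing[OF that] by (auto simp: omega_conv_op[OF \<phi>] Reals_cnj_iff)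
  moreover have "?F (rep_class G trivial_rep) = 0"
    using \<phi> by (simp add: omega_conv_op[OF \<phi>] character_trivial adm_kernels_def)
  moreover have "?F (rep_class G (conj_rep \<sigma>)) = ?F (rep_class G \<sigma>)" if \<sigma>: "\<sigma> \<in> irreducible_reps G" for \<sigma>
  proof -
    note i = conj_rep_irreducible[OF \<sigma>]
    let ?c = "rep_class G \<sigma>" and ?c' = "rep_class G (conj_rep \<sigma>)"
    have ch: "character ?c' x = cnj (character ?c x)" if "x \<in> carrier G" for x
      using rep_equiv_trace[OF rep_class_dual(2)[OF i(1)] that] rep_equiv_trace[OF rep_class_dual(2)[OF \<sigma>] that]
      by (simp add: conj_rep_trace[OF \<sigma> that])
    have dg: "degree ?c' = degree ?c"
      using rep_equiv_degree[OF rep_class_dual(2)[OF i(1)]] rep_equiv_degree[OF rep_class_dual(2)[OF \<sigma>]] i(2)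
      by simp
    have "(\<Sum>x\<in>carrier G. \<phi> x * character ?c' x) = cnj (\<Sum>x\<in>carrier G. \<phi> x * character ?c x)"
      by (auto simp: ch real intro!: sum.cong)
    also have "\<dots> = (\<Sum>x\<in>carrier G. \<phi> x * character ?c x)"
      by (rule cnj_pairing[OF rep_class_dual(1)[OF \<sigma>]])
    finally show ?thesis
      using rep_class_dual(1)[OF i(1)] rep_class_dual(1)[OF \<sigma>]
      by (simp add: omega_conv_op[OF \<phi>] dg)
  qed
  ultimately show ?thesis
    unfolding symmetric_dual_functions_def by (auto simp: omega_def)
qed

text \<open>
  Fourier inversion yields the kernel of a preimage; passing to its real part is harmless because
  \<open>F\<close> agrees on conjugate pairs.
\<close>

lemma omega_surjective:
  assumes F: "F \<in> symmetric_dual_functions G"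
  obtains \<phi> where "\<phi> \<in> adm_kernels" "\<phi> \<in> class_functions" "omega G rep (conv_op G \<phi>) = F"
proof -
  let ?N = "of_nat (card (carrier G)) :: complex"
  have N: "?N \<noteq> 0" unfolding of_nat_eq_0_iff using card_carrier_pos by linarith
  have F0: "F c = 0" if "c \<notin> dual G" for c using F that by (simp add: symmetric_dual_functions_def)
  have Freal: "cnj (F c) = F c" if "c \<in> dual G" for c
    using F that by (simp add: symmetric_dual_functions_def Reals_cnj_iff)
  have Fconj: "F (rep_class G (conj_rep (rep c))) = F c" if "c \<in> dual G" for c
    using F dual_rep[OF that] by (simp add: symmetric_dual_functions_def)
  have Ftriv: "F (rep_class G trivial_rep) = 0" using F by (simp add: symmetric_dual_functions_def)
  \<comment> \<open>The weight \<open>degree c\<close> offsets the division by the degree in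
    \<open>omega\<close>, and the factor \<open>1 / ?N\<close> the norm in character
    orthogonality.\<close>
  define \<eta> where "\<eta> x = (\<Sum>c\<in>dual G. F c * of_nat (degree c) * cnj (character c x)) / ?N" for x
  define \<phi> where "\<phi> = on_group G (\<lambda>x. of_real (Re (\<eta> x)))"
  have \<eta>_pair: "(\<Sum>x\<in>carrier G. \<eta> x * character c x) = F c * of_nat (degree c)" if c: "c \<in> dual G" for c
  proof -
    have "(\<Sum>x\<in>carrier G. \<eta> x * character c x) =
        (\<Sum>x\<in>carrier G. \<Sum>c'\<in>dual G. F c' * of_nat (degree c') / ?N * (cnj (character c' x) * character c x))"
      by (intro sum.cong refl) (simp add: \<eta>_def sum_divide_distrib sum_distrib_right mult.assoc)
    also have "\<dots> = (\<Sum>c'\<in>dual G. F c' * of_nat (degree c') / ?N *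
        (\<Sum>x\<in>carrier G. cnj (character c' x) * character c x))"
      by (subst sum.swap) (simp add: sum_distrib_left)
    also have "\<dots> = (\<Sum>c'\<in>dual G. if c' = c then F c * of_nat (degree c) else 0)"
      using N by (intro sum.cong) (auto simp: dual_orthogonality c)
    also have "\<dots> = F c * of_nat (degree c)" using c finite_dual by simp
    finally show ?thesis .
  qed
  have pair: "(\<Sum>x\<in>carrier G. \<phi> x * character c x) = F c * of_nat (degree c)" if c: "c \<in> dual G" for c
  proof -
    let ?c = "rep_class G (conj_rep (rep c))"
    have "(\<Sum>x\<in>carrier G. cnj (\<eta> x) * character c x) = cnj (\<Sum>x\<in>carrier G. \<eta> x * character ?c x)"
      by (auto simp: conj_class_dual(2)[OF c] intro!: sum.cong)
    also have "\<dots> = F c * of_nat (degree c)"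
      unfolding \<eta>_pair[OF conj_class_dual(1)[OF c]]
      by (simp add: Fconj[OF c] Freal[OF c] conj_class_dual(3)[OF c])
    finally have "(\<Sum>x\<in>carrier G. (\<eta> x + cnj (\<eta> x)) * character c x) = 2 * (F c * of_nat (degree c))"
      by (simp add: distrib_right sum.distrib \<eta>_pair[OF c])
    moreover have "(\<Sum>x\<in>carrier G. (\<eta> x + cnj (\<eta> x)) * character c x) = 2 * (\<Sum>x\<in>carrier G. \<phi> x * character c x)"
      unfolding sum_distrib_left
      by (intro sum.cong refl) (simp add: \<phi>_def on_group_def complex_add_cnj)
    ultimately show ?thesis by simp
  qed
  have "\<phi> \<in> adm_kernels"
    unfolding adm_kernels_def
  proof (intro CollectI conjI ballI)
    show "\<phi> \<in> L2 G" by (simp add: \<phi>_def)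
    show "\<phi> x \<in> \<real>" if "x \<in> carrier G" for x by (simp add: \<phi>_def on_group_def)
    show "\<phi> (inv x) = \<phi> x" if x: "x \<in> carrier G" for x
    proof -
      \<comment> \<open>Unitarity conjugates the characters at \<open>inv x\<close>, and
        \<open>F\<close> is real; taking real parts makes the kernel symmetric.\<close>
      have "\<eta> (inv x) = cnj (\<eta> x)"
        unfolding \<eta>_def complex_cnj_divide cnj_sum
        by (intro arg_cong2[of _ _ _ _ "(/)"] sum.cong)
          (auto simp: Freal trace_inv[OF dual_rep(1,2) x])
      then show ?thesis using x by (simp add: \<phi>_def on_group_def)
    qed
    \<comment> \<open>The total mass is the pairing with the trivial character, where
      \<open>F\<close> vanishes.\<close>
    have "(\<Sum>x\<in>carrier G. \<phi> x) = (\<Sum>x\<in>carrier G. \<phi> x * character (rep_class G trivial_rep) x)"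
      by (intro sum.cong) (auto simp: character_trivial)
    also have "\<dots> = 0"
      unfolding pair[OF rep_class_dual(1)[OF trivial_rep_irreducible]] by (simp add: Ftriv)
    finally show "(\<Sum>x\<in>carrier G. \<phi> x) = 0" .
  qed
  moreover have "\<phi> \<in> class_functions"
    unfolding class_functions_def
  proof (intro CollectI ballI)
    fix x y assume xy: "x \<in> carrier G" "y \<in> carrier G"
    have "character c (x \<otimes> y) = character c (y \<otimes> x)" if "c \<in> dual G" for c
      using trace_class_function[OF dual_rep(1)[OF that]] xy by (simp add: class_functions_def)
    then have "\<eta> (x \<otimes> y) = \<eta> (y \<otimes> x)" by (simp add: \<eta>_def)
    then show "\<phi> (x \<otimes> y) = \<phi> (y \<otimes> x)" using xy by (simp add: \<phi>_def on_group_def)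
  qed
  moreover have "omega G rep (conv_op G \<phi>) = F"
  proof
    fix c
    show "omega G rep (conv_op G \<phi>) c = F c"
      using pair[of c] F0[of c] irreducibleD(1)[OF dual_rep(1)[of c]]
      by (simp add: omega_conv_op[OF \<open>\<phi> \<in> adm_kernels\<close>])
  qed
  ultimately show thesis by (rule that)
qed

lemma subspace_symmetric_dual_functions: "rfun.subspace (symmetric_dual_functions G)"
  by (rule rfun.subspaceI) (auto simp: symmetric_dual_functions_def rscale_def)

lemma omega_image: "omega G rep ` admissible G = symmetric_dual_functions G"
proof
  show "omega G rep ` admissible G \<subseteq> symmetric_dual_functions G"
    unfolding admissible_eq using omega_symmetric by blast
  show "symmetric_dual_functions G \<subseteq> omega G rep ` admissible G"
  proof
    fix F assume "F \<in> symmetric_dual_functions G"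
    then obtain \<phi> where "\<phi> \<in> adm_kernels" "omega G rep (conv_op G \<phi>) = F"
      by (rule omega_surjective)
    then show "F \<in> omega G rep ` admissible G" unfolding admissible_eq by blast
  qed
qed

text \<open>Replacing \<phi> by its conjugation average leaves \<open>omega\<close> unchanged and
  produces a class function, on which \<open>omega\<close> is injective.\<close>

lemma omega_kernel:
  "{T \<in> admissible G. omega G rep T = 0} =
    {conv_op G \<phi> | \<phi>. \<phi> \<in> L2 G \<and> conv_op G \<phi> \<in> admissible G \<and> conj_avg G \<phi> = 0}"
proof (intro equalityI subsetI)
  fix T assume "T \<in> {T \<in> admissible G. omega G rep T = 0}"
  then obtain \<phi> where \<phi>: "\<phi> \<in> adm_kernels" "T = conv_op G \<phi>" "omega G rep (conv_op G \<phi>) = 0"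
    by (auto simp: admissible_eq)
  have "conj_avg G \<phi> = 0"
    using \<phi> by (intro omega_class_function_inj conj_avg_adm_kernel conj_avg_class_function)
      (simp_all add: omega_conj_avg)
  then show "T \<in> {conv_op G \<phi> | \<phi>. \<phi> \<in> L2 G \<and> conv_op G \<phi> \<in> admissible G \<and> conj_avg G \<phi> = 0}"
    using \<phi>(1,2) adm_kernels_L2 conv_op_admissible by blast
next
  fix T assume "T \<in> {conv_op G \<phi> | \<phi>. \<phi> \<in> L2 G \<and> conv_op G \<phi> \<in> admissible G \<and> conj_avg G \<phi> = 0}"
  then obtain \<phi> where \<phi>: "T = conv_op G \<phi>" "\<phi> \<in> L2 G" "conv_op G \<phi> \<in> admissible G" "conj_avg G \<phi> = 0"
    by blast
  \<comment> \<open>Admissibility is given for the operator only; uniqueness of the kernel transfers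
    it to \<phi> itself.\<close>
  obtain \<psi> where \<psi>: "\<psi> \<in> adm_kernels" "conv_op G \<phi> = conv_op G \<psi>"
    by (rule admissible_conv_op[OF \<phi>(3)])
  have eq: "\<phi> = \<psi>" by (rule conv_op_inj[OF \<phi>(2) adm_kernels_L2[OF \<psi>(1)] \<psi>(2)])
  have "0 \<in> adm_kernels" by (rule rfun.subspace_0[OF subspace_adm_kernels])
  then have "omega G rep (conv_op G 0) = 0" by (auto simp: omega_conv_op fun_eq_iff)
  then have "omega G rep (conv_op G \<phi>) = 0"
    using omega_conj_avg[of \<phi>] \<phi>(4) \<psi>(1) eq by simp
  then show "T \<in> {T \<in> admissible G. omega G rep T = 0}" using \<phi> by simp
qed

text \<open>Linearity reduces injectivity to a trivial kernel among class functions. Surjectivity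
  survives the restriction because the preimage found by Fourier inversion is already a class
  function.\<close>

lemma omega_bij: "bij_betw (omega G rep) (laplacian_span G) (symmetric_dual_functions G)"
  unfolding bij_betw_def
proof
  show "inj_on (omega G rep) (laplacian_span G)"
  proof (rule inj_onI)
    fix S T assume "S \<in> laplacian_span G" "T \<in> laplacian_span G" and eq: "omega G rep S = omega G rep T"
    then obtain \<phi> \<psi> where \<phi>: "\<phi> \<in> adm_kernels" "\<phi> \<in> class_functions" "S = conv_op G \<phi>"
      and \<psi>: "\<psi> \<in> adm_kernels" "\<psi> \<in> class_functions" "T = conv_op G \<psi>"
      by (auto simp: laplacian_span_eq)
    have "omega G rep (conv_op G (\<phi> - \<psi>)) = 0"
      using omega_diff[OF \<phi>(1) \<psi>(1)] eq \<phi>(3) \<psi>(3) by (simp add: conv_op_diff)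
    then have "\<phi> - \<psi> = 0"
      by (intro omega_class_function_inj rfun.subspace_diff subspace_adm_kernels
        subspace_class_functions \<phi> \<psi>)
    then show "S = T" using \<phi>(3) \<psi>(3) by simp
  qed
  show "omega G rep ` laplacian_span G = symmetric_dual_functions G"
  proof
    show "omega G rep ` laplacian_span G \<subseteq> symmetric_dual_functions G"
      unfolding laplacian_span_eq using omega_symmetric by blast
    show "symmetric_dual_functions G \<subseteq> omega G rep ` laplacian_span G"
    proof
      fix F assume "F \<in> symmetric_dual_functions G"
      then obtain \<phi> where "\<phi> \<in> adm_kernels" "\<phi> \<in> class_functions" "omega G rep (conv_op G \<phi>) = F"
        by (rule omega_surjective)
      then show "F \<in> omega G rep ` laplacian_span G" unfolding laplacian_span_eq by blast
    qed
  qed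
qed

lemma laplacian_span_commutant:
  "laplacian_span G =
    {T \<in> admissible G. \<forall>b\<in>carrier G. \<forall>f\<in>L2 G. T (right_trans G b f) = right_trans G b (T f)}"
proof (intro equalityI subsetI)
  fix T assume "T \<in> laplacian_span G"
  then obtain \<phi> where "\<phi> \<in> adm_kernels" "\<phi> \<in> class_functions" "T = conv_op G \<phi>"
    by (auto simp: laplacian_span_eq)
  then show "T \<in> {T \<in> admissible G. \<forall>b\<in>carrier G. \<forall>f\<in>L2 G. T (right_trans G b f) = right_trans G b (T f)}"
    using conv_op_admissible conv_op_commute_right_iff[of \<phi>] by simp
next
  fix T assume T: "T \<in> {T \<in> admissible G. \<forall>b\<in>carrier G. \<forall>f\<in>L2 G. T (right_trans G b f) = right_trans G b (T f)}"
  then obtain \<phi> where \<phi>: "\<phi> \<in> adm_kernels" "T = conv_op G \<phi>"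
    by (auto elim: admissible_conv_op)
  then have "\<phi> \<in> class_functions" using T conv_op_commute_right_iff[of \<phi>] by simp
  then show "T \<in> laplacian_span G" using \<phi> by (simp add: laplacian_span_eq)
qed

end

theorem theorem2:
  fixes G :: "('a, 'm) monoid_scheme"
    and rep :: "('a \<Rightarrow> complex mat) set \<Rightarrow> 'a \<Rightarrow> complex mat"
  assumes "group G" and "finite (carrier G)" and "unitary_choice G rep"
  shows "rop.subspace (admissible G) \<and>
    rfun.subspace (symmetric_dual_functions G) \<and>
    (\<forall>S\<in>admissible G. \<forall>T\<in>admissible G.
       omega G rep (S + T) = omega G rep S + omega G rep T) \<and>
    (\<forall>r. \<forall>T\<in>admissible G. omega G rep (opscale r T) = rscale r (omega G rep T)) \<and>
    omega G rep ` admissible G = symmetric_dual_functions G \<and>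
    {T \<in> admissible G. omega G rep T = 0} =
      {conv_op G \<phi> | \<phi>. \<phi> \<in> L2 G \<and> conv_op G \<phi> \<in> admissible G \<and> conj_avg G \<phi> = 0} \<and>
    bij_betw (omega G rep) (laplacian_span G) (symmetric_dual_functions G) \<and>
    laplacian_span G =
      {T \<in> admissible G. \<forall>b\<in>carrier G. \<forall>f\<in>L2 G.
         T (right_trans G b f) = right_trans G b (T f)}"
proof -
  interpret finite_group_dual G rep
    by (intro finite_group_dual.intro finite_group.intro finite_group_axioms.intro
      finite_group_dual_axioms.intro assms)
  show ?thesis
  proof (intro conjI)
    show "rop.subspace (admissible G)"
      unfolding admissible_eq by (rule subspace_conv_op_image[OF subspace_adm_kernels])
    show "rfun.subspace (symmetric_dual_functions G)"
      by (rule subspace_symmetric_dual_functions)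
    show "\<forall>S\<in>admissible G. \<forall>T\<in>admissible G. omega G rep (S + T) = omega G rep S + omega G rep T"
      using omega_add by (auto simp: admissible_eq)
    show "\<forall>r. \<forall>T\<in>admissible G. omega G rep (opscale r T) = rscale r (omega G rep T)"
      using omega_opscale by (auto simp: admissible_eq)
  qed (rule omega_image omega_kernel omega_bij laplacian_span_commutant)+
qed

end
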